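(* Let $F(X_1,\ldots,X_n)=\sum_{\alpha\in\mathbb{F}_n^+}A_{(\alpha)}\otimes X_\alpha$, $A_{(\alpha)}\in B(\mathcal{K})$, be a free holomorphic function on $[B(\mathcal{H})^n]_1$ with the properties: (i) $\|F\|_\infty\le1$, and (ii) $A_{(\beta)}=0$ for any $\beta\in\mathbb{F}_n^+$ with $|\beta|\le m-1$, where $m\in\{1,2,\ldots\}$. Then $$\|F(X_1,\ldots,X_n)\|\le\|[X_1,\ldots,X_n]\|^m\quad\text{and}\quad r(F(X_1,\ldots,X_n))\le r(X_1,\ldots,X_n)^m$$ for any $[X_1,\ldots,X_n]\in[B(\mathcal{H})^n]_1$. Moreover, $$\Big\|\sum_{|\alpha|=k}A_{(\alpha)}^*A_{(\alpha)}\Big\|^{1/2}\le1\quad\text{for any }k\ge m.$$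
   Context: $\mathbb{F}_n^+$ is the unital free semigroup on generators $g_1,\ldots,g_n$ with identity $g_0$; $|\alpha|$ is word length; $X_\alpha:=X_{i_1}\cdots X_{i_k}$ if $\alpha=g_{i_1}\cdots g_{i_k}$ and $X_{g_0}:=I$. $\mathcal{H},\mathcal{K}$ are Hilbert spaces, $\|[X_1,\ldots,X_n]\|:=\|\sum_iX_iX_i^*\|^{1/2}$, and $[B(\mathcal{H})^n]_1$ is the set of $n$-tuples in $B(\mathcal{H})^n$ with $\|[X_1,\ldots,X_n]\|<1$. A free holomorphic function on $[B(\mathcal{H})^n]_1$ with coefficients in $B(\mathcal{K})$ is a map $F(X_1,\ldots,X_n)=\sum_{k=0}^\infty\sum_{|\alpha|=k}A_{(\alpha)}\otimes X_\alpha\in B(\mathcal{K}\otimes\mathcal{H})$, where $A_{(\alpha)}\in B(\mathcal{K})$ satisfy $\limsup_{k\to\infty}\|\sum_{|\alpha|=k}A_{(\alpha)}^*A_{(\alpha)}\|^{1/2k}\le1$; the series converges in norm on the open unit ball over every Hilbert space. $\|F\|_\infty:=\sup\|F(X_1,\ldots,X_n)\|$, the supremum being over all $n$-tuples in $[B(\mathcal{E})^n]_1$ and all Hilbert spaces $\mathcal{E}$. $r(X_1,\ldots,X_n):=\lim_{k\to\infty}\|\sum_{|\alpha|=k}X_\alpha X_\alpha^*\|^{1/2k}$ is the joint spectral radius, and $r(F(X_1,\ldots,X_n))$ is the usual spectral radius of the single operator $F(X_1,\ldots,X_n)$. *)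

theory Defs
  imports
    "HOL-Analysis.Analysis"
    "HOL-Algebra.Module"
begin

text \<open>
  Hilbert spaces are carrier-based structures, so that the supremum norm below can range over
  all Hilbert spaces whose vectors are drawn from a given type. They extend the modules of
  HOL-Algebra over the ring of complex numbers; the ring multiplication and unit that the
  record type of modules carries along are never used.
\<close>

definition complex_ring :: "complex ring" where
  "complex_ring = \<lparr>carrier = UNIV, mult = (*), one = 1, zero = 0, add = (+)\<rparr>"

record 'a hilbert = "(complex, 'a) module" +
  inner_prod :: "'a \<Rightarrow> 'a \<Rightarrow> complex"

definition vnorm :: "'a hilbert \<Rightarrow> 'a \<Rightarrow> real" where
  "vnorm V x = sqrt (Re (inner_prod V x x))"

text \<open>The inner product is linear in its first argument.\<close>

locale complex_hilbert_space = module complex_ring V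
  for V :: "'a hilbert" +
  assumes inner_add: "\<lbrakk>x \<in> carrier V; y \<in> carrier V; z \<in> carrier V\<rbrakk>
      \<Longrightarrow> inner_prod V (x \<oplus>\<^bsub>V\<^esub> y) z = inner_prod V x z + inner_prod V y z"
    and inner_smult: "\<lbrakk>x \<in> carrier V; y \<in> carrier V\<rbrakk>
      \<Longrightarrow> inner_prod V (c \<odot>\<^bsub>V\<^esub> x) y = c * inner_prod V x y"
    and inner_cnj: "\<lbrakk>x \<in> carrier V; y \<in> carrier V\<rbrakk>
      \<Longrightarrow> inner_prod V y x = cnj (inner_prod V x y)"
    and inner_nonneg: "x \<in> carrier V \<Longrightarrow> 0 \<le> Re (inner_prod V x x)"
    and inner_definite: "\<lbrakk>x \<in> carrier V; inner_prod V x x = 0\<rbrakk> \<Longrightarrow> x = \<zero>\<^bsub>V\<^esub>"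
    and complete: "\<lbrakk>\<And>i::nat. s i \<in> carrier V;
        \<And>e. e > 0 \<Longrightarrow> \<exists>N. \<forall>i\<ge>N. \<forall>j\<ge>N. vnorm V (s i \<ominus>\<^bsub>V\<^esub> s j) < e\<rbrakk>
      \<Longrightarrow> \<exists>l\<in>carrier V. (\<lambda>i. vnorm V (s i \<ominus>\<^bsub>V\<^esub> l)) \<longlonglongrightarrow> 0"


subsection \<open>Bounded operators\<close>

text \<open>
  Operators are extensional functions (undefined off the carrier), so that equality of
  functions is equality of operators.
\<close>

definition bounded_ops :: "'a hilbert \<Rightarrow> ('a \<Rightarrow> 'a) set" where
  "bounded_ops V = {S \<in> carrier V \<rightarrow>\<^sub>E carrier V.
     (\<forall>x\<in>carrier V. \<forall>y\<in>carrier V. S (x \<oplus>\<^bsub>V\<^esub> y) = S x \<oplus>\<^bsub>V\<^esub> S y) \<and>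
     (\<forall>c. \<forall>x\<in>carrier V. S (c \<odot>\<^bsub>V\<^esub> x) = c \<odot>\<^bsub>V\<^esub> S x) \<and>
     (\<exists>b. \<forall>x\<in>carrier V. vnorm V (S x) \<le> b * vnorm V x)}"

definition op_norm :: "'a hilbert \<Rightarrow> ('a \<Rightarrow> 'a) \<Rightarrow> real" where
  "op_norm V S = (SUP x\<in>{x \<in> carrier V. vnorm V x \<le> 1}. vnorm V (S x))"

definition op_id :: "'a hilbert \<Rightarrow> 'a \<Rightarrow> 'a" where
  "op_id V = (\<lambda>x\<in>carrier V. x)"

definition op_zero :: "'a hilbert \<Rightarrow> 'a \<Rightarrow> 'a" where
  "op_zero V = (\<lambda>x\<in>carrier V. \<zero>\<^bsub>V\<^esub>)"

definition op_smult :: "'a hilbert \<Rightarrow> complex \<Rightarrow> ('a \<Rightarrow> 'a) \<Rightarrow> 'a \<Rightarrow> 'a" where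
  "op_smult V c S = (\<lambda>x\<in>carrier V. c \<odot>\<^bsub>V\<^esub> S x)"

definition op_diff :: "'a hilbert \<Rightarrow> ('a \<Rightarrow> 'a) \<Rightarrow> ('a \<Rightarrow> 'a) \<Rightarrow> 'a \<Rightarrow> 'a" where
  "op_diff V S R = (\<lambda>x\<in>carrier V. S x \<ominus>\<^bsub>V\<^esub> R x)"

definition op_sum :: "'a hilbert \<Rightarrow> ('i \<Rightarrow> 'a \<Rightarrow> 'a) \<Rightarrow> 'i set \<Rightarrow> 'a \<Rightarrow> 'a" where
  "op_sum V S I = (\<lambda>x\<in>carrier V. finsum V (\<lambda>i. S i x) I)"

definition op_mult :: "'a hilbert \<Rightarrow> ('a \<Rightarrow> 'a) \<Rightarrow> ('a \<Rightarrow> 'a) \<Rightarrow> 'a \<Rightarrow> 'a" where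
  "op_mult V S R = compose (carrier V) S R"

definition adjoint :: "'a hilbert \<Rightarrow> ('a \<Rightarrow> 'a) \<Rightarrow> 'a \<Rightarrow> 'a" where
  "adjoint V S = (THE R. R \<in> bounded_ops V \<and>
     (\<forall>x\<in>carrier V. \<forall>y\<in>carrier V. inner_prod V (S x) y = inner_prod V x (R y)))"

definition op_spectrum :: "'a hilbert \<Rightarrow> ('a \<Rightarrow> 'a) \<Rightarrow> complex set" where
  "op_spectrum V S = {c. \<not> (\<exists>R\<in>bounded_ops V.
     op_mult V R (op_diff V (op_smult V c (op_id V)) S) = op_id V \<and>
     op_mult V (op_diff V (op_smult V c (op_id V)) S) R = op_id V)}"

text \<open>
  The inserted \<open>0\<close> matters only on the zero space, where the spectrum is empty and the
  spectral radius is \<open>0\<close>.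
\<close>

definition op_spectral_radius :: "'a hilbert \<Rightarrow> ('a \<Rightarrow> 'a) \<Rightarrow> real" where
  "op_spectral_radius V S = Sup (insert 0 (cmod ` op_spectrum V S))"


subsection \<open>Tuples of operators\<close>

text \<open>
  The generators \<open>g\<^sub>1, \<dots>, g\<^sub>n\<close> are the elements of a finite type \<open>'n\<close> with
  \<open>n = CARD('n)\<close>; the free semigroup is \<open>'n list\<close> with \<open>g\<^sub>0 = []\<close>.
\<close>

definition words :: "nat \<Rightarrow> 'n list set" where
  "words k = {w. length w = k}"

primrec word_op :: "'a hilbert \<Rightarrow> ('n \<Rightarrow> 'a \<Rightarrow> 'a) \<Rightarrow> 'n list \<Rightarrow> 'a \<Rightarrow> 'a" where
  "word_op V X [] = op_id V"
| "word_op V X (i # w) = op_mult V (X i) (word_op V X w)"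

definition row_norm :: "'a hilbert \<Rightarrow> ('n::finite \<Rightarrow> 'a \<Rightarrow> 'a) \<Rightarrow> real" where
  "row_norm V X = sqrt (op_norm V (op_sum V (\<lambda>i. op_mult V (X i) (adjoint V (X i))) UNIV))"

definition row_ball :: "'a hilbert \<Rightarrow> ('n::finite \<Rightarrow> 'a \<Rightarrow> 'a) set" where
  "row_ball V = {X. (\<forall>i. X i \<in> bounded_ops V) \<and> row_norm V X < 1}"

definition joint_spectral_radius :: "'a hilbert \<Rightarrow> ('n::finite \<Rightarrow> 'a \<Rightarrow> 'a) \<Rightarrow> real" where
  "joint_spectral_radius V X = lim (\<lambda>k.
     op_norm V (op_sum V (\<lambda>w. op_mult V (word_op V X w) (adjoint V (word_op V X w))) (words k))
       powr (1 / (2 * real k)))"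


subsection \<open>Hilbert tensor products\<close>

text \<open>
  \<open>hilbert_tensor K H T t\<close>: the Hilbert space \<open>T\<close> with the map \<open>t\<close>, written
  \<open>x, y \<mapsto> x \<otimes> y\<close>, is a Hilbert tensor product of \<open>K\<close> and \<open>H\<close>. This determines
  \<open>(T, t)\<close> up to a unique unitary.
\<close>

definition hilbert_tensor ::
  "'k hilbert \<Rightarrow> 'h hilbert \<Rightarrow> 't hilbert \<Rightarrow> ('k \<Rightarrow> 'h \<Rightarrow> 't) \<Rightarrow> bool" where
  "hilbert_tensor K H T t \<longleftrightarrow>
     complex_hilbert_space T \<and>
     (\<forall>x\<in>carrier K. \<forall>y\<in>carrier H. t x y \<in> carrier T) \<and>
     (\<forall>x\<in>carrier K. \<forall>x'\<in>carrier K. \<forall>y\<in>carrier H. t (x \<oplus>\<^bsub>K\<^esub> x') y = t x y \<oplus>\<^bsub>T\<^esub> t x' y) \<and>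
     (\<forall>x\<in>carrier K. \<forall>y\<in>carrier H. \<forall>y'\<in>carrier H. t x (y \<oplus>\<^bsub>H\<^esub> y') = t x y \<oplus>\<^bsub>T\<^esub> t x y') \<and>
     (\<forall>c. \<forall>x\<in>carrier K. \<forall>y\<in>carrier H.
        t (c \<odot>\<^bsub>K\<^esub> x) y = c \<odot>\<^bsub>T\<^esub> t x y \<and> t x (c \<odot>\<^bsub>H\<^esub> y) = c \<odot>\<^bsub>T\<^esub> t x y) \<and>
     (\<forall>x\<in>carrier K. \<forall>x'\<in>carrier K. \<forall>y\<in>carrier H. \<forall>y'\<in>carrier H.
        inner_prod T (t x y) (t x' y') = inner_prod K x x' * inner_prod H y y') \<and>
     (\<forall>v\<in>carrier T. \<forall>e>0. \<exists>(N::nat) f g.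
        (\<forall>i<N. f i \<in> carrier K \<and> g i \<in> carrier H) \<and>
        vnorm T (v \<ominus>\<^bsub>T\<^esub> finsum T (\<lambda>i. t (f i) (g i)) {..<N}) < e)"

definition tensor_op ::
  "'k hilbert \<Rightarrow> 'h hilbert \<Rightarrow> 't hilbert \<Rightarrow> ('k \<Rightarrow> 'h \<Rightarrow> 't)
     \<Rightarrow> ('k \<Rightarrow> 'k) \<Rightarrow> ('h \<Rightarrow> 'h) \<Rightarrow> 't \<Rightarrow> 't" where
  "tensor_op K H T t A S = (THE R. R \<in> bounded_ops T \<and>
     (\<forall>x\<in>carrier K. \<forall>y\<in>carrier H. R (t x y) = t (A x) (S y)))"


subsection \<open>Free holomorphic functions\<close>

text \<open>
  A free holomorphic function is given by its coefficients \<open>A w\<close>; its value at \<open>X\<close> on a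
  Hilbert space \<open>H\<close> is the operator-norm limit \<open>free_eval K H T t A X\<close> on the tensor
  product \<open>T\<close> of \<open>K\<close> and \<open>H\<close>.
\<close>

definition coeff_norm :: "'k hilbert \<Rightarrow> ('n::finite list \<Rightarrow> 'k \<Rightarrow> 'k) \<Rightarrow> nat \<Rightarrow> real" where
  "coeff_norm K A k = op_norm K (op_sum K (\<lambda>w. op_mult K (adjoint K (A w)) (A w)) (words k))"

definition free_holomorphic :: "'k hilbert \<Rightarrow> ('n::finite list \<Rightarrow> 'k \<Rightarrow> 'k) \<Rightarrow> bool" where
  "free_holomorphic K A \<longleftrightarrow>
     (\<forall>w. A w \<in> bounded_ops K) \<and>
     limsup (\<lambda>k. ereal (coeff_norm K A k powr (1 / (2 * real k)))) \<le> 1"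

definition free_partial_sum ::
  "'k hilbert \<Rightarrow> 'h hilbert \<Rightarrow> 't hilbert \<Rightarrow> ('k \<Rightarrow> 'h \<Rightarrow> 't) \<Rightarrow> ('n::finite list \<Rightarrow> 'k \<Rightarrow> 'k)
     \<Rightarrow> ('n \<Rightarrow> 'h \<Rightarrow> 'h) \<Rightarrow> nat \<Rightarrow> 't \<Rightarrow> 't" where
  "free_partial_sum K H T t A X N =
     op_sum T (\<lambda>k. op_sum T (\<lambda>w. tensor_op K H T t (A w) (word_op H X w)) (words k)) {..<N}"

definition free_eval ::
  "'k hilbert \<Rightarrow> 'h hilbert \<Rightarrow> 't hilbert \<Rightarrow> ('k \<Rightarrow> 'h \<Rightarrow> 't) \<Rightarrow> ('n::finite list \<Rightarrow> 'k \<Rightarrow> 'k)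
     \<Rightarrow> ('n \<Rightarrow> 'h \<Rightarrow> 'h) \<Rightarrow> 't \<Rightarrow> 't" where
  "free_eval K H T t A X = (THE S. S \<in> bounded_ops T \<and>
     (\<lambda>N. op_norm T (op_diff T (free_partial_sum K H T t A X N) S)) \<longlonglongrightarrow> 0)"

text \<open>
  The supremum ranges over all Hilbert spaces \<open>E\<close> with vectors in the type \<open>'u\<close> of the
  vectors of \<open>K\<close>. If \<open>K\<close> is not the zero space, \<open>'u\<close> has at least the cardinality of the
  continuum, so all separable Hilbert spaces occur up to unitary equivalence. The tensor
  product of \<open>K\<close> and \<open>E\<close> ranges over its realisations on the type \<open>'u \<Rightarrow> 'u\<close>, and these always
  exist: given an orthonormal basis \<open>B\<close> of \<open>E\<close>, take the square-summable functions
  from \<open>B\<close> to \<open>K\<close>, extended by \<open>\<zero>\<close> off \<open>B\<close>, with \<open>x \<otimes> y\<close> mapping \<open>b\<close> to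
  \<open>\<langle>y, b\<rangle> x\<close>. The value is in the extended reals, as the supremum can be infinite.
\<close>

definition free_sup_norm :: "'u hilbert \<Rightarrow> ('n::finite list \<Rightarrow> 'u \<Rightarrow> 'u) \<Rightarrow> ereal" where
  "free_sup_norm K A = Sup {ereal (op_norm T (free_eval K E T t A X)) |
     (E :: 'u hilbert) (T :: ('u \<Rightarrow> 'u) hilbert) t X.
     complex_hilbert_space E \<and> hilbert_tensor K E T t \<and> X \<in> row_ball E}"

end

theory Submission
  imports Defs "HOL-Complex_Analysis.Complex_Analysis"
begin

text \<open>
  For \<open>u, v\<close> in \<open>K \<otimes> H\<close> the function \<open>z \<mapsto> \<langle>F(z X) u, v\<rangle>\<close> is a power series without terms of
  degree less than \<open>m\<close>, bounded by \<open>\<parallel>u\<parallel> \<parallel>v\<parallel>\<close> for \<open>|z| < 1 / \<parallel>X\<parallel>\<close>; the Schwarz lemma gives the first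
  inequality. For the spectral radius let \<open>r(X) < \<rho> < 1\<close>. As in Rota's theorem, the operator
  \<open>P = \<Sum>\<^sub>w \<rho>\<^bsup>-2|w|\<^esup> X\<^sub>w X\<^sub>w\<^sup>*\<close> is bounded and at least \<open>I\<close>, and the row norm of \<open>X\<close> with respect to the
  equivalent inner product \<open>\<langle>P\<^sup>-\<^sup>1 x, y\<rangle>\<close> is at most \<open>\<rho>\<close>. The first inequality in the new norm bounds
  the spectral radius of \<open>F(X)\<close> by \<open>\<rho>\<^sup>m\<close>. The coefficients are estimated by evaluating \<open>F\<close> at the
  multiples \<open>r S\<close>, \<open>r < 1\<close>, of the creation operators on the Fock space truncated at degree \<open>k\<close>:
  the vector \<open>F(r S) (x \<otimes> 1)\<close> has the components \<open>r\<^bsup>|w|\<^esup> A\<^sub>w x\<close>.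
\<close>

section \<open>Inner products and the Riesz representation\<close>

text \<open>Two obstacles shape the proof. The supremum in \<open>free_sup_norm\<close> sees only
  spaces with vectors in \<open>'u\<close> and tensor products realised on
  \<open>'u \<Rightarrow> 'u\<close>, while the spaces needed live on other types. Spaces are
  therefore copied along injections, and values of F are compared only through scalars on elementary
  tensors. Truncating the Fock space makes its embedding easy: a finite power of the complex numbers
  injects into the complex numbers, and these inject into K as the multiples of a nonzero vector.
  The other obstacle is that a change of norm on H must be matched by one on the tensor product with
  K. Rota's construction is repeated there, with the identity of K tensored to each operator; the
  resulting form is the product of the inner product of K with the form on H. The inverse of P
  occurs because the row norm is a statement about adjoints: for the form
  \<open>\<langle>P\<^sup>-\<^sup>1 x, y\<rangle>\<close> it is at most \<rho> exactly when
  \<open>\<Sum>\<^sub>i X\<^sub>i P X\<^sub>i\<^sup>* \<le> \<rho>\<^sup>2 P\<close>, and this holds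
  because the left side is the series of P shifted by one degree.\<close>

lemma complex_ring_simps [simp]:
  "carrier complex_ring = UNIV" "x \<otimes>\<^bsub>complex_ring\<^esub> y = x * y" "\<one>\<^bsub>complex_ring\<^esub> = 1"
  "\<zero>\<^bsub>complex_ring\<^esub> = 0" "x \<oplus>\<^bsub>complex_ring\<^esub> y = x + y"
  by (simp_all add: complex_ring_def)

lemma cring_complex_ring: "cring complex_ring"
proof (rule cringI)
  show "abelian_group complex_ring"
  proof (rule abelian_groupI)
    fix x :: complex
    show "\<exists>y\<in>carrier complex_ring. y \<oplus>\<^bsub>complex_ring\<^esub> x = \<zero>\<^bsub>complex_ring\<^esub>"
      by (rule bexI[of _ "-x"]) auto
  qed auto
  show "Group.comm_monoid complex_ring"
    by (rule comm_monoidI) auto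
qed (auto simp: algebra_simps)

lemma null_comparison:
  assumes "\<And>i. norm (f i) \<le> g i" "(g \<longlongrightarrow> 0) F"
  shows "(f \<longlongrightarrow> 0) F"
  by (rule Lim_null_comparison[OF always_eventually assms(2)]) (use assms(1) in blast)

text \<open>The predicate is assumed instead of being extended, so that only the facts re-exported
  below, with plain complex scalars, are visible. The module locale is interpreted locally where its
  axioms are used.\<close>

locale hilb =
  fixes V :: "'a hilbert" (structure)
  assumes hilbert: "complex_hilbert_space V"
begin

lemma add_closed [simp, intro]: "x \<in> carrier V \<Longrightarrow> y \<in> carrier V \<Longrightarrow> x \<oplus> y \<in> carrier V"
  and zero_closed [simp, intro]: "\<zero> \<in> carrier V"
  and smult_closed [simp, intro]: "x \<in> carrier V \<Longrightarrow> c \<odot> x \<in> carrier V"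
  and minus_closed [simp, intro]: "x \<in> carrier V \<Longrightarrow> y \<in> carrier V \<Longrightarrow> x \<ominus> y \<in> carrier V"
  and finsum_empty [simp]: "finsum V f {} = \<zero>"
  and finsum_insert: "finite I \<Longrightarrow> i \<notin> I \<Longrightarrow> f \<in> I \<rightarrow> carrier V \<Longrightarrow> f i \<in> carrier V \<Longrightarrow>
      finsum V f (insert i I) = f i \<oplus> finsum V f I"
  and finsum_closed [simp, intro]: "f \<in> I \<rightarrow> carrier V \<Longrightarrow> finsum V f I \<in> carrier V"
  and smult_one [simp]: "x \<in> carrier V \<Longrightarrow> 1 \<odot> x = x"
proof -
  interpret M: complex_hilbert_space V by (rule hilbert)
  show "x \<in> carrier V \<Longrightarrow> y \<in> carrier V \<Longrightarrow> x \<oplus> y \<in> carrier V"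
    "\<zero> \<in> carrier V" "x \<in> carrier V \<Longrightarrow> y \<in> carrier V \<Longrightarrow> x \<ominus> y \<in> carrier V"
    "f \<in> I \<rightarrow> carrier V \<Longrightarrow> finsum V f I \<in> carrier V"
    "finsum V f {} = \<zero>"
    by auto
  show "finite I \<Longrightarrow> i \<notin> I \<Longrightarrow> f \<in> I \<rightarrow> carrier V \<Longrightarrow> f i \<in> carrier V \<Longrightarrow>
      finsum V f (insert i I) = f i \<oplus> finsum V f I"
    by (rule M.finsum_insert)
  show "x \<in> carrier V \<Longrightarrow> c \<odot> x \<in> carrier V"
    using M.smult_closed[of c x] by simp
  show "x \<in> carrier V \<Longrightarrow> 1 \<odot> x = x"
    using M.smult_one[of x] by simp
qed

lemma ip_add_left [simp]: "\<lbrakk>x \<in> carrier V; y \<in> carrier V; z \<in> carrier V\<rbrakk>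
    \<Longrightarrow> inner_prod V (x \<oplus> y) z = inner_prod V x z + inner_prod V y z"
  and ip_smult_left [simp]: "\<lbrakk>x \<in> carrier V; y \<in> carrier V\<rbrakk>
    \<Longrightarrow> inner_prod V (c \<odot> x) y = c * inner_prod V x y"
  and ip_cnj: "\<lbrakk>x \<in> carrier V; y \<in> carrier V\<rbrakk> \<Longrightarrow> inner_prod V y x = cnj (inner_prod V x y)"
  and ip_nonneg: "x \<in> carrier V \<Longrightarrow> 0 \<le> Re (inner_prod V x x)"
  and ip_definite: "\<lbrakk>x \<in> carrier V; inner_prod V x x = 0\<rbrakk> \<Longrightarrow> x = \<zero>"
  and complete: "\<lbrakk>\<And>i::nat. s i \<in> carrier V;
        \<And>e. e > 0 \<Longrightarrow> \<exists>N. \<forall>i\<ge>N. \<forall>j\<ge>N. vnorm V (s i \<ominus> s j) < e\<rbrakk>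
      \<Longrightarrow> \<exists>l\<in>carrier V. (\<lambda>i. vnorm V (s i \<ominus> l)) \<longlonglongrightarrow> 0"
proof -
  interpret M: complex_hilbert_space V by (rule hilbert)
  show "\<lbrakk>x \<in> carrier V; y \<in> carrier V; z \<in> carrier V\<rbrakk>
    \<Longrightarrow> inner_prod V (x \<oplus> y) z = inner_prod V x z + inner_prod V y z" by (rule M.inner_add)
  show "\<lbrakk>x \<in> carrier V; y \<in> carrier V\<rbrakk>
    \<Longrightarrow> inner_prod V (c \<odot> x) y = c * inner_prod V x y" by (rule M.inner_smult)
  show "\<lbrakk>x \<in> carrier V; y \<in> carrier V\<rbrakk> \<Longrightarrow> inner_prod V y x = cnj (inner_prod V x y)"
    by (rule M.inner_cnj)
  show "x \<in> carrier V \<Longrightarrow> 0 \<le> Re (inner_prod V x x)" by (rule M.inner_nonneg)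
  show "\<lbrakk>x \<in> carrier V; inner_prod V x x = 0\<rbrakk> \<Longrightarrow> x = \<zero>" by (rule M.inner_definite)
  show "\<lbrakk>\<And>i::nat. s i \<in> carrier V;
        \<And>e. e > 0 \<Longrightarrow> \<exists>N. \<forall>i\<ge>N. \<forall>j\<ge>N. vnorm V (s i \<ominus> s j) < e\<rbrakk>
      \<Longrightarrow> \<exists>l\<in>carrier V. (\<lambda>i. vnorm V (s i \<ominus> l)) \<longlonglongrightarrow> 0" by (rule M.complete)
qed

lemma ip_zero_left [simp]: "y \<in> carrier V \<Longrightarrow> inner_prod V \<zero> y = 0"
proof -
  interpret M: complex_hilbert_space V by (rule hilbert)
  assume y: "y \<in> carrier V"
  have "inner_prod V (\<zero> \<oplus> \<zero>) y = inner_prod V \<zero> y" by simp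
  then show ?thesis using y by (simp del: M.l_zero M.r_zero)
qed

lemma ip_minus_left [simp]: "\<lbrakk>x \<in> carrier V; y \<in> carrier V; z \<in> carrier V\<rbrakk>
    \<Longrightarrow> inner_prod V (x \<ominus> y) z = inner_prod V x z - inner_prod V y z"
proof -
  interpret M: complex_hilbert_space V by (rule hilbert)
  assume "x \<in> carrier V" "y \<in> carrier V" "z \<in> carrier V"
  moreover from this have "inner_prod V ((x \<ominus> y) \<oplus> y) z = inner_prod V x z"
    by (simp add: M.minus_eq M.a_assoc M.l_neg)
  ultimately show ?thesis by (simp add: algebra_simps)
qed

lemma ip_add_right [simp]: "\<lbrakk>x \<in> carrier V; y \<in> carrier V; z \<in> carrier V\<rbrakk>
    \<Longrightarrow> inner_prod V z (x \<oplus> y) = inner_prod V z x + inner_prod V z y"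
  using ip_cnj[of "x \<oplus> y" z] ip_cnj[of x z] ip_cnj[of y z] by simp

lemma ip_minus_right [simp]: "\<lbrakk>x \<in> carrier V; y \<in> carrier V; z \<in> carrier V\<rbrakk>
    \<Longrightarrow> inner_prod V z (x \<ominus> y) = inner_prod V z x - inner_prod V z y"
  using ip_cnj[of "x \<ominus> y" z] ip_cnj[of x z] ip_cnj[of y z] by simp

lemma ip_smult_right [simp]: "\<lbrakk>x \<in> carrier V; y \<in> carrier V\<rbrakk>
    \<Longrightarrow> inner_prod V y (c \<odot> x) = cnj c * inner_prod V y x"
  using ip_cnj[of "c \<odot> x" y] ip_cnj[of x y] by simp

lemma ip_zero_right [simp]: "y \<in> carrier V \<Longrightarrow> inner_prod V y \<zero> = 0"
  using ip_cnj[of "\<zero>" y] by simp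

lemma ip_finsum_left:
  assumes "f \<in> I \<rightarrow> carrier V" "y \<in> carrier V" "finite I"
  shows "inner_prod V (finsum V f I) y = (\<Sum>i\<in>I. inner_prod V (f i) y)"
  using assms(3,1)
proof (induction I)
  case (insert i I)
  then have "f \<in> I \<rightarrow> carrier V" "f i \<in> carrier V" by auto
  then show ?case using insert assms(2) by (simp add: finsum_insert)
qed (use assms(2) in auto)

lemma ip_finsum_right:
  assumes "f \<in> I \<rightarrow> carrier V" "y \<in> carrier V" "finite I"
  shows "inner_prod V y (finsum V f I) = (\<Sum>i\<in>I. inner_prod V y (f i))"
proof -
  have "inner_prod V y (finsum V f I) = cnj (inner_prod V (finsum V f I) y)"
    using assms by (intro ip_cnj) auto
  also have "\<dots> = (\<Sum>i\<in>I. cnj (inner_prod V (f i) y))"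
    using assms by (simp add: ip_finsum_left)
  also have "\<dots> = (\<Sum>i\<in>I. inner_prod V y (f i))"
    using assms by (intro sum.cong refl ip_cnj[symmetric]) auto
  finally show ?thesis .
qed

lemma vnorm_nonneg [simp]: "x \<in> carrier V \<Longrightarrow> 0 \<le> vnorm V x"
  using ip_nonneg by (simp add: vnorm_def)

lemma vnorm_sq: "x \<in> carrier V \<Longrightarrow> (vnorm V x)\<^sup>2 = Re (inner_prod V x x)"
  using ip_nonneg by (simp add: vnorm_def)

lemma ip_self: "x \<in> carrier V \<Longrightarrow> inner_prod V x x = of_real ((vnorm V x)\<^sup>2)"
  using ip_cnj[of x x] Reals_cnj_iff[of "inner_prod V x x"] by (metis vnorm_sq of_real_Re)

lemma minus_self [simp]: "x \<in> carrier V \<Longrightarrow> x \<ominus> x = \<zero>"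
  by (rule ip_definite) auto

text \<open>The difference is orthogonal to itself. Most vector identities below go through this
  rule: the simp rules for \<open>inner_prod\<close> turn them into identities of complex
  numbers.\<close>

lemma eqI:
  assumes "x \<in> carrier V" "y \<in> carrier V"
    and "\<And>z. z \<in> carrier V \<Longrightarrow> inner_prod V x z = inner_prod V y z"
  shows "x = y"
proof -
  interpret M: complex_hilbert_space V by (rule hilbert)
  have "x \<ominus> y = \<zero>" by (rule ip_definite) (use assms in auto)
  moreover have "x = (x \<ominus> y) \<oplus> y"
    using assms by (simp add: M.minus_eq M.a_assoc M.l_neg)
  ultimately show ?thesis using assms by (metis M.l_zero)
qed

lemma vnorm_eq_0 [simp]: "x \<in> carrier V \<Longrightarrow> vnorm V x = 0 \<longleftrightarrow> x = \<zero>"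
  by (metis ip_definite ip_self ip_zero_left of_real_0 power_zero_numeral zero_closed of_real_eq_0_iff
      zero_eq_power2)

lemma vnorm_zero [simp]: "vnorm V \<zero> = 0" by simp

lemma vnorm_smult [simp]: "x \<in> carrier V \<Longrightarrow> vnorm V (c \<odot> x) = cmod c * vnorm V x"
proof -
  assume x: "x \<in> carrier V"
  have "inner_prod V (c \<odot> x) (c \<odot> x) = of_real ((cmod c)\<^sup>2) * inner_prod V x x"
    using x by (simp add: complex_norm_square mult.commute del: of_real_power)
  then show ?thesis unfolding vnorm_def
    by (simp only: times_complex.sel Re_complex_of_real Im_complex_of_real mult_zero_left diff_zero real_sqrt_mult real_sqrt_abs abs_norm_cancel)
qed

lemma vnorm_add_sq: "\<lbrakk>x \<in> carrier V; y \<in> carrier V\<rbrakk> \<Longrightarrow>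
    (vnorm V (x \<oplus> y))\<^sup>2 = (vnorm V x)\<^sup>2 + 2 * Re (inner_prod V x y) + (vnorm V y)\<^sup>2"
  using ip_cnj[of x y] by (simp add: vnorm_sq)

lemma vnorm_minus_sq: "\<lbrakk>x \<in> carrier V; y \<in> carrier V\<rbrakk> \<Longrightarrow>
    (vnorm V (x \<ominus> y))\<^sup>2 = (vnorm V x)\<^sup>2 - 2 * Re (inner_prod V x y) + (vnorm V y)\<^sup>2"
  using ip_cnj[of x y] by (simp add: vnorm_sq)

lemma vnorm_minus_commute: "\<lbrakk>x \<in> carrier V; y \<in> carrier V\<rbrakk> \<Longrightarrow> vnorm V (x \<ominus> y) = vnorm V (y \<ominus> x)"
  by (simp add: vnorm_def)

lemma cauchy_schwarz:
  assumes x: "x \<in> carrier V" and y: "y \<in> carrier V"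
  shows "cmod (inner_prod V x y) \<le> vnorm V x * vnorm V y"
proof (cases "y = \<zero>")
  case False
  let ?n = "(vnorm V y)\<^sup>2"
  have n: "?n > 0" using False y by simp
  define a where "a = inner_prod V x y"
  \<comment> \<open>\<open>z\<close> is the component of \<open>x\<close> orthogonal to
    \<open>y\<close>; the inequality is the positivity of its squared norm.\<close>
  define z where "z = x \<ominus> (a / ?n) \<odot> y"
  have zV: "z \<in> carrier V" using x y by (simp add: z_def)
  define k where "k = inner_prod V x x"
  have yx: "inner_prod V y x = cnj a" "inner_prod V x y = a" using ip_cnj[of x y] x y by (simp_all add: a_def)
  have "inner_prod V z z = k - of_real ((cmod a)\<^sup>2 / ?n)"
    unfolding z_def using x y n
    by (simp add: k_def[symmetric] yx ip_self[OF y] complex_norm_square del: of_real_power)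
  then have "0 \<le> Re k - (cmod a)\<^sup>2 / ?n"
    using ip_nonneg[OF zV] by (simp only: minus_complex.sel Re_complex_of_real)
  then have "0 \<le> (vnorm V x)\<^sup>2 - (cmod a)\<^sup>2 / ?n"
    using x by (simp add: vnorm_sq k_def)
  then have "(cmod a)\<^sup>2 \<le> (vnorm V x * vnorm V y)\<^sup>2"
    using n by (simp add: field_simps)
  then have "cmod a \<le> vnorm V x * vnorm V y"
    by (rule power2_le_imp_le) (intro mult_nonneg_nonneg vnorm_nonneg x y)
  then show ?thesis by (simp only: a_def)
next
  case True
  then show ?thesis using x by (simp only: ip_zero_right vnorm_zero norm_zero mult_zero_right order_refl)
qed

lemma vnorm_triangle:
  assumes x: "x \<in> carrier V" and y: "y \<in> carrier V"
  shows "vnorm V (x \<oplus> y) \<le> vnorm V x + vnorm V y"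
proof (rule power2_le_imp_le)
  have "Re (inner_prod V x y) \<le> vnorm V x * vnorm V y"
    using cauchy_schwarz[OF x y] complex_Re_le_cmod order_trans by blast
  then show "(vnorm V (x \<oplus> y))\<^sup>2 \<le> (vnorm V x + vnorm V y)\<^sup>2"
    using x y by (simp add: vnorm_add_sq power2_sum)
  show "0 \<le> vnorm V x + vnorm V y" by (intro add_nonneg_nonneg vnorm_nonneg x y)
qed

lemma vnorm_triangle_minus:
  assumes x: "x \<in> carrier V" and y: "y \<in> carrier V"
  shows "vnorm V x \<le> vnorm V (x \<ominus> y) + vnorm V y"
proof -
  have "x = (x \<ominus> y) \<oplus> y" by (rule eqI) (use x y in auto)
  then show ?thesis using vnorm_triangle[of "x \<ominus> y" y] x y by simp
qed

lemma vnorm_diff_le: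
  assumes x: "x \<in> carrier V" and y: "y \<in> carrier V"
  shows "\<bar>vnorm V x - vnorm V y\<bar> \<le> vnorm V (x \<ominus> y)"
  using vnorm_triangle_minus[OF x y] vnorm_triangle_minus[OF y x] vnorm_minus_commute[OF x y] by auto

lemma ip_tendsto:
  assumes "\<And>i. s i \<in> carrier V" "l \<in> carrier V" "(\<lambda>i::nat. vnorm V (s i \<ominus> l)) \<longlonglongrightarrow> 0" "y \<in> carrier V"
  shows "(\<lambda>i. inner_prod V (s i) y) \<longlonglongrightarrow> inner_prod V l y"
proof -
  have "(\<lambda>i. vnorm V (s i \<ominus> l) * vnorm V y) \<longlonglongrightarrow> 0"
    by (rule tendsto_mult_left_zero[OF assms(3)])
  moreover have "cmod (inner_prod V (s i) y - inner_prod V l y) \<le> vnorm V (s i \<ominus> l) * vnorm V y" for i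
    using cauchy_schwarz[of "s i \<ominus> l" y] assms(1,2,4) by simp
  ultimately have "(\<lambda>i. inner_prod V (s i) y - inner_prod V l y) \<longlonglongrightarrow> 0"
    by (rule null_comparison[rotated])
  then show ?thesis by (rule LIM_zero_cancel)
qed

lemma vnorm_tendsto:
  assumes "\<And>i. s i \<in> carrier V" "l \<in> carrier V" "(\<lambda>i::nat. vnorm V (s i \<ominus> l)) \<longlonglongrightarrow> 0"
  shows "(\<lambda>i. vnorm V (s i)) \<longlonglongrightarrow> vnorm V l"
proof -
  have "(\<lambda>i. vnorm V (s i) - vnorm V l) \<longlonglongrightarrow> 0"
    by (rule null_comparison[OF _ assms(3)]) (simp add: vnorm_diff_le assms(1,2))
  then show ?thesis by (rule LIM_zero_cancel)
qed

text \<open>Take \<open>y = x\<close> and cancel one factor. Operator norms are estimated through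
  this rule, from bounds on inner products alone.\<close>

lemma vnorm_leI:
  assumes x: "x \<in> carrier V" and b: "0 \<le> b"
    and "\<And>y. y \<in> carrier V \<Longrightarrow> cmod (inner_prod V x y) \<le> b * vnorm V y"
  shows "vnorm V x \<le> b"
proof (cases "x = \<zero>")
  case False
  have "(vnorm V x)\<^sup>2 \<le> b * vnorm V x"
    using assms(3)[OF x] by (simp only: ip_self[OF x] norm_of_real abs_power2)
  moreover have "vnorm V x > 0" using False x vnorm_nonneg[OF x] by (simp add: less_le)
  ultimately show ?thesis by (simp only: power2_eq_square mult_le_cancel_right_pos)
next
  case True
  then show ?thesis using b by (simp only: vnorm_zero)
qed

section \<open>Riesz representation of functionals on an arbitrary subspace\<close>

text \<open>
  The functional is given on a subspace that need be neither closed nor dense, as a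
  relation; its representing vector is found by minimising \<open>\<parallel>x\<parallel>\<^sup>2 - 2 Re (f x)\<close>.
\<close>

lemma riesz:
  assumes G: "\<And>x c. (x, c) \<in> G \<Longrightarrow> x \<in> carrier V"
    and ne: "G \<noteq> {}"
    and add: "\<And>x c y d. (x, c) \<in> G \<Longrightarrow> (y, d) \<in> G \<Longrightarrow> (x \<oplus> y, c + d) \<in> G"
    and sm: "\<And>x c a. (x, c) \<in> G \<Longrightarrow> (a \<odot> x, a * c) \<in> G"
    and bd: "\<And>x c. (x, c) \<in> G \<Longrightarrow> cmod c \<le> b * vnorm V x"
    and b: "b \<ge> 0"
  shows "\<exists>l\<in>carrier V. (\<forall>(x, c)\<in>G. inner_prod V x l = c) \<and> vnorm V l \<le> b"
proof -
  define J where "J = (\<lambda>(x, c). (vnorm V x)\<^sup>2 - 2 * Re c)"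
  \<comment> \<open>Completing the square in \<open>vnorm V x\<close> gives the bound.\<close>
  have Jlow: "J p \<ge> - b\<^sup>2" if "p \<in> G" for p
  proof -
    obtain x c where p: "p = (x, c)" by (cases p)
    have "Re c \<le> b * vnorm V x" using bd[of x c] that p complex_Re_le_cmod[of c] by simp
    moreover have "0 \<le> (vnorm V x - b)\<^sup>2" by simp
    ultimately show ?thesis by (simp add: J_def p power2_diff algebra_simps)
  qed
  define \<mu> where "\<mu> = Inf (J ` G)"
  have bdd: "bdd_below (J ` G)" by (rule bdd_belowI2[of _ "- b\<^sup>2"]) (use Jlow in auto)
  have \<mu>: "\<mu> \<le> J p" if "p \<in> G" for p unfolding \<mu>_def by (rule cINF_lower[OF bdd that])
  have "\<exists>p\<in>G. J p < \<mu> + inverse (real (Suc n))" for n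
    unfolding \<mu>_def using cINF_less_iff[OF ne bdd, of "Inf (J ` G) + inverse (real (Suc n))"] by simp
  then obtain p where pG: "\<And>n. p n \<in> G" and pJ: "\<And>n. J (p n) < \<mu> + inverse (real (Suc n))" by metis
  define x c where "x = (\<lambda>n. fst (p n))" and "c = (\<lambda>n. snd (p n))"
  have xc: "(x n, c n) \<in> G" for n using pG by (simp add: x_def c_def)
  have xV [simp]: "x n \<in> carrier V" for n using G xc by blast
  have Jxc: "(vnorm V (x n))\<^sup>2 - 2 * Re (c n) < \<mu> + inverse (real (Suc n))" for n
    using pJ[of n] by (simp add: J_def x_def c_def case_prod_beta)
  \<comment> \<open>The midpoint of two almost minimising vectors is again admissible, so
    \<open>\<mu>\<close> bounds its value from below; the parallelogram identity turns this into
    closeness of the two vectors.\<close>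
  have cauchy: "(vnorm V (x i \<ominus> x j))\<^sup>2 \<le> 2 * (inverse (real (Suc i)) + inverse (real (Suc j)))" for i j
  proof -
    have "((1/2) \<odot> (x i \<oplus> x j), (1/2) * (c i + c j)) \<in> G" by (intro sm add xc)
    from \<mu>[OF this] have "\<mu> \<le> (vnorm V (x i \<oplus> x j))\<^sup>2 / 4 - Re (c i + c j)"
      by (simp add: J_def power_mult_distrib power2_eq_square add_divide_distrib)
    moreover have "(vnorm V (x i \<oplus> x j))\<^sup>2 + (vnorm V (x i \<ominus> x j))\<^sup>2
        = 2 * (vnorm V (x i))\<^sup>2 + 2 * (vnorm V (x j))\<^sup>2"
      by (simp add: vnorm_add_sq vnorm_minus_sq)
    ultimately show ?thesis using Jxc[of i] Jxc[of j] by simp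
  qed
  have "\<exists>N. \<forall>i\<ge>N. \<forall>j\<ge>N. vnorm V (x i \<ominus> x j) < e" if e: "e > 0" for e
  proof -
    obtain N where N: "inverse (real (Suc N)) < e\<^sup>2 / 4"
      using reals_Archimedean[of "e\<^sup>2 / 4"] e by auto
    have "vnorm V (x i \<ominus> x j) < e" if ij: "i \<ge> N" "j \<ge> N" for i j
    proof (rule power2_less_imp_less)
      have "inverse (real (Suc i)) \<le> inverse (real (Suc N))" "inverse (real (Suc j)) \<le> inverse (real (Suc N))"
        using ij by (simp_all add: field_simps)
      with N have "2 * (inverse (real (Suc i)) + inverse (real (Suc j))) < e\<^sup>2"
        by argo
      then show "(vnorm V (x i \<ominus> x j))\<^sup>2 < e\<^sup>2" using cauchy[of i j] by (rule le_less_trans[rotated])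
    qed (rule less_imp_le[OF e])
    then show ?thesis by (intro exI[of _ N] allI impI)
  qed
  from complete[OF xV this] obtain l where l: "l \<in> carrier V" and lim: "(\<lambda>i. vnorm V (x i \<ominus> l)) \<longlonglongrightarrow> 0"
    by blast
  have limip: "(\<lambda>i. inner_prod V (x i) y) \<longlonglongrightarrow> inner_prod V l y" if "y \<in> carrier V" for y
    using ip_tendsto[OF xV l lim that] .
  have ReEq: "Re (inner_prod V l y) = Re d" if yd: "(y, d) \<in> G" for y d
  proof -
    have y: "y \<in> carrier V" using G yd by blast
    \<comment> \<open>Minimality is tested at \<open>x i\<close> perturbed by \<open>s\<close> times
      \<open>y\<close>. The value of \<open>J\<close> at \<open>x i\<close> cancels against
      \<open>\<mu>\<close> up to \<open>inverse (real (Suc i))\<close>, which vanishes in the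
      limit.\<close>
    have ineq: "0 \<le> 2 * s * (Re (inner_prod V l y) - Re d) + s\<^sup>2 * (vnorm V y)\<^sup>2" for s :: real
    proof -
      have "0 \<le> 2 * s * (Re (inner_prod V (x i) y) - Re d) + s\<^sup>2 * (vnorm V y)\<^sup>2 + inverse (real (Suc i))" for i
      proof -
        have "(x i \<oplus> of_real s \<odot> y, c i + of_real s * d) \<in> G" by (intro add sm xc yd)
        from \<mu>[OF this] have "\<mu> \<le> (vnorm V (x i))\<^sup>2 + 2 * s * Re (inner_prod V (x i) y) + s\<^sup>2 * (vnorm V y)\<^sup>2
            - 2 * Re (c i) - 2 * s * Re d"
          using y by (simp add: J_def vnorm_add_sq power_mult_distrib)
        then show ?thesis using Jxc[of i] by (simp add: algebra_simps)
      qed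
      moreover have "(\<lambda>i. 2 * s * (Re (inner_prod V (x i) y) - Re d) + s\<^sup>2 * (vnorm V y)\<^sup>2 + inverse (real (Suc i)))
         \<longlonglongrightarrow> 2 * s * (Re (inner_prod V l y) - Re d) + s\<^sup>2 * (vnorm V y)\<^sup>2 + 0"
        by (intro tendsto_intros limip y LIMSEQ_inverse_real_of_nat)
      ultimately have "0 \<le> 2 * s * (Re (inner_prod V l y) - Re d) + s\<^sup>2 * (vnorm V y)\<^sup>2 + 0"
        by (intro tendsto_lowerbound[OF _ always_eventually sequentially_bot]) auto
      then show ?thesis by (simp only: add_0_right)
    qed
    define D where "D = Re (inner_prod V l y) - Re d"
    \<comment> \<open>The choice \<open>s = - D / M\<close> minimises
      \<open>2 * s * D + s\<^sup>2 * M\<close>; the summand 1 keeps \<open>M\<close> positive when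
      \<open>y\<close> is zero.\<close>
    define M where "M = (vnorm V y)\<^sup>2 + 1"
    have M: "M > 0" by (simp add: M_def add_nonneg_pos)
    have "0 \<le> 2 * (- D / M) * D + (- D / M)\<^sup>2 * (vnorm V y)\<^sup>2"
      using ineq[of "- D / M"] by (simp add: D_def)
    also have "\<dots> \<le> 2 * (- D / M) * D + (- D / M)\<^sup>2 * M"
      by (simp add: M_def mult_left_mono)
    also have "\<dots> = - (D\<^sup>2 / M)" using M by (simp add: power2_eq_square field_simps)
    finally have "D\<^sup>2 / M \<le> 0" by simp
    then have "D = 0" using M by (simp add: divide_le_0_iff)
    then show ?thesis by (simp add: D_def)
  qed
  have eq: "inner_prod V y l = d" if yd: "(y, d) \<in> G" for y d
  proof -
    have y: "y \<in> carrier V" using G yd by blast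
    \<comment> \<open>Minimisation controls real parts only; the imaginary part comes from the
      multiple of \<open>y\<close> by the imaginary unit.\<close>
    have "Re (inner_prod V l (\<i> \<odot> y)) = Re (\<i> * d)" using ReEq[OF sm[OF yd]] .
    then have "Im (inner_prod V l y) = - Im d" using l y by simp
    then show ?thesis using ReEq[OF yd] ip_cnj[OF l y] by (simp add: complex_eq_iff)
  qed
  have "vnorm V l \<le> b"
  proof (cases "l = \<zero>")
    case False
    \<comment> \<open>The subspace need not be closed, so \<open>l\<close> is only a limit of its
      vectors. The bound on the functional is applied to the \<open>x i\<close> and passed to the
      limit.\<close>
    have "(\<lambda>i. cmod (inner_prod V (x i) l)) \<longlonglongrightarrow> cmod (inner_prod V l l)"
      by (rule tendsto_norm[OF limip[OF l]])
    moreover have "(\<lambda>i. b * vnorm V (x i)) \<longlonglongrightarrow> b * vnorm V l"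
      by (rule tendsto_mult_left[OF vnorm_tendsto[OF xV l lim]])
    moreover have "cmod (inner_prod V (x i) l) \<le> b * vnorm V (x i)" for i
      using bd[OF xc] eq[OF xc] by simp
    ultimately have "cmod (inner_prod V l l) \<le> b * vnorm V l" by (intro LIMSEQ_le) auto
    moreover have "vnorm V l > 0" using False l vnorm_nonneg[OF l] by (simp add: less_le)
    moreover have "cmod (inner_prod V l l) = vnorm V l * vnorm V l"
      by (simp only: ip_self[OF l] norm_of_real abs_power2 power2_eq_square[symmetric])
    ultimately show ?thesis by (simp only: mult_le_cancel_right_pos)
  next
    case True
    then show ?thesis using b by (simp only: vnorm_zero)
  qed
  then show ?thesis using l eq by (intro bexI[of _ l]) auto
qed

end

section \<open>Bounded operators\<close>

context hilb
begin

lemma zero_smult [simp]: "x \<in> carrier V \<Longrightarrow> 0 \<odot> x = \<zero>"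
  by (rule eqI) auto

lemma minus_eq_add: "\<lbrakk>x \<in> carrier V; y \<in> carrier V\<rbrakk> \<Longrightarrow> x \<ominus> y = x \<oplus> (-1) \<odot> y"
  by (rule eqI) auto

lemma vnorm_finsum_le:
  assumes "finite I" "f \<in> I \<rightarrow> carrier V"
  shows "vnorm V (finsum V f I) \<le> (\<Sum>i\<in>I. vnorm V (f i))"
  using assms
proof (induction I)
  case (insert i I)
  then have f: "f \<in> I \<rightarrow> carrier V" "f i \<in> carrier V" by auto
  then have "vnorm V (finsum V f (insert i I)) \<le> vnorm V (f i) + vnorm V (finsum V f I)"
    using insert by (simp add: finsum_insert vnorm_triangle)
  then show ?case using insert.IH[OF f(1)] insert.hyps by simp
qed simp

lemma bounded_opsI:
  assumes "S \<in> extensional (carrier V)" "\<And>x. x \<in> carrier V \<Longrightarrow> S x \<in> carrier V"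
    and "\<And>x y. x \<in> carrier V \<Longrightarrow> y \<in> carrier V \<Longrightarrow> S (x \<oplus> y) = S x \<oplus> S y"
    and "\<And>c x. x \<in> carrier V \<Longrightarrow> S (c \<odot> x) = c \<odot> S x"
    and "\<And>x. x \<in> carrier V \<Longrightarrow> vnorm V (S x) \<le> b * vnorm V x"
  shows "S \<in> bounded_ops V"
proof -
  have "\<exists>b. \<forall>x\<in>carrier V. vnorm V (S x) \<le> b * vnorm V x" using assms(5) by blast
  then show ?thesis unfolding bounded_ops_def using assms(1-4) by (auto simp: PiE_def)
qed

lemma bounded_opsD:
  assumes "S \<in> bounded_ops V"
  shows bop_closed: "\<And>x. x \<in> carrier V \<Longrightarrow> S x \<in> carrier V"
    and bop_add: "\<And>x y. x \<in> carrier V \<Longrightarrow> y \<in> carrier V \<Longrightarrow> S (x \<oplus> y) = S x \<oplus> S y"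
    and bop_smult: "\<And>c x. x \<in> carrier V \<Longrightarrow> S (c \<odot> x) = c \<odot> S x"
    and bop_ext: "S \<in> extensional (carrier V)"
    and bop_bound: "\<exists>b\<ge>0. \<forall>x\<in>carrier V. vnorm V (S x) \<le> b * vnorm V x"
proof -
  show "\<And>x. x \<in> carrier V \<Longrightarrow> S x \<in> carrier V"
    "\<And>x y. x \<in> carrier V \<Longrightarrow> y \<in> carrier V \<Longrightarrow> S (x \<oplus> y) = S x \<oplus> S y"
    "\<And>c x. x \<in> carrier V \<Longrightarrow> S (c \<odot> x) = c \<odot> S x"
    "S \<in> extensional (carrier V)"
    using assms by (auto simp: bounded_ops_def PiE_def)
  from assms obtain b where b: "\<forall>x\<in>carrier V. vnorm V (S x) \<le> b * vnorm V x"
    by (auto simp: bounded_ops_def)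
  have "vnorm V (S x) \<le> \<bar>b\<bar> * vnorm V x" if x: "x \<in> carrier V" for x
  proof -
    have "vnorm V (S x) \<le> b * vnorm V x" using b x by blast
    also have "\<dots> \<le> \<bar>b\<bar> * vnorm V x" by (rule mult_right_mono) (use x in auto)
    finally show ?thesis .
  qed
  then show "\<exists>b\<ge>0. \<forall>x\<in>carrier V. vnorm V (S x) \<le> b * vnorm V x"
    by (intro exI[of _ "\<bar>b\<bar>"]) simp
qed

lemma bop_zero [simp]: "S \<in> bounded_ops V \<Longrightarrow> S \<zero> = \<zero>"
  using bop_smult[of S "\<zero>" 0] bop_closed[of S "\<zero>"] by simp

lemma bop_minus: "\<lbrakk>S \<in> bounded_ops V; x \<in> carrier V; y \<in> carrier V\<rbrakk> \<Longrightarrow> S (x \<ominus> y) = S x \<ominus> S y"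
  by (simp add: minus_eq_add bop_add bop_smult bop_closed)

lemma bop_eqI:
  assumes "S \<in> bounded_ops V" "R \<in> bounded_ops V" "\<And>x. x \<in> carrier V \<Longrightarrow> S x = R x"
  shows "S = R"
  using extensionalityI[OF bop_ext[OF assms(1)] bop_ext[OF assms(2)]] assms(3) by blast

lemma op_norm_bdd:
  assumes "S \<in> bounded_ops V"
  shows "bdd_above ((\<lambda>x. vnorm V (S x)) ` {x \<in> carrier V. vnorm V x \<le> 1})"
proof -
  obtain b where b: "b \<ge> 0" "\<forall>x\<in>carrier V. vnorm V (S x) \<le> b * vnorm V x"
    using bop_bound[OF assms] by blast
  show ?thesis
  proof (rule bdd_aboveI2[of _ _ b])
    fix x assume "x \<in> {x \<in> carrier V. vnorm V x \<le> 1}"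
    then have "vnorm V (S x) \<le> b * vnorm V x" "b * vnorm V x \<le> b * 1"
      using b by (auto intro!: mult_left_mono simp del: mult_1_right)
    then show "vnorm V (S x) \<le> b" by simp
  qed
qed

lemma op_norm_bound:
  assumes S: "S \<in> bounded_ops V" and x: "x \<in> carrier V"
  shows "vnorm V (S x) \<le> op_norm V S * vnorm V x"
proof (cases "x = \<zero>")
  case True
  then show ?thesis using S by simp
next
  case False
  then have n: "vnorm V x > 0" using x vnorm_nonneg[OF x] by (simp add: less_le)
  let ?y = "complex_of_real (inverse (vnorm V x)) \<odot> x"
  have cm: "cmod (complex_of_real (inverse (vnorm V x))) = inverse (vnorm V x)"
    using n by (simp only: norm_of_real) simp
  have "vnorm V ?y = 1" unfolding vnorm_smult[OF x] cm using n by simp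
  then have "vnorm V (S ?y) \<le> op_norm V S"
    unfolding op_norm_def by (intro cSUP_upper op_norm_bdd S) (use x in simp)
  moreover have "vnorm V (S ?y) = inverse (vnorm V x) * vnorm V (S x)"
    unfolding bop_smult[OF S x] vnorm_smult[OF bop_closed[OF S x]] cm ..
  ultimately have "inverse (vnorm V x) * vnorm V (S x) \<le> op_norm V S" by (simp only:)
  then show ?thesis using n by (simp add: field_simps)
qed

lemma op_norm_leI:
  assumes "\<And>x. x \<in> carrier V \<Longrightarrow> vnorm V (S x) \<le> b * vnorm V x" "b \<ge> 0"
  shows "op_norm V S \<le> b"
  unfolding op_norm_def
proof (rule cSUP_least)
  show "{x \<in> carrier V. vnorm V x \<le> 1} \<noteq> {}" using zero_closed vnorm_zero by fastforce
  fix x assume "x \<in> {x \<in> carrier V. vnorm V x \<le> 1}"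
  then have "vnorm V (S x) \<le> b * vnorm V x" "b * vnorm V x \<le> b * 1"
    using assms by (auto intro!: mult_left_mono simp del: mult_1_right)
  then show "vnorm V (S x) \<le> b" by simp
qed

lemma op_norm_nonneg:
  assumes "S \<in> bounded_ops V"
  shows "0 \<le> op_norm V S"
proof -
  have "vnorm V (S \<zero>) \<le> op_norm V S"
    unfolding op_norm_def by (intro cSUP_upper op_norm_bdd assms) simp
  then show ?thesis using assms by simp
qed

lemma op_id_bop [simp]: "op_id V \<in> bounded_ops V"
  by (rule bounded_opsI[where b = 1]) (auto simp: op_id_def)

lemma op_id_apply [simp]: "x \<in> carrier V \<Longrightarrow> op_id V x = x"
  by (simp add: op_id_def)

lemma op_smult_apply [simp]: "x \<in> carrier V \<Longrightarrow> op_smult V c S x = c \<odot> S x"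
  by (simp add: op_smult_def)

lemma op_diff_apply [simp]: "x \<in> carrier V \<Longrightarrow> op_diff V S R x = S x \<ominus> R x"
  by (simp add: op_diff_def)

lemma op_sum_apply [simp]: "x \<in> carrier V \<Longrightarrow> op_sum V F I x = finsum V (\<lambda>i. F i x) I"
  by (simp add: op_sum_def)

lemma op_mult_apply [simp]: "x \<in> carrier V \<Longrightarrow> op_mult V S R x = S (R x)"
  by (simp add: op_mult_def compose_def)

lemma op_smult_bop:
  assumes S: "S \<in> bounded_ops V"
  shows "op_smult V c S \<in> bounded_ops V"
proof (rule bounded_opsI[where b = "cmod c * op_norm V S"])
  fix x assume x: "x \<in> carrier V"
  have "cmod c * vnorm V (S x) \<le> cmod c * (op_norm V S * vnorm V x)"
    by (intro mult_left_mono op_norm_bound S x) auto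
  then show "vnorm V (op_smult V c S x) \<le> cmod c * op_norm V S * vnorm V x"
    using x by (simp add: bop_closed[OF S] mult.assoc)
  show "op_smult V c S (d \<odot> x) = d \<odot> op_smult V c S x" for d
    by (rule eqI) (use x bop_closed[OF S] bop_smult[OF S] in auto)
next
  fix x y assume "x \<in> carrier V" "y \<in> carrier V"
  then show "op_smult V c S (x \<oplus> y) = op_smult V c S x \<oplus> op_smult V c S y"
    by (intro eqI) (auto simp: bop_closed[OF S] bop_add[OF S] algebra_simps)
qed (auto simp: op_smult_def bop_closed[OF S])

lemma op_diff_bop:
  assumes S: "S \<in> bounded_ops V" and R: "R \<in> bounded_ops V"
  shows "op_diff V S R \<in> bounded_ops V"
proof (rule bounded_opsI[where b = "op_norm V S + op_norm V R"])
  note [simp] = bop_closed[OF S] bop_closed[OF R]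
  fix x assume x: "x \<in> carrier V"
  have "vnorm V (S x \<ominus> R x) \<le> vnorm V (S x) + vnorm V (R x)"
    using vnorm_triangle[of "S x" "(-1) \<odot> R x"] x by (simp add: minus_eq_add)
  then show "vnorm V (op_diff V S R x) \<le> (op_norm V S + op_norm V R) * vnorm V x"
    using op_norm_bound[OF S x] op_norm_bound[OF R x] x by (simp add: algebra_simps)
  show "op_diff V S R (d \<odot> x) = d \<odot> op_diff V S R x" for d
    by (rule eqI) (use x bop_smult[OF S] bop_smult[OF R] in \<open>auto simp: algebra_simps\<close>)
next
  fix x y assume "x \<in> carrier V" "y \<in> carrier V"
  then show "op_diff V S R (x \<oplus> y) = op_diff V S R x \<oplus> op_diff V S R y"
    by (intro eqI) (auto simp: bop_closed[OF S] bop_closed[OF R] bop_add[OF S] bop_add[OF R])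
qed (auto simp: op_diff_def bop_closed[OF S] bop_closed[OF R])

lemma op_mult_bop:
  assumes S: "S \<in> bounded_ops V" and R: "R \<in> bounded_ops V"
  shows "op_mult V S R \<in> bounded_ops V"
proof (rule bounded_opsI[where b = "op_norm V S * op_norm V R"])
  fix x assume x: "x \<in> carrier V"
  have "vnorm V (S (R x)) \<le> op_norm V S * vnorm V (R x)" by (intro op_norm_bound S bop_closed[OF R] x)
  also have "\<dots> \<le> op_norm V S * (op_norm V R * vnorm V x)"
    by (intro mult_left_mono op_norm_bound op_norm_nonneg S R x)
  finally show "vnorm V (op_mult V S R x) \<le> op_norm V S * op_norm V R * vnorm V x"
    using x by (simp add: mult.assoc)
  show "op_mult V S R (d \<odot> x) = d \<odot> op_mult V S R x" for d
    using x by (simp add: bop_closed[OF R] bop_smult[OF R] bop_smult[OF S])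
next
  fix x y assume "x \<in> carrier V" "y \<in> carrier V"
  then show "op_mult V S R (x \<oplus> y) = op_mult V S R x \<oplus> op_mult V S R y"
    by (simp add: bop_closed[OF R] bop_add[OF R] bop_add[OF S])
qed (auto simp: op_mult_def compose_def bop_closed[OF S] bop_closed[OF R])

lemma op_sum_bop:
  assumes F: "\<And>i. i \<in> I \<Longrightarrow> F i \<in> bounded_ops V" and "finite I"
  shows "op_sum V F I \<in> bounded_ops V"
proof (rule bounded_opsI[where b = "\<Sum>i\<in>I. op_norm V (F i)"])
  have Fx: "(\<lambda>i. F i x) \<in> I \<rightarrow> carrier V" if "x \<in> carrier V" for x
    using bop_closed[OF F] that by auto
  fix x assume x: "x \<in> carrier V"
  show "op_sum V F I x \<in> carrier V" using x Fx by simp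
  have "vnorm V (op_sum V F I x) \<le> (\<Sum>i\<in>I. vnorm V (F i x))"
    using vnorm_finsum_le[OF assms(2) Fx[OF x]] x by simp
  also have "\<dots> \<le> (\<Sum>i\<in>I. op_norm V (F i) * vnorm V x)"
    by (intro sum_mono op_norm_bound F x)
  finally show "vnorm V (op_sum V F I x) \<le> (\<Sum>i\<in>I. op_norm V (F i)) * vnorm V x"
    by (simp add: sum_distrib_right)
  show "op_sum V F I (d \<odot> x) = d \<odot> op_sum V F I x" for d
  proof (rule eqI)
    fix z assume z: "z \<in> carrier V"
    have "inner_prod V (op_sum V F I (d \<odot> x)) z = (\<Sum>i\<in>I. inner_prod V (F i (d \<odot> x)) z)"
      using x z Fx[of "d \<odot> x"] assms(2) by (simp add: ip_finsum_left)
    also have "\<dots> = (\<Sum>i\<in>I. d * inner_prod V (F i x) z)"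
      using x z by (intro sum.cong refl) (simp add: bop_smult[OF F] bop_closed[OF F])
    also have "\<dots> = inner_prod V (d \<odot> op_sum V F I x) z"
      using x z Fx assms(2) by (simp add: ip_finsum_left sum_distrib_left)
    finally show "inner_prod V (op_sum V F I (d \<odot> x)) z = inner_prod V (d \<odot> op_sum V F I x) z" .
  qed (use x Fx in simp_all)
  fix y assume y: "y \<in> carrier V"
  show "op_sum V F I (x \<oplus> y) = op_sum V F I x \<oplus> op_sum V F I y"
  proof (rule eqI)
    fix z assume z: "z \<in> carrier V"
    have "inner_prod V (op_sum V F I (x \<oplus> y)) z = (\<Sum>i\<in>I. inner_prod V (F i (x \<oplus> y)) z)"
      using x y z Fx[of "x \<oplus> y"] assms(2) by (simp add: ip_finsum_left)
    also have "\<dots> = (\<Sum>i\<in>I. inner_prod V (F i x) z + inner_prod V (F i y) z)"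
      using x y z by (intro sum.cong refl) (simp add: bop_add[OF F] bop_closed[OF F])
    also have "\<dots> = inner_prod V (op_sum V F I x \<oplus> op_sum V F I y) z"
      using x y z Fx assms(2) by (simp add: ip_finsum_left sum.distrib)
    finally show "inner_prod V (op_sum V F I (x \<oplus> y)) z = inner_prod V (op_sum V F I x \<oplus> op_sum V F I y) z" .
  qed (use x y Fx in simp_all)
qed (simp add: op_sum_def)

lemma ip_op_sum:
  assumes "\<And>i. i \<in> I \<Longrightarrow> F i \<in> bounded_ops V" "finite I" "x \<in> carrier V" "y \<in> carrier V"
  shows "inner_prod V (op_sum V F I x) y = (\<Sum>i\<in>I. inner_prod V (F i x) y)"
proof -
  have "(\<lambda>i. F i x) \<in> I \<rightarrow> carrier V" using bop_closed[OF assms(1)] assms(3) by auto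
  then show ?thesis using assms by (simp add: ip_finsum_left)
qed

section \<open>Operators represented by bounded sesquilinear forms, and adjoints\<close>

text \<open>
  The first argument of the form \<open>B\<close> ranges only over a total family, so that the lemma also
  yields operators on a tensor product from their values on finite sums of elementary tensors.
\<close>

lemma op_exists:
  assumes \<phi>: "\<And>i. i \<in> I \<Longrightarrow> \<phi> i \<in> carrier V" and ne: "I \<noteq> {}"
    and add: "\<And>i j. i \<in> I \<Longrightarrow> j \<in> I \<Longrightarrow> \<exists>k\<in>I. \<phi> k = \<phi> i \<oplus> \<phi> j \<and> (\<forall>u\<in>carrier V. B k u = B i u + B j u)"
    and sm: "\<And>i a. i \<in> I \<Longrightarrow> \<exists>k\<in>I. \<phi> k = a \<odot> \<phi> i \<and> (\<forall>u\<in>carrier V. B k u = a * B i u)"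
    and total: "\<And>u. u \<in> carrier V \<Longrightarrow> (\<And>i. i \<in> I \<Longrightarrow> inner_prod V (\<phi> i) u = 0) \<Longrightarrow> u = \<zero>"
    and Badd: "\<And>i u v. i \<in> I \<Longrightarrow> u \<in> carrier V \<Longrightarrow> v \<in> carrier V \<Longrightarrow> B i (u \<oplus> v) = B i u + B i v"
    and Bsm: "\<And>i u c. i \<in> I \<Longrightarrow> u \<in> carrier V \<Longrightarrow> B i (c \<odot> u) = cnj c * B i u"
    and bd: "\<And>i u. i \<in> I \<Longrightarrow> u \<in> carrier V \<Longrightarrow> cmod (B i u) \<le> b * vnorm V (\<phi> i) * vnorm V u"
    and b: "b \<ge> 0"
  shows "\<exists>R\<in>bounded_ops V. (\<forall>i\<in>I. \<forall>u\<in>carrier V. inner_prod V (\<phi> i) (R u) = B i u) \<and>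
    (\<forall>u\<in>carrier V. vnorm V (R u) \<le> b * vnorm V u)"
proof -
  have "\<exists>l. l \<in> carrier V \<and> (\<forall>i\<in>I. inner_prod V (\<phi> i) l = B i u) \<and> vnorm V l \<le> b * vnorm V u"
    if u: "u \<in> carrier V" for u
  proof -
    define G where "G = (\<lambda>i. (\<phi> i, B i u)) ` I"
    have "\<exists>l\<in>carrier V. (\<forall>(x, c)\<in>G. inner_prod V x l = c) \<and> vnorm V l \<le> b * vnorm V u"
    proof (rule riesz)
      show "\<And>x c. (x, c) \<in> G \<Longrightarrow> x \<in> carrier V" using \<phi> by (auto simp: G_def)
      show "G \<noteq> {}" using ne by (simp add: G_def)
      show "(x \<oplus> y, c + d) \<in> G" if "(x, c) \<in> G" "(y, d) \<in> G" for x c y d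
      proof -
        obtain i j where "i \<in> I" "j \<in> I" "x = \<phi> i" "c = B i u" "y = \<phi> j" "d = B j u"
          using \<open>(x, c) \<in> G\<close> \<open>(y, d) \<in> G\<close> by (auto simp: G_def)
        then show ?thesis using add[of i j] u by (force simp: G_def image_iff)
      qed
      show "(a \<odot> x, a * c) \<in> G" if "(x, c) \<in> G" for x c a
      proof -
        obtain i where "i \<in> I" "x = \<phi> i" "c = B i u"
          using \<open>(x, c) \<in> G\<close> by (auto simp: G_def)
        then show ?thesis using sm[of i a] u by (force simp: G_def image_iff)
      qed
      show "cmod c \<le> b * vnorm V u * vnorm V x" if "(x, c) \<in> G" for x c
      proof -
        obtain i where "i \<in> I" "x = \<phi> i" "c = B i u"
          using \<open>(x, c) \<in> G\<close> by (auto simp: G_def)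
        then show ?thesis using bd[of i u] u by (simp add: mult_ac)
      qed
      show "0 \<le> b * vnorm V u" using b u by simp
    qed
    then show ?thesis by (auto simp: G_def)
  qed
  then obtain l where l: "\<And>u. u \<in> carrier V \<Longrightarrow> l u \<in> carrier V"
    and lB: "\<And>u i. u \<in> carrier V \<Longrightarrow> i \<in> I \<Longrightarrow> inner_prod V (\<phi> i) (l u) = B i u"
    and ln: "\<And>u. u \<in> carrier V \<Longrightarrow> vnorm V (l u) \<le> b * vnorm V u"
    by metis
  have teq: "x = y" if "x \<in> carrier V" "y \<in> carrier V"
      "\<And>i. i \<in> I \<Longrightarrow> inner_prod V (\<phi> i) x = inner_prod V (\<phi> i) y" for x y
  proof -
    have "x \<ominus> y = \<zero>" by (rule total) (use that \<phi> in auto)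
    moreover have "x = (x \<ominus> y) \<oplus> y" "y = \<zero> \<oplus> y" by (rule eqI; use that in simp)+
    ultimately show ?thesis by simp
  qed
  define R where "R = (\<lambda>u\<in>carrier V. l u)"
  have "R \<in> bounded_ops V"
  proof (rule bounded_opsI)
    show "R \<in> extensional (carrier V)" by (simp add: R_def)
    show "\<And>u. u \<in> carrier V \<Longrightarrow> R u \<in> carrier V" using l by (simp add: R_def)
    show "\<And>u. u \<in> carrier V \<Longrightarrow> vnorm V (R u) \<le> b * vnorm V u" using ln by (simp add: R_def)
    show "R (u \<oplus> v) = R u \<oplus> R v" if uv: "u \<in> carrier V" "v \<in> carrier V" for u v
      by (rule teq) (use uv l lB \<phi> Badd in \<open>simp_all add: R_def\<close>)
    show "R (c \<odot> u) = c \<odot> R u" if u: "u \<in> carrier V" for u c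
      by (rule teq) (use u l lB \<phi> Bsm in \<open>simp_all add: R_def\<close>)
  qed
  moreover have "\<forall>i\<in>I. \<forall>u\<in>carrier V. inner_prod V (\<phi> i) (R u) = B i u"
    "\<forall>u\<in>carrier V. vnorm V (R u) \<le> b * vnorm V u"
    using lB ln by (simp_all add: R_def)
  ultimately show ?thesis by blast
qed

text \<open>The form \<open>inner_prod V (S x) y\<close> is bounded by the operator norm, and
  \<open>op_exists\<close> represents it with the whole carrier as total family.\<close>

lemma adjoint_exists:
  assumes S: "S \<in> bounded_ops V"
  shows "\<exists>R\<in>bounded_ops V. \<forall>x\<in>carrier V. \<forall>y\<in>carrier V. inner_prod V (S x) y = inner_prod V x (R y)"
proof -
  note [simp] = bop_closed[OF S]
  have "\<exists>R\<in>bounded_ops V. (\<forall>i\<in>carrier V. \<forall>u\<in>carrier V. inner_prod V i (R u) = inner_prod V (S i) u) \<and>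
    (\<forall>u\<in>carrier V. vnorm V (R u) \<le> op_norm V S * vnorm V u)"
  proof (rule op_exists[where \<phi> = "\<lambda>x. x"])
    show "carrier V \<noteq> {}" using zero_closed by blast
    show "cmod (inner_prod V (S i) u) \<le> op_norm V S * vnorm V i * vnorm V u"
      if "i \<in> carrier V" "u \<in> carrier V" for i u
    proof -
      have "cmod (inner_prod V (S i) u) \<le> vnorm V (S i) * vnorm V u"
        using that by (intro cauchy_schwarz) auto
      also have "\<dots> \<le> op_norm V S * vnorm V i * vnorm V u"
        using that by (intro mult_right_mono op_norm_bound S) auto
      finally show ?thesis .
    qed
    show "\<exists>k\<in>carrier V. k = i \<oplus> j \<and> (\<forall>u\<in>carrier V. inner_prod V (S k) u = inner_prod V (S i) u + inner_prod V (S j) u)"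
      if "i \<in> carrier V" "j \<in> carrier V" for i j
      using that by (intro bexI[of _ "i \<oplus> j"]) (auto simp: bop_add[OF S])
    show "\<exists>k\<in>carrier V. k = a \<odot> i \<and> (\<forall>u\<in>carrier V. inner_prod V (S k) u = a * inner_prod V (S i) u)"
      if "i \<in> carrier V" for i a
      using that by (intro bexI[of _ "a \<odot> i"]) (auto simp: bop_smult[OF S])
    show "u = \<zero>" if u: "u \<in> carrier V" "\<And>i. i \<in> carrier V \<Longrightarrow> inner_prod V i u = 0" for u
      by (rule ip_definite) (use u in auto)
  qed (auto simp: op_norm_nonneg[OF S])
  then show ?thesis by metis
qed

lemma ip_right_eqI:
  assumes "x \<in> carrier V" "y \<in> carrier V"
    and "\<And>z. z \<in> carrier V \<Longrightarrow> inner_prod V z x = inner_prod V z y"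
  shows "x = y"
  by (rule eqI) (use assms ip_cnj in metis)+

lemma adjoint:
  assumes S: "S \<in> bounded_ops V"
  shows adjoint_bop: "adjoint V S \<in> bounded_ops V"
    and ip_adjoint: "\<And>x y. x \<in> carrier V \<Longrightarrow> y \<in> carrier V \<Longrightarrow>
      inner_prod V (S x) y = inner_prod V x (adjoint V S y)"
proof -
  let ?P = "\<lambda>R. R \<in> bounded_ops V \<and>
     (\<forall>x\<in>carrier V. \<forall>y\<in>carrier V. inner_prod V (S x) y = inner_prod V x (R y))"
  have "\<exists>!R. ?P R"
  proof (rule ex_ex1I)
    show "\<exists>R. ?P R" using adjoint_exists[OF S] by blast
    fix R R' assume R: "?P R" and R': "?P R'"
    show "R = R'"
    proof (rule bop_eqI)
      fix y assume y: "y \<in> carrier V"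
      show "R y = R' y"
        by (rule ip_right_eqI) (use R R' y bop_closed[of R] bop_closed[of R'] in auto)
    qed (use R R' in auto)
  qed
  from theI'[OF this] show "adjoint V S \<in> bounded_ops V"
    "\<And>x y. x \<in> carrier V \<Longrightarrow> y \<in> carrier V \<Longrightarrow> inner_prod V (S x) y = inner_prod V x (adjoint V S y)"
    unfolding adjoint_def by blast+
qed

lemma ip_adjoint_left:
  assumes "S \<in> bounded_ops V" "x \<in> carrier V" "y \<in> carrier V"
  shows "inner_prod V (adjoint V S x) y = inner_prod V x (S y)"
  using ip_adjoint[OF assms(1,3,2)] ip_cnj[of "adjoint V S x" y] ip_cnj[of "S y" x] assms
    bop_closed[OF assms(1)] bop_closed[OF adjoint_bop[OF assms(1)]] ip_cnj by metis

lemma adjoint_eqI: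
  assumes S: "S \<in> bounded_ops V" and "y \<in> carrier V" "r \<in> carrier V"
    and "\<And>x. x \<in> carrier V \<Longrightarrow> inner_prod V (S x) y = inner_prod V x r"
  shows "adjoint V S y = r"
  by (rule ip_right_eqI) (use assms ip_adjoint[OF S] bop_closed[OF adjoint_bop[OF S]] in auto)

section \<open>Cauchy-Schwarz for finite families and norms of Gram operators\<close>

lemma ip_sum_le:
  assumes W: "finite W" and a: "\<And>w. w \<in> W \<Longrightarrow> a w \<in> carrier V" and b: "\<And>w. w \<in> W \<Longrightarrow> b w \<in> carrier V"
    and A: "(\<Sum>w\<in>W. (vnorm V (a w))\<^sup>2) \<le> A\<^sup>2" and B: "(\<Sum>w\<in>W. (vnorm V (b w))\<^sup>2) \<le> B\<^sup>2"
    and "A \<ge> 0" "B \<ge> 0"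
  shows "cmod (\<Sum>w\<in>W. inner_prod V (a w) (b w)) \<le> A * B"
proof -
  have "cmod (\<Sum>w\<in>W. inner_prod V (a w) (b w)) \<le> (\<Sum>w\<in>W. vnorm V (a w) * vnorm V (b w))"
    by (rule sum_norm_le) (use a b cauchy_schwarz in auto)
  also have "\<dots> = (\<Sum>w\<in>W. \<bar>vnorm V (a w)\<bar> * \<bar>vnorm V (b w)\<bar>)"
    using a b by (intro sum.cong) auto
  also have "\<dots> \<le> L2_set (\<lambda>w. vnorm V (a w)) W * L2_set (\<lambda>w. vnorm V (b w)) W"
    by (rule L2_set_mult_ineq)
  also have "\<dots> \<le> A * B"
    using A B assms(6,7) by (intro mult_mono) (auto simp: L2_set_def intro!: real_le_lsqrt sum_nonneg)
  finally show ?thesis .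
qed

text \<open>\<open>Q\<close> is a positive operator with quadratic form
  \<open>\<Sum>w\<in>W. (vnorm V (B w y))\<^sup>2\<close>, so its norm is the best constant in the
  estimate of that sum. The two families are kept separate in order to cover both uses: rows, where
  \<open>B\<close> consists of adjoints, and coefficients, where \<open>C\<close> does.\<close>

lemma gram_norm:
  assumes W: "finite W" and C: "\<And>w. w \<in> W \<Longrightarrow> C w \<in> bounded_ops V"
    and B: "\<And>w. w \<in> W \<Longrightarrow> B w \<in> bounded_ops V"
    and CB: "\<And>w x y. w \<in> W \<Longrightarrow> x \<in> carrier V \<Longrightarrow> y \<in> carrier V \<Longrightarrow>
      inner_prod V (C w x) y = inner_prod V x (B w y)"
  defines "Q \<equiv> op_sum V (\<lambda>w. op_mult V (C w) (B w)) W"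
  shows gram_norm_bound: "\<And>y. y \<in> carrier V \<Longrightarrow> (\<Sum>w\<in>W. (vnorm V (B w y))\<^sup>2) \<le> op_norm V Q * (vnorm V y)\<^sup>2"
    and gram_norm_leI: "\<And>c. (\<And>y. y \<in> carrier V \<Longrightarrow> (\<Sum>w\<in>W. (vnorm V (B w y))\<^sup>2) \<le> c * (vnorm V y)\<^sup>2) \<Longrightarrow> c \<ge> 0 \<Longrightarrow>
      op_norm V Q \<le> c"
    and gram_norm_nonneg: "op_norm V Q \<ge> 0"
proof -
  have CBw: "\<And>w. w \<in> W \<Longrightarrow> op_mult V (C w) (B w) \<in> bounded_ops V" by (intro op_mult_bop C B)
  then have Q: "Q \<in> bounded_ops V" unfolding Q_def by (intro op_sum_bop W)
  then show "op_norm V Q \<ge> 0" by (rule op_norm_nonneg)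
  have Qip: "inner_prod V (Q x) y = (\<Sum>w\<in>W. inner_prod V (B w x) (B w y))"
    if "x \<in> carrier V" "y \<in> carrier V" for x y
    unfolding Q_def using that
    by (subst ip_op_sum[OF CBw W]) (auto intro!: sum.cong simp: CB bop_closed[OF B])
  show "(\<Sum>w\<in>W. (vnorm V (B w y))\<^sup>2) \<le> op_norm V Q * (vnorm V y)\<^sup>2" if y: "y \<in> carrier V" for y
  proof -
    have "complex_of_real (\<Sum>w\<in>W. (vnorm V (B w y))\<^sup>2) = inner_prod V (Q y) y"
      unfolding Qip[OF y y] of_real_sum by (intro sum.cong refl ip_self[symmetric] bop_closed[OF B] y)
    then have "(\<Sum>w\<in>W. (vnorm V (B w y))\<^sup>2) = Re (inner_prod V (Q y) y)"
      by (metis Re_complex_of_real)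
    also have "\<dots> \<le> vnorm V (Q y) * vnorm V y"
      by (rule order_trans[OF complex_Re_le_cmod]) (intro cauchy_schwarz bop_closed[OF Q] y)
    also have "\<dots> \<le> op_norm V Q * vnorm V y * vnorm V y"
      by (intro mult_right_mono op_norm_bound Q y vnorm_nonneg)
    finally show ?thesis by (simp add: power2_eq_square mult.assoc)
  qed
  show "op_norm V Q \<le> c"
    if c: "\<And>y. y \<in> carrier V \<Longrightarrow> (\<Sum>w\<in>W. (vnorm V (B w y))\<^sup>2) \<le> c * (vnorm V y)\<^sup>2" "c \<ge> 0" for c
  proof (rule op_norm_leI[OF _ \<open>c \<ge> 0\<close>])
    fix x assume x: "x \<in> carrier V"
    show "vnorm V (Q x) \<le> c * vnorm V x"
    proof (rule vnorm_leI)
      fix y assume y: "y \<in> carrier V"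
      have "cmod (inner_prod V (Q x) y) \<le> (sqrt c * vnorm V x) * (sqrt c * vnorm V y)"
        unfolding Qip[OF x y]
        by (rule ip_sum_le) (use c x y W bop_closed[OF B] in \<open>auto simp: power_mult_distrib\<close>)
      also have "\<dots> = (sqrt c * sqrt c) * vnorm V x * vnorm V y" by (simp only: mult_ac)
      finally show "cmod (inner_prod V (Q x) y) \<le> c * vnorm V x * vnorm V y"
        using c(2) by simp
    qed (use x c bop_closed[OF Q] in auto)
  qed
qed

end

section \<open>Words, row norms and series of operators\<close>

lemma finite_words [simp]: "finite (words k :: 'n::finite list set)"
  using finite_lists_length_eq[of "UNIV :: 'n set" k] by (simp add: words_def)

lemma words_0 [simp]: "words 0 = {[]}"
  by (auto simp: words_def)

lemma sum_words_add:
  fixes f :: "'n::finite list \<Rightarrow> 'b::comm_monoid_add"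
  shows "(\<Sum>w\<in>words (j + k). f w) = (\<Sum>u\<in>words j. \<Sum>v\<in>words k. f (u @ v))"
proof -
  have "bij_betw (\<lambda>(u, v). u @ v) (words j \<times> words k) (words (j + k) :: 'n list set)"
    unfolding bij_betw_def
  proof
    show "inj_on (\<lambda>(u, v). u @ v) (words j \<times> words k)"
      by (auto simp: inj_on_def words_def)
    show "(\<lambda>(u, v). u @ v) ` (words j \<times> words k) = (words (j + k) :: 'n list set)"
    proof (intro equalityI subsetI)
      fix w :: "'n list" assume "w \<in> words (j + k)"
      then have "w = (\<lambda>(u, v). u @ v) (take j w, drop j w)" "(take j w, drop j w) \<in> words j \<times> words k"
        by (auto simp: words_def)
      then show "w \<in> (\<lambda>(u, v). u @ v) ` (words j \<times> words k)" by blast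
    qed (auto simp: words_def)
  qed
  from sum.reindex_bij_betw[OF this, of f] show ?thesis
    by (simp add: sum.cartesian_product case_prod_beta)
qed

lemma sum_words_1:
  fixes f :: "'n::finite list \<Rightarrow> 'b::comm_monoid_add"
  shows "(\<Sum>w\<in>words (Suc 0). f w) = (\<Sum>i\<in>UNIV. f [i])"
proof -
  have "bij_betw (\<lambda>i. [i]) UNIV (words (Suc 0) :: 'n list set)"
    by (auto simp: bij_betw_def inj_on_def words_def length_Suc_conv)
  from sum.reindex_bij_betw[OF this, of f] show ?thesis by simp
qed

text \<open>The squared norm of the row formed by all \<open>X\<^sub>w\<close> of length
  \<open>k\<close>; the joint spectral radius is the limit of its roots of order
  \<open>2 * k\<close>.\<close>

definition word_norm :: "'a hilbert \<Rightarrow> ('n::finite \<Rightarrow> 'a \<Rightarrow> 'a) \<Rightarrow> nat \<Rightarrow> real" where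
  "word_norm V X k =
     op_norm V (op_sum V (\<lambda>w. op_mult V (word_op V X w) (adjoint V (word_op V X w))) (words k))"

context hilb
begin

lemma row_norm_nonneg:
  fixes X :: "'n::finite \<Rightarrow> 'a \<Rightarrow> 'a"
  assumes "\<And>i. X i \<in> bounded_ops V"
  shows "row_norm V X \<ge> 0"
  unfolding row_norm_def
  by (rule real_sqrt_ge_zero, rule gram_norm_nonneg) (use assms in \<open>auto simp: adjoint_bop ip_adjoint\<close>)

lemma row_norm_bound:
  fixes X :: "'n::finite \<Rightarrow> 'a \<Rightarrow> 'a"
  assumes X: "\<And>i. X i \<in> bounded_ops V" and y: "y \<in> carrier V"
  shows "(\<Sum>i\<in>UNIV. (vnorm V (adjoint V (X i) y))\<^sup>2) \<le> (row_norm V X)\<^sup>2 * (vnorm V y)\<^sup>2"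
proof -
  let ?q = "op_norm V (op_sum V (\<lambda>i. op_mult V (X i) (adjoint V (X i))) UNIV)"
  have "?q \<ge> 0"
    by (rule gram_norm_nonneg) (use X in \<open>auto simp: adjoint_bop ip_adjoint\<close>)
  then have "(row_norm V X)\<^sup>2 = ?q" by (simp add: row_norm_def)
  moreover have "(\<Sum>i\<in>UNIV. (vnorm V (adjoint V (X i) y))\<^sup>2) \<le> ?q * (vnorm V y)\<^sup>2"
    by (rule gram_norm_bound) (use X y in \<open>auto simp: adjoint_bop ip_adjoint\<close>)
  ultimately show ?thesis by simp
qed

text \<open>The maps \<open>B i\<close> are only required to satisfy the adjoint relation. A
  concrete candidate can thus be used without evaluating \<open>adjoint\<close>.\<close>

lemma row_norm_leI:
  fixes X :: "'n::finite \<Rightarrow> 'a \<Rightarrow> 'a"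
  assumes X: "\<And>i. X i \<in> bounded_ops V"
    and B: "\<And>i y. y \<in> carrier V \<Longrightarrow> B i y \<in> carrier V"
    and XB: "\<And>i x y. x \<in> carrier V \<Longrightarrow> y \<in> carrier V \<Longrightarrow> inner_prod V (X i x) y = inner_prod V x (B i y)"
    and c: "\<And>y. y \<in> carrier V \<Longrightarrow> (\<Sum>i\<in>UNIV. (vnorm V (B i y))\<^sup>2) \<le> c\<^sup>2 * (vnorm V y)\<^sup>2" "c \<ge> 0"
  shows "row_norm V X \<le> c"
proof -
  have "adjoint V (X i) y = B i y" if "y \<in> carrier V" for i y
    by (rule adjoint_eqI[OF X]) (use that B XB in auto)
  then have "op_norm V (op_sum V (\<lambda>i. op_mult V (X i) (adjoint V (X i))) UNIV) \<le> c\<^sup>2"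
    by (intro gram_norm_leI) (use X c in \<open>auto simp: adjoint_bop ip_adjoint\<close>)
  then show ?thesis unfolding row_norm_def using c(2) by (intro real_le_lsqrt) auto
qed

lemma word_op_bop:
  assumes "\<And>i. X i \<in> bounded_ops V"
  shows "word_op V X w \<in> bounded_ops V"
  by (induction w) (auto intro: op_mult_bop assms)

lemma word_op_append:
  assumes X: "\<And>i. X i \<in> bounded_ops V" and x: "x \<in> carrier V"
  shows "word_op V X (u @ v) x = word_op V X u (word_op V X v x)"
  using x by (induction u) (simp_all add: bop_closed[OF word_op_bop[of X, OF X]])

lemma adjoint_word_append:
  assumes X: "\<And>i. X i \<in> bounded_ops V" and y: "y \<in> carrier V"
  shows "adjoint V (word_op V X (u @ v)) y = adjoint V (word_op V X v) (adjoint V (word_op V X u) y)"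
  by (rule adjoint_eqI[OF word_op_bop[of X, OF X] y])
     (simp_all add: X y word_op_append bop_closed[OF adjoint_bop] bop_closed[OF word_op_bop[of X, OF X]]
       word_op_bop[of X, OF X] ip_adjoint[OF word_op_bop[of X, OF X]])

lemma adjoint_word_single:
  assumes X: "\<And>i. X i \<in> bounded_ops V" and y: "y \<in> carrier V"
  shows "adjoint V (word_op V X [i]) y = adjoint V (X i) y"
  by (rule adjoint_eqI[OF word_op_bop[of X, OF X] y])
     (simp_all add: X y bop_closed[OF adjoint_bop] ip_adjoint[OF X])

lemma adjoint_op_id: "y \<in> carrier V \<Longrightarrow> adjoint V (op_id V) y = y"
  by (rule adjoint_eqI) auto

lemma word_norm_nonneg:
  fixes X :: "'n::finite \<Rightarrow> 'a \<Rightarrow> 'a"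
  assumes X: "\<And>i. X i \<in> bounded_ops V"
  shows "word_norm V X k \<ge> 0"
  unfolding word_norm_def
  by (rule gram_norm_nonneg) (use word_op_bop[of X, OF X] in \<open>auto simp: adjoint_bop ip_adjoint\<close>)

lemma word_norm_bound:
  fixes X :: "'n::finite \<Rightarrow> 'a \<Rightarrow> 'a"
  assumes X: "\<And>i. X i \<in> bounded_ops V" and y: "y \<in> carrier V"
  shows "(\<Sum>w\<in>words k. (vnorm V (adjoint V (word_op V X w) y))\<^sup>2) \<le> word_norm V X k * (vnorm V y)\<^sup>2"
  unfolding word_norm_def
  by (rule gram_norm_bound) (use y word_op_bop[of X, OF X] in \<open>auto simp: adjoint_bop ip_adjoint\<close>)

lemma word_norm_leI:
  fixes X :: "'n::finite \<Rightarrow> 'a \<Rightarrow> 'a"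
  assumes X: "\<And>i. X i \<in> bounded_ops V" and "c \<ge> 0"
    and "\<And>y. y \<in> carrier V \<Longrightarrow> (\<Sum>w\<in>words k. (vnorm V (adjoint V (word_op V X w) y))\<^sup>2) \<le> c * (vnorm V y)\<^sup>2"
  shows "word_norm V X k \<le> c"
  unfolding word_norm_def
  by (rule gram_norm_leI) (use assms(2,3) word_op_bop[of X, OF X] in \<open>auto simp: adjoint_bop ip_adjoint\<close>)

text \<open>The adjoint of a product reverses the order: for a word \<open>u @ v\<close> the adjoint
  of \<open>X\<^sub>v\<close> is applied to the vectors obtained from the adjoints of the
  \<open>X\<^sub>u\<close>. The bound in degree \<open>k\<close> is used on each of these, the bound
  in degree \<open>j\<close> on their sum.\<close>

lemma word_norm_add:
  fixes X :: "'n::finite \<Rightarrow> 'a \<Rightarrow> 'a"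
  assumes X: "\<And>i. X i \<in> bounded_ops V"
  shows "word_norm V X (j + k) \<le> word_norm V X j * word_norm V X k"
proof (rule word_norm_leI[OF X])
  fix y assume y: "y \<in> carrier V"
  have Xy: "adjoint V (word_op V X w) y \<in> carrier V" for w
    by (intro bop_closed[OF adjoint_bop] word_op_bop X y)
  have "(\<Sum>w\<in>words (j + k). (vnorm V (adjoint V (word_op V X w) y))\<^sup>2)
     = (\<Sum>u\<in>words j. \<Sum>v\<in>words k. (vnorm V (adjoint V (word_op V X v) (adjoint V (word_op V X u) y)))\<^sup>2)"
    unfolding sum_words_add by (simp add: adjoint_word_append[of X, OF X y])
  also have "\<dots> \<le> (\<Sum>u\<in>words j. word_norm V X k * (vnorm V (adjoint V (word_op V X u) y))\<^sup>2)"
    by (intro sum_mono word_norm_bound X Xy)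
  also have "\<dots> = word_norm V X k * (\<Sum>u\<in>words j. (vnorm V (adjoint V (word_op V X u) y))\<^sup>2)"
    by (simp add: sum_distrib_left)
  also have "\<dots> \<le> word_norm V X k * (word_norm V X j * (vnorm V y)\<^sup>2)"
    by (intro mult_left_mono word_norm_bound word_norm_nonneg X y)
  finally show "(\<Sum>w\<in>words (j + k). (vnorm V (adjoint V (word_op V X w) y))\<^sup>2)
    \<le> word_norm V X j * word_norm V X k * (vnorm V y)\<^sup>2" by (simp add: mult_ac)
qed (simp add: word_norm_nonneg[of X, OF X])

lemma word_norm_le_row_norm:
  fixes X :: "'n::finite \<Rightarrow> 'a \<Rightarrow> 'a"
  assumes X: "\<And>i. X i \<in> bounded_ops V"
  shows "word_norm V X k \<le> ((row_norm V X)\<^sup>2) ^ k"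
proof (induction k)
  case 0
  show ?case by (rule word_norm_leI[OF X]) (auto simp: adjoint_op_id)
next
  case (Suc k)
  have "word_norm V X (Suc 0) \<le> (row_norm V X)\<^sup>2"
    by (rule word_norm_leI[OF X])
       (use row_norm_bound[of X, OF X] in \<open>auto simp: sum_words_1 adjoint_word_single[of X, OF X] simp del: word_op.simps\<close>)
  then have "word_norm V X (Suc 0) * word_norm V X k \<le> (row_norm V X)\<^sup>2 * ((row_norm V X)\<^sup>2) ^ k"
    by (intro mult_mono Suc.IH word_norm_nonneg X) auto
  then show ?case using word_norm_add[of X, OF X, of "Suc 0" k] by simp
qed

lemma coeff_norm:
  fixes A :: "'n::finite list \<Rightarrow> 'a \<Rightarrow> 'a"
  assumes A: "\<And>w. A w \<in> bounded_ops V"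
  shows coeff_norm_nonneg: "coeff_norm V A k \<ge> 0"
    and coeff_norm_bound: "\<And>x. x \<in> carrier V \<Longrightarrow>
      (\<Sum>w\<in>words k. (vnorm V (A w x))\<^sup>2) \<le> coeff_norm V A k * (vnorm V x)\<^sup>2"
    and coeff_norm_leI: "\<And>c. (\<And>x. x \<in> carrier V \<Longrightarrow>
      (\<Sum>w\<in>words k. (vnorm V (A w x))\<^sup>2) \<le> c * (vnorm V x)\<^sup>2) \<Longrightarrow> c \<ge> 0 \<Longrightarrow> coeff_norm V A k \<le> c"
proof -
  show "coeff_norm V A k \<ge> 0" unfolding coeff_norm_def
    by (rule gram_norm_nonneg) (use A in \<open>auto simp: adjoint_bop ip_adjoint_left\<close>)
  show "(\<Sum>w\<in>words k. (vnorm V (A w x))\<^sup>2) \<le> coeff_norm V A k * (vnorm V x)\<^sup>2" if "x \<in> carrier V" for x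
    unfolding coeff_norm_def
    by (rule gram_norm_bound) (use A that in \<open>auto simp: adjoint_bop ip_adjoint_left\<close>)
  show "coeff_norm V A k \<le> c" if c: "\<And>x. x \<in> carrier V \<Longrightarrow>
      (\<Sum>w\<in>words k. (vnorm V (A w x))\<^sup>2) \<le> c * (vnorm V x)\<^sup>2" "c \<ge> 0" for c
    unfolding coeff_norm_def
    by (rule gram_norm_leI) (use A c in \<open>auto simp: adjoint_bop ip_adjoint_left\<close>)
qed

section \<open>Convergent series of operators\<close>

lemma op_norm_tendsto_ip:
  assumes P: "\<And>N. P N \<in> bounded_ops V" and S: "S \<in> bounded_ops V"
    and lim: "(\<lambda>N. op_norm V (op_diff V (P N) S)) \<longlonglongrightarrow> 0"
    and u: "u \<in> carrier V" and v: "v \<in> carrier V"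
  shows "(\<lambda>N. inner_prod V (P N u) v) \<longlonglongrightarrow> inner_prod V (S u) v"
proof -
  have "(\<lambda>N. inner_prod V (P N u) v - inner_prod V (S u) v) \<longlonglongrightarrow> 0"
  proof (rule null_comparison)
    show "(\<lambda>N. op_norm V (op_diff V (P N) S) * vnorm V u * vnorm V v) \<longlonglongrightarrow> 0"
      by (intro tendsto_mult_left_zero lim)
    fix N
    have "inner_prod V (P N u) v - inner_prod V (S u) v = inner_prod V (op_diff V (P N) S u) v"
      using u v bop_closed[OF P] bop_closed[OF S] by simp
    also have "cmod \<dots> \<le> vnorm V (op_diff V (P N) S u) * vnorm V v"
      by (intro cauchy_schwarz bop_closed[OF op_diff_bop] P S u v)
    also have "\<dots> \<le> op_norm V (op_diff V (P N) S) * vnorm V u * vnorm V v"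
      by (intro mult_right_mono op_norm_bound op_diff_bop P S u vnorm_nonneg v)
    finally show "cmod (inner_prod V (P N u) v - inner_prod V (S u) v)
        \<le> op_norm V (op_diff V (P N) S) * vnorm V u * vnorm V v" .
  qed
  then show ?thesis by (rule LIM_zero_cancel)
qed

text \<open>The sum is obtained by representing the form made of the scalar series, so that
  completeness of the space of operators is not invoked. Norm convergence follows since the tails of
  \<open>b\<close> dominate the remainders.\<close>

lemma op_series:
  assumes F: "\<And>k. F k \<in> bounded_ops V"
    and b: "\<And>k x. x \<in> carrier V \<Longrightarrow> vnorm V (F k x) \<le> b k * vnorm V x"
    and b0: "\<And>k. b k \<ge> 0" and sb: "summable b"
  obtains S where "S \<in> bounded_ops V"
    and "(\<lambda>N. op_norm V (op_diff V (op_sum V F {..<N}) S)) \<longlonglongrightarrow> 0"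
    and "\<And>u v. u \<in> carrier V \<Longrightarrow> v \<in> carrier V \<Longrightarrow>
      (\<lambda>k. inner_prod V (F k u) v) sums inner_prod V (S u) v"
proof -
  note [simp] = bop_closed[OF F]
  have bnd: "cmod (inner_prod V (F k u) v) \<le> b k * (vnorm V u * vnorm V v)"
    if "u \<in> carrier V" "v \<in> carrier V" for k u v
  proof -
    have "cmod (inner_prod V (F k u) v) \<le> vnorm V (F k u) * vnorm V v"
      using that by (intro cauchy_schwarz) auto
    also have "\<dots> \<le> b k * vnorm V u * vnorm V v"
      using that by (intro mult_right_mono b) auto
    finally show ?thesis by (simp add: mult.assoc)
  qed
  have sm: "summable (\<lambda>k. inner_prod V (F k u) v)" if "u \<in> carrier V" "v \<in> carrier V" for u v
    by (rule summable_comparison_test'[OF summable_mult2[OF sb, of "vnorm V u * vnorm V v"]])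
       (use bnd that in auto)
  \<comment> \<open>The conjugate makes \<open>B\<close> linear in \<open>v\<close>, as
    \<open>op_exists\<close> requires: the operator sought stands in the second slot,
    \<open>inner_prod V v (S u) = B v u\<close>.\<close>
  define B where "B = (\<lambda>v u. cnj (\<Sum>k. inner_prod V (F k u) v))"
  have "\<exists>R\<in>bounded_ops V. (\<forall>i\<in>carrier V. \<forall>u\<in>carrier V. inner_prod V i (R u) = B i u) \<and>
    (\<forall>u\<in>carrier V. vnorm V (R u) \<le> suminf b * vnorm V u)"
  proof (rule op_exists[where \<phi> = "\<lambda>x. x"])
    show "carrier V \<noteq> {}" using zero_closed by blast
    show "cmod (B i u) \<le> suminf b * vnorm V i * vnorm V u"
      if "i \<in> carrier V" "u \<in> carrier V" for i u
    proof -
      have "cmod (B i u) \<le> (\<Sum>k. b k * (vnorm V u * vnorm V i))"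
        unfolding B_def complex_mod_cnj
        by (rule norm_suminf_le) (use bnd that in \<open>auto intro: summable_mult2 sb\<close>)
      then show ?thesis using suminf_mult2[OF sb, of "vnorm V u * vnorm V i"] by (simp add: mult_ac)
    qed
    show "\<exists>k\<in>carrier V. k = i \<oplus> j \<and> (\<forall>u\<in>carrier V. B k u = B i u + B j u)"
      if "i \<in> carrier V" "j \<in> carrier V" for i j
      using that by (intro bexI[of _ "i \<oplus> j"]) (auto simp: B_def suminf_add[OF sm sm, symmetric])
    show "\<exists>k\<in>carrier V. k = a \<odot> i \<and> (\<forall>u\<in>carrier V. B k u = a * B i u)"
      if "i \<in> carrier V" for i a
      using that by (intro bexI[of _ "a \<odot> i"]) (auto simp: B_def suminf_mult[OF sm])
    show "u = \<zero>" if u: "u \<in> carrier V" "\<And>i. i \<in> carrier V \<Longrightarrow> inner_prod V i u = 0" for u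
      by (rule ip_definite) (use u in auto)
    show "B i (u \<oplus> v) = B i u + B i v" if "i \<in> carrier V" "u \<in> carrier V" "v \<in> carrier V" for i u v
      using that by (auto simp: B_def suminf_add[OF sm sm, symmetric] bop_add[OF F])
    show "B i (c \<odot> u) = cnj c * B i u" if "i \<in> carrier V" "u \<in> carrier V" for i u c
      using that by (auto simp: B_def suminf_mult[OF sm] bop_smult[OF F])
    show "suminf b \<ge> 0" by (rule suminf_nonneg[OF sb b0])
  qed
  then obtain S where S: "S \<in> bounded_ops V"
    and SB: "\<And>v u. v \<in> carrier V \<Longrightarrow> u \<in> carrier V \<Longrightarrow> inner_prod V v (S u) = B v u" by blast
  have Sip: "inner_prod V (S u) v = (\<Sum>k. inner_prod V (F k u) v)"
    if "u \<in> carrier V" "v \<in> carrier V" for u v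
    using SB[of v u] ip_cnj[of v "S u"] bop_closed[OF S] that by (simp add: B_def)
  have sums: "(\<lambda>k. inner_prod V (F k u) v) sums inner_prod V (S u) v"
    if "u \<in> carrier V" "v \<in> carrier V" for u v
    using Sip[OF that] sm[OF that] by (simp add: summable_sums)
  define P where "P = (\<lambda>N. op_sum V F {..<N})"
  have P: "P N \<in> bounded_ops V" for N unfolding P_def by (intro op_sum_bop F) auto
  have tail: "op_norm V (op_diff V (P N) S) \<le> (\<Sum>k. b (k + N))" for N
  proof (rule op_norm_leI)
    have sbN: "summable (\<lambda>k. b (k + N))" using sb by (subst summable_iff_shift)
    show n0: "0 \<le> (\<Sum>k. b (k + N))" by (rule suminf_nonneg[OF sbN b0])
    fix u assume u: "u \<in> carrier V"
    show "vnorm V (op_diff V (P N) S u) \<le> (\<Sum>k. b (k + N)) * vnorm V u"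
    proof (rule vnorm_leI)
      fix v assume v: "v \<in> carrier V"
      have "inner_prod V (P N u) v = (\<Sum>k<N. inner_prod V (F k u) v)"
        unfolding P_def by (intro ip_op_sum F u v) auto
      then have "inner_prod V (op_diff V (P N) S u) v = - (\<Sum>k. inner_prod V (F (k + N) u) v)"
        using u v bop_closed[OF P] bop_closed[OF S] suminf_minus_initial_segment[OF sm[OF u v], of N]
        by (simp add: Sip)
      also have "cmod \<dots> \<le> (\<Sum>k. b (k + N) * (vnorm V u * vnorm V v))"
        unfolding norm_minus_cancel
        by (rule norm_suminf_le) (use bnd u v in \<open>auto intro: summable_mult2 sbN\<close>)
      also have "\<dots> = (\<Sum>k. b (k + N)) * (vnorm V u * vnorm V v)"
        by (rule suminf_mult2[OF sbN, symmetric])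
      finally show "cmod (inner_prod V (op_diff V (P N) S u) v) \<le> (\<Sum>k. b (k + N)) * vnorm V u * vnorm V v"
        by (simp add: mult.assoc)
    qed (use n0 u bop_closed[OF op_diff_bop[OF P S]] in auto)
  qed
  have "(\<lambda>N. op_norm V (op_diff V (P N) S)) \<longlonglongrightarrow> 0"
  proof (rule null_comparison)
    show "norm (op_norm V (op_diff V (P N) S)) \<le> (\<Sum>k. b (k + N))" for N
      using tail[of N] op_norm_nonneg[OF op_diff_bop[OF P S]] by simp
    show "(\<lambda>N. \<Sum>k. b (k + N)) \<longlonglongrightarrow> 0" by (rule suminf_exist_split2[OF sb])
  qed
  then show thesis using that S sums by (simp add: P_def)
qed

text \<open>For \<open>cmod c > b\<close> the Neumann series
  \<open>\<Sum>k. S\<^sup>k / c\<^sup>k\<^sup>+\<^sup>1\<close> converges and inverts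
  \<open>c - S\<close>.\<close>

lemma op_spectral_radius_le:
  assumes S: "S \<in> bounded_ops V" and b: "b \<ge> 0"
    and Sb: "\<And>x. x \<in> carrier V \<Longrightarrow> vnorm V (S x) \<le> b * vnorm V x"
  shows "op_spectral_radius V S \<le> b"
proof -
  note Sc [simp] = bop_closed[OF S]
  have "c \<notin> op_spectrum V S" if c: "cmod c > b" for c
  proof -
    have c0: "c \<noteq> 0" using c b by auto
    define P where "P = (\<lambda>k. (S ^^ k))"
    have Pc [simp]: "P k x \<in> carrier V" if "x \<in> carrier V" for k x
      unfolding P_def using that by (induction k) auto
    have PS: "P k (S x) = P (Suc k) x" for k x by (simp add: P_def funpow_swap1)
    have SP: "S (P k x) = P (Suc k) x" for k x by (simp add: P_def)
    have Padd: "P k (x \<oplus> y) = P k x \<oplus> P k y" if "x \<in> carrier V" "y \<in> carrier V" for k x y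
      using that Pc unfolding P_def by (induction k) (auto simp: bop_add[OF S])
    have Psm: "P k (a \<odot> x) = a \<odot> P k x" if "x \<in> carrier V" for k x a
      using that Pc unfolding P_def by (induction k) (auto simp: bop_smult[OF S])
    have Pb: "vnorm V (P k x) \<le> b ^ k * vnorm V x" if x: "x \<in> carrier V" for k x
    proof (induction k)
      case (Suc k)
      have "vnorm V (P (Suc k) x) \<le> b * vnorm V (P k x)"
        using Sb[OF Pc[OF x, of k]] by (simp add: P_def)
      also have "\<dots> \<le> b * (b ^ k * vnorm V x)" by (rule mult_left_mono[OF Suc.IH b])
      finally show ?case by (simp add: mult.assoc)
    qed (simp add: P_def)
    define F where "F = (\<lambda>k. (\<lambda>x\<in>carrier V. (1 / c ^ Suc k) \<odot> P k x))"
    define r where "r = b / cmod c"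
    have r: "0 \<le> r" "r < 1" using c b by (auto simp: r_def divide_less_eq_1)
    have Fb: "vnorm V (F k x) \<le> (r ^ k / cmod c) * vnorm V x" if x: "x \<in> carrier V" for k x
    proof -
      have "vnorm V (F k x) = (1 / cmod c ^ Suc k) * vnorm V (P k x)"
        using x by (simp add: F_def norm_divide norm_power norm_mult)
      also have "\<dots> \<le> (1 / cmod c ^ Suc k) * (b ^ k * vnorm V x)"
        by (intro mult_left_mono Pb x) auto
      also have "\<dots> = (r ^ k / cmod c) * vnorm V x"
        by (simp add: r_def power_divide)
      finally show ?thesis .
    qed
    have F: "F k \<in> bounded_ops V" for k
    proof (rule bounded_opsI)
      show "\<And>x. x \<in> carrier V \<Longrightarrow> vnorm V (F k x) \<le> (r ^ k / cmod c) * vnorm V x" by (rule Fb)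
      show "F k (x \<oplus> y) = F k x \<oplus> F k y" if "x \<in> carrier V" "y \<in> carrier V" for x y
        by (rule eqI) (use that in \<open>auto simp: F_def Padd algebra_simps\<close>)
      show "F k (a \<odot> x) = a \<odot> F k x" if "x \<in> carrier V" for a x
        by (rule eqI) (use that in \<open>auto simp: F_def Psm algebra_simps\<close>)
    qed (auto simp: F_def)
    obtain R where R: "R \<in> bounded_ops V"
      and Rs: "\<And>u v. u \<in> carrier V \<Longrightarrow> v \<in> carrier V \<Longrightarrow>
        (\<lambda>k. inner_prod V (F k u) v) sums inner_prod V (R u) v"
    proof (rule op_series[of F "\<lambda>k. r ^ k / cmod c"])
      show "summable (\<lambda>k. r ^ k / cmod c)" by (intro summable_divide summable_geometric) (use r in auto)
    qed (use F Fb r in auto)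
    note [simp] = bop_closed[OF R]
    define D where "D = op_diff V (op_smult V c (op_id V)) S"
    have Dx: "D x = c \<odot> x \<ominus> S x" if "x \<in> carrier V" for x using that by (simp add: D_def)
    \<comment> \<open>Multiplying the Neumann series by \<open>c - S\<close> from either side
      produces this telescoping series.\<close>
    have tel: "(\<lambda>k. (1 / c ^ k) * inner_prod V (P k u) v - (1 / c ^ Suc k) * inner_prod V (P (Suc k) u) v)
        sums inner_prod V u v" if u: "u \<in> carrier V" and v: "v \<in> carrier V" for u v
    proof -
      define g where "g = (\<lambda>k. (1 / c ^ k) * inner_prod V (P k u) v)"
      have "g \<longlonglongrightarrow> 0"
      proof (rule null_comparison)
        show "(\<lambda>k. r ^ k * (vnorm V u * vnorm V v)) \<longlonglongrightarrow> 0"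
          by (intro tendsto_mult_left_zero LIMSEQ_power_zero) (use r in auto)
        fix k
        have "cmod (inner_prod V (P k u) v) \<le> vnorm V (P k u) * vnorm V v"
          by (intro cauchy_schwarz Pc u v)
        also have "\<dots> \<le> b ^ k * vnorm V u * vnorm V v"
          by (intro mult_right_mono Pb u vnorm_nonneg v)
        finally have "(1 / cmod c ^ k) * cmod (inner_prod V (P k u) v)
            \<le> (1 / cmod c ^ k) * (b ^ k * vnorm V u * vnorm V v)"
          by (intro mult_left_mono) auto
        then show "norm (g k) \<le> r ^ k * (vnorm V u * vnorm V v)"
          by (simp add: g_def norm_mult norm_divide norm_power r_def power_divide)
      qed
      from telescope_sums'[OF this] show ?thesis by (simp add: g_def P_def)
    qed
    have "op_mult V R D = op_id V"
    proof (rule bop_eqI)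
      fix u assume u: "u \<in> carrier V"
      have "R (c \<odot> u \<ominus> S u) = u"
      proof (rule eqI)
        fix v assume v: "v \<in> carrier V"
        have "(\<lambda>k. inner_prod V (F k (c \<odot> u \<ominus> S u)) v) sums inner_prod V (R (c \<odot> u \<ominus> S u)) v"
          using u v by (intro Rs) auto
        moreover have "inner_prod V (F k (c \<odot> u \<ominus> S u)) v =
            (1 / c ^ k) * inner_prod V (P k u) v - (1 / c ^ Suc k) * inner_prod V (P (Suc k) u) v" for k
          using u v c0 by (simp add: F_def minus_eq_add Padd Psm PS field_simps)
        ultimately show "inner_prod V (R (c \<odot> u \<ominus> S u)) v = inner_prod V u v"
          using tel[OF u v] sums_unique2 by simp
      qed (use u in auto)
      then show "op_mult V R D u = op_id V u" using u by (simp add: Dx)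
    qed (auto simp: D_def intro!: op_mult_bop op_diff_bop op_smult_bop R S)
    moreover have "op_mult V D R = op_id V"
    proof (rule bop_eqI)
      fix u assume u: "u \<in> carrier V"
      have "c \<odot> R u \<ominus> S (R u) = u"
      proof (rule eqI)
        fix v assume v: "v \<in> carrier V"
        have av: "adjoint V S v \<in> carrier V" by (rule bop_closed[OF adjoint_bop[OF S] v])
        \<comment> \<open>The series for \<open>R\<close> is available only inside inner products,
          so the \<open>S\<close> on the left is moved to the other argument as an adjoint.\<close>
        have "(\<lambda>k. c * inner_prod V (F k u) v - inner_prod V (F k u) (adjoint V S v))
            sums (c * inner_prod V (R u) v - inner_prod V (R u) (adjoint V S v))"
          by (intro sums_diff sums_mult Rs u v av)
        moreover have "c * inner_prod V (F k u) v - inner_prod V (F k u) (adjoint V S v) =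
            (1 / c ^ k) * inner_prod V (P k u) v - (1 / c ^ Suc k) * inner_prod V (P (Suc k) u) v" for k
          using u v av c0 ip_adjoint[OF S, of "P k u" v] by (simp add: F_def SP)
        ultimately show "inner_prod V (c \<odot> R u \<ominus> S (R u)) v = inner_prod V u v"
          using tel[OF u v] sums_unique2 u v by (simp add: ip_adjoint[OF S])
      qed (use u in auto)
      then show "op_mult V D R u = op_id V u" using u by (simp add: Dx)
    qed (auto simp: D_def intro!: op_mult_bop op_diff_bop op_smult_bop R S)
    ultimately show ?thesis unfolding op_spectrum_def D_def using R by blast
  qed
  then have "cmod c \<le> b" if "c \<in> op_spectrum V S" for c
    using that by (meson not_le)
  then show ?thesis unfolding op_spectral_radius_def
    by (intro cSup_least) (use b in auto)
qed

end

section \<open>Tensor products of operators\<close>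

text \<open>Lists of pairs are formal sums of elementary tensors. Distinct lists may denote the same
  vector, but lists allow concatenation, induction on the length and the formal application of
  operators by \<open>map_prod\<close>.\<close>

primrec tsum :: "'t hilbert \<Rightarrow> ('k \<Rightarrow> 'h \<Rightarrow> 't) \<Rightarrow> ('k \<times> 'h) list \<Rightarrow> 't" where
  "tsum T t [] = \<zero>\<^bsub>T\<^esub>"
| "tsum T t (p # l) = t (fst p) (snd p) \<oplus>\<^bsub>T\<^esub> tsum T t l"

locale htensor = K: hilb K + H: hilb H + T: hilb T
  for K :: "'k hilbert" and H :: "'h hilbert" and T :: "'t hilbert" +
  fixes t :: "'k \<Rightarrow> 'h \<Rightarrow> 't"
  assumes tensor: "hilbert_tensor K H T t"
begin

definition pairs :: "('k \<times> 'h) list set" where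
  "pairs = lists (carrier K \<times> carrier H)"

lemma pairs_simps [simp]:
  "[] \<in> pairs" "p # l \<in> pairs \<longleftrightarrow> fst p \<in> carrier K \<and> snd p \<in> carrier H \<and> l \<in> pairs"
  "l @ l' \<in> pairs \<longleftrightarrow> l \<in> pairs \<and> l' \<in> pairs"
  by (cases p; auto simp: pairs_def)+

lemma t_closed [simp, intro]: "x \<in> carrier K \<Longrightarrow> y \<in> carrier H \<Longrightarrow> t x y \<in> carrier T"
  and t_add_left: "x \<in> carrier K \<Longrightarrow> x' \<in> carrier K \<Longrightarrow> y \<in> carrier H \<Longrightarrow>
    t (x \<oplus>\<^bsub>K\<^esub> x') y = t x y \<oplus>\<^bsub>T\<^esub> t x' y"
  and t_add_right: "x \<in> carrier K \<Longrightarrow> y \<in> carrier H \<Longrightarrow> y' \<in> carrier H \<Longrightarrow>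
    t x (y \<oplus>\<^bsub>H\<^esub> y') = t x y \<oplus>\<^bsub>T\<^esub> t x y'"
  and t_smult_left: "x \<in> carrier K \<Longrightarrow> y \<in> carrier H \<Longrightarrow> t (c \<odot>\<^bsub>K\<^esub> x) y = c \<odot>\<^bsub>T\<^esub> t x y"
  and t_smult_right: "x \<in> carrier K \<Longrightarrow> y \<in> carrier H \<Longrightarrow> t x (c \<odot>\<^bsub>H\<^esub> y) = c \<odot>\<^bsub>T\<^esub> t x y"
  and t_ip [simp]: "x \<in> carrier K \<Longrightarrow> x' \<in> carrier K \<Longrightarrow> y \<in> carrier H \<Longrightarrow> y' \<in> carrier H \<Longrightarrow>
    inner_prod T (t x y) (t x' y') = inner_prod K x x' * inner_prod H y y'"
  using tensor unfolding hilbert_tensor_def by simp_all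

lemma vnorm_t: "x \<in> carrier K \<Longrightarrow> y \<in> carrier H \<Longrightarrow> vnorm T (t x y) = vnorm K x * vnorm H y"
  using T.ip_self[of "t x y"] K.ip_self[of x] H.ip_self[of y]
  by (metis t_closed t_ip of_real_mult of_real_eq_iff power_mult_distrib power2_eq_imp_eq
      mult_nonneg_nonneg K.vnorm_nonneg H.vnorm_nonneg T.vnorm_nonneg)

lemma tsum_closed [simp, intro]: "l \<in> pairs \<Longrightarrow> tsum T t l \<in> carrier T"
  by (induction l) auto

lemma tsum_append: "l \<in> pairs \<Longrightarrow> l' \<in> pairs \<Longrightarrow> tsum T t (l @ l') = tsum T t l \<oplus>\<^bsub>T\<^esub> tsum T t l'"
proof (induction l)
  case Nil
  then show ?case by (intro T.eqI) auto
next
  case (Cons p l)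
  then show ?case by (intro T.eqI) (auto simp: Cons.IH algebra_simps)
qed

lemma tsum_smult: "l \<in> pairs \<Longrightarrow> tsum T t (map (map_prod (\<lambda>x. c \<odot>\<^bsub>K\<^esub> x) (\<lambda>x. x)) l) = c \<odot>\<^bsub>T\<^esub> tsum T t l"
proof (induction l)
  case Nil
  show ?case by (intro T.eqI) auto
next
  case (Cons p l)
  then show ?case by (intro T.eqI) (auto simp: Cons.IH t_smult_left algebra_simps)
qed

lemma finsum_tsum:
  "\<forall>i<N. f i \<in> carrier K \<and> g i \<in> carrier H \<Longrightarrow>
    finsum T (\<lambda>i. t (f i) (g i)) {..<N} = tsum T t (map (\<lambda>i. (f i, g i)) (rev [0..<N]))"
proof (induction N)
  case (Suc N)
  have "finsum T (\<lambda>i. t (f i) (g i)) (insert N {..<N}) =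
      t (f N) (g N) \<oplus>\<^bsub>T\<^esub> finsum T (\<lambda>i. t (f i) (g i)) {..<N}"
    using Suc.prems by (intro T.finsum_insert) auto
  then show ?case using Suc by (simp add: lessThan_Suc)
qed simp

lemma tsum_dense:
  assumes v: "v \<in> carrier T" and e: "e > 0"
  obtains l where "l \<in> pairs" "vnorm T (v \<ominus>\<^bsub>T\<^esub> tsum T t l) < e"
proof -
  have "\<forall>v\<in>carrier T. \<forall>e>0. \<exists>(N::nat) f g.
        (\<forall>i<N. f i \<in> carrier K \<and> g i \<in> carrier H) \<and>
        vnorm T (v \<ominus>\<^bsub>T\<^esub> finsum T (\<lambda>i. t (f i) (g i)) {..<N}) < e"
    using tensor unfolding hilbert_tensor_def by simp
  then obtain N f g where fg: "\<forall>i<(N::nat). f i \<in> carrier K \<and> g i \<in> carrier H"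
    and d: "vnorm T (v \<ominus>\<^bsub>T\<^esub> finsum T (\<lambda>i. t (f i) (g i)) {..<N}) < e"
    using v e by blast
  show thesis
    by (rule that[of "map (\<lambda>i. (f i, g i)) (rev [0..<N])"])
       (use d fg in \<open>auto simp: finsum_tsum[OF fg] pairs_def\<close>)
qed

lemma tsum_approx:
  assumes v: "v \<in> carrier T"
  obtains s where "\<And>n. s n \<in> pairs" "(\<lambda>n::nat. vnorm T (tsum T t (s n) \<ominus>\<^bsub>T\<^esub> v)) \<longlonglongrightarrow> 0"
proof -
  have "\<exists>l. l \<in> pairs \<and> vnorm T (v \<ominus>\<^bsub>T\<^esub> tsum T t l) < inverse (real (Suc n))" for n
    using tsum_dense[OF v, of "inverse (real (Suc n))"] by (metis inverse_Suc)
  then obtain s where s: "\<And>n. s n \<in> pairs"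
    and d: "\<And>n. vnorm T (v \<ominus>\<^bsub>T\<^esub> tsum T t (s n)) < inverse (real (Suc n))" by metis
  have "(\<lambda>n. vnorm T (tsum T t (s n) \<ominus>\<^bsub>T\<^esub> v)) \<longlonglongrightarrow> 0"
  proof (rule null_comparison[OF _ LIMSEQ_inverse_real_of_nat])
    show "norm (vnorm T (tsum T t (s n) \<ominus>\<^bsub>T\<^esub> v)) \<le> inverse (real (Suc n))" for n
      using less_imp_le[OF d[of n]] T.vnorm_minus_commute[OF v tsum_closed[OF s]] v s
      by (simp del: of_nat_Suc)
  qed
  then show thesis using that s by blast
qed

lemma ip_tsum_eq_0:
  assumes "u \<in> carrier T" "\<And>x y. x \<in> carrier K \<Longrightarrow> y \<in> carrier H \<Longrightarrow> inner_prod T (t x y) u = 0"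
    and "l \<in> pairs"
  shows "inner_prod T (tsum T t l) u = 0"
  using assms(3) by (induction l) (use assms(1,2) in auto)

text \<open>\<open>u\<close> is a limit of sums of elementary tensors, all of them orthogonal to
  \<open>u\<close>, hence orthogonal to itself.\<close>

lemma total:
  assumes u: "u \<in> carrier T"
    and "\<And>x y. x \<in> carrier K \<Longrightarrow> y \<in> carrier H \<Longrightarrow> inner_prod T (t x y) u = 0"
  shows "u = \<zero>\<^bsub>T\<^esub>"
proof -
  obtain s where s: "\<And>n. s n \<in> pairs" and lim: "(\<lambda>n::nat. vnorm T (tsum T t (s n) \<ominus>\<^bsub>T\<^esub> u)) \<longlonglongrightarrow> 0"
    using tsum_approx[OF u] by blast
  have "(\<lambda>n. inner_prod T (tsum T t (s n)) u) \<longlonglongrightarrow> inner_prod T u u"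
    by (rule T.ip_tendsto[OF tsum_closed[OF s] u lim u])
  then have "inner_prod T u u = 0"
    using ip_tsum_eq_0[OF u assms(2) s] by (simp add: LIMSEQ_const_iff)
  then show ?thesis by (rule T.ip_definite[OF u])
qed

lemma T_eqI:
  assumes u: "u \<in> carrier T" "u' \<in> carrier T"
    and "\<And>x y. x \<in> carrier K \<Longrightarrow> y \<in> carrier H \<Longrightarrow> inner_prod T (t x y) u = inner_prod T (t x y) u'"
  shows "u = u'"
proof -
  have "u \<ominus>\<^bsub>T\<^esub> u' = \<zero>\<^bsub>T\<^esub>" by (rule total) (use assms in auto)
  moreover have "u = (u \<ominus>\<^bsub>T\<^esub> u') \<oplus>\<^bsub>T\<^esub> u'" "u' = \<zero>\<^bsub>T\<^esub> \<oplus>\<^bsub>T\<^esub> u'" by (rule T.eqI; use u in simp)+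
  ultimately show ?thesis by simp
qed

text \<open>Passing to adjoints replaces a continuity argument: the adjoint at \<open>v\<close> is
  determined by its inner products with elementary tensors, and these involve only the values of the
  operator on elementary tensors.\<close>

lemma bop_weak_eqI:
  assumes R: "R \<in> bounded_ops T" and R': "R' \<in> bounded_ops T"
    and eq: "\<And>x y x' y'. x \<in> carrier K \<Longrightarrow> y \<in> carrier H \<Longrightarrow> x' \<in> carrier K \<Longrightarrow> y' \<in> carrier H \<Longrightarrow>
      inner_prod T (R (t x y)) (t x' y') = inner_prod T (R' (t x y)) (t x' y')"
  shows "R = R'"
proof -
  note [simp] = T.bop_closed[OF R] T.bop_closed[OF R']
    T.bop_closed[OF T.adjoint_bop[OF R]] T.bop_closed[OF T.adjoint_bop[OF R']]
  have "R (t x y) = R' (t x y)" if "x \<in> carrier K" "y \<in> carrier H" for x y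
  proof (rule T_eqI)
    fix x' y' assume "x' \<in> carrier K" "y' \<in> carrier H"
    then show "inner_prod T (t x' y') (R (t x y)) = inner_prod T (t x' y') (R' (t x y))"
      using eq that T.ip_cnj[of "R (t x y)" "t x' y'"] T.ip_cnj[of "R' (t x y)" "t x' y'"] by simp
  qed (use that in auto)
  then have "adjoint T R v = adjoint T R' v" if v: "v \<in> carrier T" for v
    by (intro T_eqI) (use v in \<open>auto simp flip: T.ip_adjoint[OF R] T.ip_adjoint[OF R']\<close>)
  then have "inner_prod T (R u) v = inner_prod T (R' u) v" if "u \<in> carrier T" "v \<in> carrier T" for u v
    using that by (simp add: T.ip_adjoint[OF R] T.ip_adjoint[OF R'])
  then show ?thesis by (intro T.bop_eqI[OF R R'] T.eqI) auto
qed

section \<open>Gram-Schmidt estimates on sums of elementary tensors\<close>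

lemma map_pairs:
  assumes "\<And>x. x \<in> carrier K \<Longrightarrow> f x \<in> carrier K" "\<And>y. y \<in> carrier H \<Longrightarrow> g y \<in> carrier H" "l \<in> pairs"
  shows "map (map_prod f g) l \<in> pairs"
  using assms(3) by (induction l) (use assms(1,2) in auto)

text \<open>
  One step of Gram-Schmidt on the first coordinates, applied simultaneously to
  \<open>(id \<otimes> B) v\<close> for all operators \<open>B\<close>; note that \<open>a x = 0\<close> when \<open>x1 = \<zero>\<close>.
\<close>

lemma tsum_split:
  assumes x1: "x1 \<in> carrier K" and l: "l \<in> pairs"
  defines "a \<equiv> \<lambda>x. inner_prod K x x1 / inner_prod K x1 x1"
  defines "l' \<equiv> map (map_prod (\<lambda>x. x \<ominus>\<^bsub>K\<^esub> a x \<odot>\<^bsub>K\<^esub> x1) (\<lambda>x. x)) l"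
  shows "\<exists>s\<in>carrier H. \<forall>B\<in>bounded_ops H. tsum T t (map (map_prod (\<lambda>x. x) B) l) =
      t x1 (B s) \<oplus>\<^bsub>T\<^esub> tsum T t (map (map_prod (\<lambda>x. x) B) l')"
  using l unfolding l'_def
proof (induction l)
  case Nil
  have "\<zero>\<^bsub>T\<^esub> = t x1 \<zero>\<^bsub>H\<^esub> \<oplus>\<^bsub>T\<^esub> \<zero>\<^bsub>T\<^esub>"
    using t_smult_right[OF x1 H.zero_closed, of 0] x1 by (intro T.eqI) simp_all
  then show ?case by (intro bexI[of _ "\<zero>\<^bsub>H\<^esub>"]) auto
next
  case (Cons p l)
  obtain x y where p: "p = (x, y)" and x: "x \<in> carrier K" and y: "y \<in> carrier H"
    using Cons.prems by (cases p) auto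
  have l: "l \<in> pairs" using Cons.prems by simp
  let ?r = "map (map_prod (\<lambda>x. x \<ominus>\<^bsub>K\<^esub> a x \<odot>\<^bsub>K\<^esub> x1) (\<lambda>x. x)) l"
  have r: "?r \<in> pairs" by (rule map_pairs[OF _ _ l]) (use x1 in auto)
  obtain s where s: "s \<in> carrier H" and IH: "\<And>B. B \<in> bounded_ops H \<Longrightarrow> tsum T t (map (map_prod (\<lambda>x. x) B) l) =
      t x1 (B s) \<oplus>\<^bsub>T\<^esub> tsum T t (map (map_prod (\<lambda>x. x) B) ?r)" using Cons.IH[OF l] by blast
  have "tsum T t (map (map_prod (\<lambda>x. x) B) (p # l)) = t x1 (B (a x \<odot>\<^bsub>H\<^esub> y \<oplus>\<^bsub>H\<^esub> s)) \<oplus>\<^bsub>T\<^esub>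
      tsum T t (map (map_prod (\<lambda>x. x) B) (map (map_prod (\<lambda>x. x \<ominus>\<^bsub>K\<^esub> a x \<odot>\<^bsub>K\<^esub> x1) (\<lambda>x. x)) (p # l)))"
    if B: "B \<in> bounded_ops H" for B
  proof -
    note [simp] = H.bop_closed[OF B]
    have r': "map (map_prod (\<lambda>x. x) B) ?r \<in> pairs" "map (map_prod (\<lambda>x. x) B) l \<in> pairs"
      by (rule map_pairs[OF _ _ r] map_pairs[OF _ _ l]; simp)+
    let ?u = "tsum T t (map (map_prod (\<lambda>x. x) B) ?r)"
    have u: "?u \<in> carrier T" using r' by blast
    have "t x (B y) \<oplus>\<^bsub>T\<^esub> (t x1 (B s) \<oplus>\<^bsub>T\<^esub> ?u) =
        t x1 (B (a x \<odot>\<^bsub>H\<^esub> y \<oplus>\<^bsub>H\<^esub> s)) \<oplus>\<^bsub>T\<^esub> (t (x \<ominus>\<^bsub>K\<^esub> a x \<odot>\<^bsub>K\<^esub> x1) (B y) \<oplus>\<^bsub>T\<^esub> ?u)"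
      using x y s x1 u
      by (intro T.eqI) (simp_all add: K.minus_eq_add H.bop_add[OF B] H.bop_smult[OF B] t_add_left t_add_right
          t_smult_left t_smult_right)
    then show ?thesis using IH[OF B] by (simp add: p)
  qed
  then show ?case using x y s by (intro bexI[of _ "a x \<odot>\<^bsub>H\<^esub> y \<oplus>\<^bsub>H\<^esub> s"] ballI) blast+
qed

text \<open>After the Gram-Schmidt step every first coordinate is orthogonal to \<open>x1\<close>,
  and \<open>B\<close> acts on the second coordinates only. For \<open>x1 = \<zero>\<close> the
  orthogonality is trivial.\<close>

lemma tsum_split_orth:
  assumes x1: "x1 \<in> carrier K" and z: "z \<in> carrier H" and l: "l \<in> pairs"
    and B: "\<And>y. y \<in> carrier H \<Longrightarrow> B y \<in> carrier H"
  shows "inner_prod T (tsum T t (map (map_prod (\<lambda>x. x) B) (map (map_prod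
    (\<lambda>x. x \<ominus>\<^bsub>K\<^esub> (inner_prod K x x1 / inner_prod K x1 x1) \<odot>\<^bsub>K\<^esub> x1) (\<lambda>x. x)) l))) (t x1 z) = 0"
  using l
proof (induction l)
  case (Cons p l)
  obtain x y where p: "p = (x, y)" and x: "x \<in> carrier K" and y: "y \<in> carrier H" and l: "l \<in> pairs"
    using Cons.prems by (cases p) auto
  let ?f = "\<lambda>x. x \<ominus>\<^bsub>K\<^esub> (inner_prod K x x1 / inner_prod K x1 x1) \<odot>\<^bsub>K\<^esub> x1"
  let ?u = "tsum T t (map (map_prod (\<lambda>x. x) B) (map (map_prod ?f (\<lambda>x. x)) l))"
  have "map (map_prod ?f (\<lambda>x. x)) l \<in> pairs" by (rule map_pairs[OF _ _ l]) (use x1 in auto)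
  then have "map (map_prod (\<lambda>x. x) B) (map (map_prod ?f (\<lambda>x. x)) l) \<in> pairs" by (rule map_pairs[rotated 2]) (use B in auto)
  then have u: "?u \<in> carrier T" by (rule tsum_closed)
  have "inner_prod K (?f x) x1 = 0"
    using K.ip_definite[OF x1] x x1 by (cases "inner_prod K x1 x1 = 0") simp_all
  then have "inner_prod T (t (?f x) (B y)) (t x1 z) = 0"
    using x x1 y z B by simp
  moreover have "inner_prod T (t (?f x) (B y) \<oplus>\<^bsub>T\<^esub> ?u) (t x1 z) =
      inner_prod T (t (?f x) (B y)) (t x1 z) + inner_prod T ?u (t x1 z)"
    using x x1 y z B u by (intro T.ip_add_left) auto
  ultimately show ?case using Cons.IH[OF l]
    by (simp only: p list.map tsum.simps map_prod_simp fst_conv snd_conv add_0)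
qed (use x1 z in simp)

text \<open>Tensoring a column of operators with the identity of \<open>K\<close> does not increase
  its norm. One Gram-Schmidt step writes the tensor as an orthogonal sum of one elementary tensor
  and the tensor of a shorter list; the decomposition is respected by every operator acting on the
  second factor, so squared norms add and induction on the length applies.\<close>

lemma tsum_estimate_right:
  assumes W: "finite W" and B: "\<And>i. i \<in> W \<Longrightarrow> B i \<in> bounded_ops H"
    and c: "\<And>y. y \<in> carrier H \<Longrightarrow> (\<Sum>i\<in>W. (vnorm H (B i y))\<^sup>2) \<le> c * (vnorm H y)\<^sup>2"
    and "l \<in> pairs"
  shows "(\<Sum>i\<in>W. (vnorm T (tsum T t (map (map_prod (\<lambda>x. x) (B i)) l)))\<^sup>2) \<le> c * (vnorm T (tsum T t l))\<^sup>2"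
  using assms(4)
proof (induction l rule: length_induct)
  case (1 l)
  show ?case
  proof (cases l)
    case (Cons p l0)
    obtain x1 y1 where p: "p = (x1, y1)" and x1: "x1 \<in> carrier K" and y1: "y1 \<in> carrier H" and l0: "l0 \<in> pairs"
      using 1 Cons by (cases p) auto
    define l' where "l' = map (map_prod
      (\<lambda>x. x \<ominus>\<^bsub>K\<^esub> (inner_prod K x x1 / inner_prod K x1 x1) \<odot>\<^bsub>K\<^esub> x1) (\<lambda>x. x)) l0"
    have l': "l' \<in> pairs" unfolding l'_def by (rule map_pairs[OF _ _ l0]) (use x1 in auto)
    obtain s0 where s0: "s0 \<in> carrier H" and sp: "\<And>B. B \<in> bounded_ops H \<Longrightarrow>
        tsum T t (map (map_prod (\<lambda>x. x) B) l0) = t x1 (B s0) \<oplus>\<^bsub>T\<^esub> tsum T t (map (map_prod (\<lambda>x. x) B) l')"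
      using tsum_split[OF x1 l0] unfolding l'_def by blast
    let ?s = "y1 \<oplus>\<^bsub>H\<^esub> s0"
    have main: "(vnorm T (tsum T t (map (map_prod (\<lambda>x. x) C) l)))\<^sup>2 =
        (vnorm K x1)\<^sup>2 * (vnorm H (C ?s))\<^sup>2 + (vnorm T (tsum T t (map (map_prod (\<lambda>x. x) C) l')))\<^sup>2"
      if C: "C \<in> bounded_ops H" for C
    proof -
      note [simp] = H.bop_closed[OF C]
      let ?u = "tsum T t (map (map_prod (\<lambda>x. x) C) l')"
      have u: "?u \<in> carrier T" by (intro tsum_closed map_pairs[OF _ _ l']) auto
      have "tsum T t (map (map_prod (\<lambda>x. x) C) l) = t x1 (C ?s) \<oplus>\<^bsub>T\<^esub> ?u"
        using sp[OF C] x1 y1 s0 u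
        by (intro T.eqI) (simp_all add: Cons p H.bop_add[OF C] t_add_right)
      moreover have "inner_prod T ?u (t x1 (C ?s)) = 0"
        unfolding l'_def by (rule tsum_split_orth[OF x1 _ l0]) (use y1 s0 in auto)
      then have "Re (inner_prod T (t x1 (C ?s)) ?u) = 0"
        using T.ip_cnj[OF u, of "t x1 (C ?s)"] x1 y1 s0 by simp
      ultimately show ?thesis
        using x1 y1 s0 u by (simp add: T.vnorm_add_sq vnorm_t power_mult_distrib)
    qed
    have map_id: "map (map_prod (\<lambda>x. x) (op_id H)) r = r" if "r \<in> pairs" for r
      using that by (induction r) auto
    \<comment> \<open>The same decomposition with the identity in place of \<open>C\<close> gives
      the norm of the tensor itself.\<close>
    have nl: "(vnorm T (tsum T t l))\<^sup>2 = (vnorm K x1)\<^sup>2 * (vnorm H ?s)\<^sup>2 + (vnorm T (tsum T t l'))\<^sup>2"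
      using main[OF H.op_id_bop] map_id[OF l'] map_id[of l] 1(2) y1 s0 by simp
    have IH: "(\<Sum>i\<in>W. (vnorm T (tsum T t (map (map_prod (\<lambda>x. x) (B i)) l')))\<^sup>2) \<le> c * (vnorm T (tsum T t l'))\<^sup>2"
    proof (rule 1(1)[rule_format, OF _ l'])
      show "length l' < length l" by (simp add: Cons l'_def)
    qed
    have "(\<Sum>i\<in>W. (vnorm T (tsum T t (map (map_prod (\<lambda>x. x) (B i)) l)))\<^sup>2) =
       (\<Sum>i\<in>W. (vnorm K x1)\<^sup>2 * (vnorm H (B i ?s))\<^sup>2 + (vnorm T (tsum T t (map (map_prod (\<lambda>x. x) (B i)) l')))\<^sup>2)"
      by (intro sum.cong refl main B)
    also have "\<dots> = (vnorm K x1)\<^sup>2 * (\<Sum>i\<in>W. (vnorm H (B i ?s))\<^sup>2) +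
       (\<Sum>i\<in>W. (vnorm T (tsum T t (map (map_prod (\<lambda>x. x) (B i)) l')))\<^sup>2)"
      by (simp add: sum.distrib sum_distrib_left)
    also have "\<dots> \<le> (vnorm K x1)\<^sup>2 * (c * (vnorm H ?s)\<^sup>2) + c * (vnorm T (tsum T t l'))\<^sup>2"
      by (intro add_mono mult_left_mono c IH) (use y1 s0 in auto)
    also have "\<dots> = c * (vnorm T (tsum T t l))\<^sup>2" unfolding nl by (simp add: algebra_simps)
    finally show ?thesis .
  qed simp
qed

end

lemma (in htensor) tsum_swap: "tsum T (\<lambda>y x. t x y) (map prod.swap l) = tsum T t l"
  by (induction l) auto

text \<open>The notion is symmetric in the two factors, so that estimates for operators on the left
  factor follow from those on the right.\<close>

lemma (in htensor) htensor_flip: "htensor H K T (\<lambda>y x. t x y)"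
proof (intro htensor.intro htensor_axioms.intro)
  show "hilb H" "hilb K" "hilb T" by unfold_locales
  show "hilbert_tensor H K T (\<lambda>y x. t x y)"
    unfolding hilbert_tensor_def
  proof (intro conjI ballI allI impI)
    show "complex_hilbert_space T" by (rule T.hilbert)
    fix v and e :: real assume v: "v \<in> carrier T" and e: "e > 0"
    have "\<forall>v\<in>carrier T. \<forall>e>0. \<exists>(N::nat) f g.
        (\<forall>i<N. f i \<in> carrier K \<and> g i \<in> carrier H) \<and>
        vnorm T (v \<ominus>\<^bsub>T\<^esub> finsum T (\<lambda>i. t (f i) (g i)) {..<N}) < e"
      using tensor unfolding hilbert_tensor_def by simp
    then show "\<exists>N f g. (\<forall>i<N. f i \<in> carrier H \<and> g i \<in> carrier K) \<and>
        vnorm T (v \<ominus>\<^bsub>T\<^esub> (\<Oplus>\<^bsub>T\<^esub>i\<in>{..<N::nat}. t (g i) (f i))) < e"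
      using v e by blast
  qed (simp_all add: t_add_left t_add_right t_smult_left t_smult_right)
qed

section \<open>Estimates on the left factor and tensor products of operators\<close>

context htensor
begin

lemma tsum_estimate_left:
  assumes W: "finite W" and B: "\<And>i. i \<in> W \<Longrightarrow> B i \<in> bounded_ops K"
    and c: "\<And>x. x \<in> carrier K \<Longrightarrow> (\<Sum>i\<in>W. (vnorm K (B i x))\<^sup>2) \<le> c * (vnorm K x)\<^sup>2"
    and l: "l \<in> pairs"
  shows "(\<Sum>i\<in>W. (vnorm T (tsum T t (map (map_prod (B i) (\<lambda>x. x)) l)))\<^sup>2) \<le> c * (vnorm T (tsum T t l))\<^sup>2"
proof -
  interpret F: htensor H K T "\<lambda>y x. t x y" by (rule htensor_flip)
  have l': "map prod.swap l \<in> F.pairs" using l by (induction l) auto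
  have "map (map_prod (\<lambda>x. x) C) (map prod.swap l) = map prod.swap (map (map_prod C (\<lambda>x. x)) l)" for C :: "'k \<Rightarrow> 'k"
    by auto
  then show ?thesis using F.tsum_estimate_right[OF W B c l'] by (simp add: tsum_swap del: map_map)
qed

text \<open>A sum over a single index, to match the hypotheses of the estimates above.\<close>

lemma op_norm_estimate:
  assumes "hilb V" "S \<in> bounded_ops V" "y \<in> carrier V"
  shows "(\<Sum>i\<in>{()}. (vnorm V (S y))\<^sup>2) \<le> (op_norm V S)\<^sup>2 * (vnorm V y)\<^sup>2"
proof -
  interpret hilb V by fact
  have "(vnorm V (S y))\<^sup>2 \<le> (op_norm V S * vnorm V y)\<^sup>2"
    by (intro power_mono op_norm_bound vnorm_nonneg assms bop_closed[OF assms(2)])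
  then show ?thesis by (simp add: power_mult_distrib)
qed

text \<open>The operators are applied one factor at a time, and each application is a column
  estimate with a single entry. The bound refers to the vector denoted by the list, which makes it
  usable for defining operators on all of \<open>T\<close>.\<close>

lemma tsum_map_bound:
  assumes A: "A \<in> bounded_ops K" and S: "S \<in> bounded_ops H" and l: "l \<in> pairs"
  shows "vnorm T (tsum T t (map (map_prod A S) l)) \<le> op_norm K A * op_norm H S * vnorm T (tsum T t l)"
proof (rule power2_le_imp_le)
  have l': "map (map_prod (\<lambda>x. x) S) l \<in> pairs"
    by (rule map_pairs[OF _ _ l]) (use H.bop_closed[OF S] in auto)
  have eq: "map (map_prod A S) l = map (map_prod A (\<lambda>x. x)) (map (map_prod (\<lambda>x. x) S) l)" by auto
  have "(vnorm T (tsum T t (map (map_prod A S) l)))\<^sup>2 \<le>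
      (op_norm K A)\<^sup>2 * (vnorm T (tsum T t (map (map_prod (\<lambda>x. x) S) l)))\<^sup>2"
    unfolding eq using tsum_estimate_left[where W = "{()}" and B = "\<lambda>_. A" and c = "(op_norm K A)\<^sup>2" and l = "map (map_prod (\<lambda>x. x) S) l"]
      op_norm_estimate[OF K.hilb_axioms A] A l' by (simp del: map_map)
  also have "\<dots> \<le> (op_norm K A)\<^sup>2 * ((op_norm H S)\<^sup>2 * (vnorm T (tsum T t l))\<^sup>2)"
    using tsum_estimate_right[where W = "{()}" and B = "\<lambda>_. S" and c = "(op_norm H S)\<^sup>2" and l = l]
      op_norm_estimate[OF H.hilb_axioms S] S l by (intro mult_left_mono) simp_all
  finally show "(vnorm T (tsum T t (map (map_prod A S) l)))\<^sup>2 \<le>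
      (op_norm K A * op_norm H S * vnorm T (tsum T t l))\<^sup>2" by (simp add: power_mult_distrib mult_ac)
  show "0 \<le> op_norm K A * op_norm H S * vnorm T (tsum T t l)"
    by (intro mult_nonneg_nonneg K.op_norm_nonneg H.op_norm_nonneg T.vnorm_nonneg A S tsum_closed l)
qed

text \<open>The operator is defined by duality: its inner product with a sum of elementary tensors
  is prescribed by applying the adjoints of \<open>A\<close> and \<open>S\<close> formally to that
  sum. Boundedness of this form is \<open>tsum_map_bound\<close>, and on elementary tensors the two
  adjoints are moved back.\<close>

lemma tensor_op_ex:
  assumes A: "A \<in> bounded_ops K" and S: "S \<in> bounded_ops H"
  shows "\<exists>R\<in>bounded_ops T. \<forall>x\<in>carrier K. \<forall>y\<in>carrier H. R (t x y) = t (A x) (S y)"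
proof -
  let ?A = "adjoint K A" and ?S = "adjoint H S"
  note bA = K.adjoint_bop[OF A] and bS = H.adjoint_bop[OF S]
  note [simp] = K.bop_closed[OF A] H.bop_closed[OF S] K.bop_closed[OF bA] H.bop_closed[OF bS]
  have mp [simp]: "map (map_prod ?A ?S) l \<in> pairs" if "l \<in> pairs" for l
    by (rule map_pairs[OF _ _ that]) auto
  define B where "B = (\<lambda>l u. inner_prod T (tsum T t (map (map_prod ?A ?S) l)) u)"
  have "\<exists>R\<in>bounded_ops T. (\<forall>l\<in>pairs. \<forall>u\<in>carrier T. inner_prod T (tsum T t l) (R u) = B l u) \<and>
    (\<forall>u\<in>carrier T. vnorm T (R u) \<le> op_norm K ?A * op_norm H ?S * vnorm T u)"
  proof (rule T.op_exists[where \<phi> = "tsum T t" and I = pairs and B = B and b = "op_norm K ?A * op_norm H ?S"])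
    show "pairs \<noteq> {}" using pairs_simps(1) by force
    show "\<exists>k\<in>pairs. tsum T t k = tsum T t i \<oplus>\<^bsub>T\<^esub> tsum T t j \<and> (\<forall>u\<in>carrier T. B k u = B i u + B j u)"
      if "i \<in> pairs" "j \<in> pairs" for i j
      by (rule bexI[of _ "i @ j"]) (use that mp[of i] mp[of j] in \<open>simp_all add: B_def tsum_append del: mp\<close>)
    show "\<exists>k\<in>pairs. tsum T t k = a \<odot>\<^bsub>T\<^esub> tsum T t i \<and> (\<forall>u\<in>carrier T. B k u = a * B i u)"
      if i: "i \<in> pairs" for i a
    proof (intro bexI[of _ "map (map_prod (\<lambda>x. a \<odot>\<^bsub>K\<^esub> x) (\<lambda>x. x)) i"] conjI ballI)
      show "tsum T t (map (map_prod ((\<odot>\<^bsub>K\<^esub>) a) (\<lambda>x. x)) i) = a \<odot>\<^bsub>T\<^esub> tsum T t i" by (rule tsum_smult[OF i])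
      have "map (map_prod ?A ?S) (map (map_prod ((\<odot>\<^bsub>K\<^esub>) a) (\<lambda>x. x)) i) =
          map (map_prod ((\<odot>\<^bsub>K\<^esub>) a) (\<lambda>x. x)) (map (map_prod ?A ?S) i)"
        using i by (induction i) (auto simp: K.bop_smult[OF bA])
      then show "B (map (map_prod ((\<odot>\<^bsub>K\<^esub>) a) (\<lambda>x. x)) i) u = a * B i u" if "u \<in> carrier T" for u
        using that i mp[OF i] by (simp add: B_def tsum_smult del: mp map_map)
      show "map (map_prod ((\<odot>\<^bsub>K\<^esub>) a) (\<lambda>x. x)) i \<in> pairs" by (rule map_pairs[OF _ _ i]) auto
    qed
    show "u = \<zero>\<^bsub>T\<^esub>" if u: "u \<in> carrier T" and z: "\<And>i. i \<in> pairs \<Longrightarrow> inner_prod T (tsum T t i) u = 0" for u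
    proof (rule total[OF u])
      fix x y assume "x \<in> carrier K" "y \<in> carrier H"
      then show "inner_prod T (t x y) u = 0" using z[of "[(x, y)]"] u by simp
    qed
    show "B i (u \<oplus>\<^bsub>T\<^esub> v) = B i u + B i v" if "i \<in> pairs" "u \<in> carrier T" "v \<in> carrier T" for i u v
      using that mp[of i] by (simp add: B_def del: mp)
    show "B i (c \<odot>\<^bsub>T\<^esub> u) = cnj c * B i u" if "i \<in> pairs" "u \<in> carrier T" for i u c
      using that mp[of i] by (simp add: B_def del: mp)
    show "cmod (B i u) \<le> op_norm K ?A * op_norm H ?S * vnorm T (tsum T t i) * vnorm T u"
      if i: "i \<in> pairs" and u: "u \<in> carrier T" for i u
    proof -
      have "cmod (B i u) \<le> vnorm T (tsum T t (map (map_prod ?A ?S) i)) * vnorm T u"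
        unfolding B_def by (intro T.cauchy_schwarz tsum_closed mp i u)
      also have "\<dots> \<le> op_norm K ?A * op_norm H ?S * vnorm T (tsum T t i) * vnorm T u"
        by (intro mult_right_mono tsum_map_bound bA bS i T.vnorm_nonneg u)
      finally show ?thesis .
    qed
    show "0 \<le> op_norm K ?A * op_norm H ?S"
      by (intro mult_nonneg_nonneg K.op_norm_nonneg H.op_norm_nonneg bA bS)
  qed auto
  then obtain R where R: "R \<in> bounded_ops T"
    and RB: "\<And>l u. l \<in> pairs \<Longrightarrow> u \<in> carrier T \<Longrightarrow> inner_prod T (tsum T t l) (R u) = B l u" by blast
  have "R (t x y) = t (A x) (S y)" if x: "x \<in> carrier K" and y: "y \<in> carrier H" for x y
  proof (rule T_eqI)
    fix x' y' assume x': "x' \<in> carrier K" and y': "y' \<in> carrier H"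
    have "inner_prod T (t x' y') (R (t x y)) = inner_prod T (t (?A x') (?S y')) (t x y)"
      using RB[of "[(x', y')]" "t x y"] x y x' y' T.bop_closed[OF R] by (simp add: B_def)
    also have "\<dots> = inner_prod T (t x' y') (t (A x) (S y))"
      using x y x' y' by (simp add: K.ip_adjoint_left[OF A] H.ip_adjoint_left[OF S])
    finally show "inner_prod T (t x' y') (R (t x y)) = inner_prod T (t x' y') (t (A x) (S y))" .
  qed (use x y T.bop_closed[OF R] in auto)
  then show ?thesis using R by blast
qed

lemma tensor_op:
  assumes A: "A \<in> bounded_ops K" and S: "S \<in> bounded_ops H"
  shows tensor_op_bop: "tensor_op K H T t A S \<in> bounded_ops T"
    and tensor_op_t: "\<And>x y. x \<in> carrier K \<Longrightarrow> y \<in> carrier H \<Longrightarrow> tensor_op K H T t A S (t x y) = t (A x) (S y)"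
    and tensor_op_eqI: "\<And>R. R \<in> bounded_ops T \<Longrightarrow>
      (\<And>x y. x \<in> carrier K \<Longrightarrow> y \<in> carrier H \<Longrightarrow> R (t x y) = t (A x) (S y)) \<Longrightarrow> tensor_op K H T t A S = R"
proof -
  let ?P = "\<lambda>R. R \<in> bounded_ops T \<and> (\<forall>x\<in>carrier K. \<forall>y\<in>carrier H. R (t x y) = t (A x) (S y))"
  have un: "R = R'" if "?P R" "?P R'" for R R'
    by (rule bop_weak_eqI) (use that in auto)
  then have "\<exists>!R. ?P R" using tensor_op_ex[OF A S] by blast
  from theI'[OF this] have P: "?P (tensor_op K H T t A S)" unfolding tensor_op_def .
  then show "tensor_op K H T t A S \<in> bounded_ops T"
    "\<And>x y. x \<in> carrier K \<Longrightarrow> y \<in> carrier H \<Longrightarrow> tensor_op K H T t A S (t x y) = t (A x) (S y)" by blast+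
  show "\<And>R. R \<in> bounded_ops T \<Longrightarrow>
      (\<And>x y. x \<in> carrier K \<Longrightarrow> y \<in> carrier H \<Longrightarrow> R (t x y) = t (A x) (S y)) \<Longrightarrow> tensor_op K H T t A S = R"
    using un[OF P] by blast
qed

lemma tensor_op_tsum:
  assumes A: "A \<in> bounded_ops K" and S: "S \<in> bounded_ops H" and l: "l \<in> pairs"
  shows "tensor_op K H T t A S (tsum T t l) = tsum T t (map (map_prod A S) l)"
  using l by (induction l) (auto simp: tensor_op_t[OF A S] T.bop_add[OF tensor_op_bop[OF A S]]
      T.bop_zero[OF tensor_op_bop[OF A S]])

lemma adjoint_tensor_op:
  assumes A: "A \<in> bounded_ops K" and S: "S \<in> bounded_ops H"
  shows "adjoint T (tensor_op K H T t A S) = tensor_op K H T t (adjoint K A) (adjoint H S)"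
proof (rule tensor_op_eqI[symmetric, OF K.adjoint_bop[OF A] H.adjoint_bop[OF S]])
  show "adjoint T (tensor_op K H T t A S) \<in> bounded_ops T" by (intro T.adjoint_bop tensor_op_bop A S)
  note [simp] = K.bop_closed[OF A] H.bop_closed[OF S] K.bop_closed[OF K.adjoint_bop[OF A]]
    H.bop_closed[OF H.adjoint_bop[OF S]] T.bop_closed[OF T.adjoint_bop[OF tensor_op_bop[OF A S]]]
  fix x y assume xy: "x \<in> carrier K" "y \<in> carrier H"
  show "adjoint T (tensor_op K H T t A S) (t x y) = t (adjoint K A x) (adjoint H S y)"
    by (rule T_eqI) (use xy in \<open>auto simp: tensor_op_t[OF A S] K.ip_adjoint[OF A] H.ip_adjoint[OF S]
        simp flip: T.ip_adjoint[OF tensor_op_bop[OF A S]]\<close>)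
qed

text \<open>Both sides are continuous in the vector, and sums of elementary tensors are
  dense.\<close>

lemma estimate_extend:
  assumes W: "finite W" and R: "\<And>i. i \<in> W \<Longrightarrow> R i \<in> bounded_ops T"
    and "\<And>l. l \<in> pairs \<Longrightarrow> (\<Sum>i\<in>W. (vnorm T (R i (tsum T t l)))\<^sup>2) \<le> c * (vnorm T (tsum T t l))\<^sup>2"
    and u: "u \<in> carrier T"
  shows "(\<Sum>i\<in>W. (vnorm T (R i u))\<^sup>2) \<le> c * (vnorm T u)\<^sup>2"
proof -
  obtain s where s: "\<And>n. s n \<in> pairs" and lim: "(\<lambda>n::nat. vnorm T (tsum T t (s n) \<ominus>\<^bsub>T\<^esub> u)) \<longlonglongrightarrow> 0"
    using tsum_approx[OF u] by blast
  have l1: "(\<lambda>n. vnorm T (tsum T t (s n))) \<longlonglongrightarrow> vnorm T u"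
    by (rule T.vnorm_tendsto[OF tsum_closed[OF s] u lim])
  have l2: "(\<lambda>n. vnorm T (R i (tsum T t (s n)))) \<longlonglongrightarrow> vnorm T (R i u)" if i: "i \<in> W" for i
  proof (rule T.vnorm_tendsto)
    show "(\<lambda>n. vnorm T (R i (tsum T t (s n)) \<ominus>\<^bsub>T\<^esub> R i u)) \<longlonglongrightarrow> 0"
    proof (rule null_comparison)
      show "(\<lambda>n. op_norm T (R i) * vnorm T (tsum T t (s n) \<ominus>\<^bsub>T\<^esub> u)) \<longlonglongrightarrow> 0"
        by (rule tendsto_mult_right_zero[OF lim])
      show "norm (vnorm T (R i (tsum T t (s n)) \<ominus>\<^bsub>T\<^esub> R i u)) \<le> op_norm T (R i) * vnorm T (tsum T t (s n) \<ominus>\<^bsub>T\<^esub> u)" for n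
        using T.op_norm_bound[OF R[OF i], of "tsum T t (s n) \<ominus>\<^bsub>T\<^esub> u"] u s[of n] T.bop_closed[OF R[OF i]]
        by (simp add: T.bop_minus[OF R[OF i]])
    qed
  qed (use u s T.bop_closed[OF R[OF i]] in auto)
  have "(\<lambda>n. \<Sum>i\<in>W. (vnorm T (R i (tsum T t (s n))))\<^sup>2) \<longlonglongrightarrow> (\<Sum>i\<in>W. (vnorm T (R i u))\<^sup>2)"
    by (intro tendsto_sum tendsto_power l2)
  moreover have "(\<lambda>n. c * (vnorm T (tsum T t (s n)))\<^sup>2) \<longlonglongrightarrow> c * (vnorm T u)\<^sup>2"
    by (rule tendsto_mult_left[OF tendsto_power[OF l1]])
  ultimately show ?thesis
    by (rule LIMSEQ_le) (use assms(3) s in auto)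
qed

lemma tensor_estimate_right:
  assumes W: "finite W" and B: "\<And>i. i \<in> W \<Longrightarrow> B i \<in> bounded_ops H"
    and c: "\<And>y. y \<in> carrier H \<Longrightarrow> (\<Sum>i\<in>W. (vnorm H (B i y))\<^sup>2) \<le> c * (vnorm H y)\<^sup>2"
    and u: "u \<in> carrier T"
  shows "(\<Sum>i\<in>W. (vnorm T (tensor_op K H T t (op_id K) (B i) u))\<^sup>2) \<le> c * (vnorm T u)\<^sup>2"
proof (rule estimate_extend[OF W _ _ u])
  fix l assume l: "l \<in> pairs"
  have eq: "map (map_prod (op_id K) (B i)) l = map (map_prod (\<lambda>x. x) (B i)) l" for i
    using l by (induction l) auto
  have "(\<Sum>i\<in>W. (vnorm T (tensor_op K H T t (op_id K) (B i) (tsum T t l)))\<^sup>2) =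
      (\<Sum>i\<in>W. (vnorm T (tsum T t (map (map_prod (\<lambda>x. x) (B i)) l)))\<^sup>2)"
    by (intro sum.cong refl) (simp only: tensor_op_tsum[OF K.op_id_bop B l] eq)
  also have "\<dots> \<le> c * (vnorm T (tsum T t l))\<^sup>2" by (rule tsum_estimate_right[OF W B c l])
  finally show "(\<Sum>i\<in>W. (vnorm T (tensor_op K H T t (op_id K) (B i) (tsum T t l)))\<^sup>2) \<le> c * (vnorm T (tsum T t l))\<^sup>2" .
qed (intro tensor_op_bop K.op_id_bop B)

lemma tensor_estimate_left:
  assumes W: "finite W" and B: "\<And>i. i \<in> W \<Longrightarrow> B i \<in> bounded_ops K"
    and c: "\<And>y. y \<in> carrier K \<Longrightarrow> (\<Sum>i\<in>W. (vnorm K (B i y))\<^sup>2) \<le> c * (vnorm K y)\<^sup>2"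
    and u: "u \<in> carrier T"
  shows "(\<Sum>i\<in>W. (vnorm T (tensor_op K H T t (B i) (op_id H) u))\<^sup>2) \<le> c * (vnorm T u)\<^sup>2"
proof (rule estimate_extend[OF W _ _ u])
  fix l assume l: "l \<in> pairs"
  have eq: "map (map_prod (B i) (op_id H)) l = map (map_prod (B i) (\<lambda>x. x)) l" for i
    using l by (induction l) auto
  have "(\<Sum>i\<in>W. (vnorm T (tensor_op K H T t (B i) (op_id H) (tsum T t l)))\<^sup>2) =
      (\<Sum>i\<in>W. (vnorm T (tsum T t (map (map_prod (B i) (\<lambda>x. x)) l)))\<^sup>2)"
    by (intro sum.cong refl) (simp only: tensor_op_tsum[OF B H.op_id_bop l] eq)
  also have "\<dots> \<le> c * (vnorm T (tsum T t l))\<^sup>2" by (rule tsum_estimate_left[OF W B c l])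
  finally show "(\<Sum>i\<in>W. (vnorm T (tensor_op K H T t (B i) (op_id H) (tsum T t l)))\<^sup>2) \<le> c * (vnorm T (tsum T t l))\<^sup>2" .
qed (intro tensor_op_bop H.op_id_bop B)

end

section \<open>Evaluation and the Schwarz lemma\<close>

lemma le_power_if_root_le:
  fixes c s :: real
  assumes "c \<ge> 0" "k > 0" "c powr (1 / (2 * real k)) \<le> s"
  shows "c \<le> (s\<^sup>2) ^ k"
proof -
  have s: "s \<ge> 0" using order_trans[OF powr_ge_zero assms(3)] .
  have "c = (c powr (1 / (2 * real k))) powr (real (2 * k))"
    using assms(1,2) by (cases "c = 0") (simp_all add: powr_powr)
  also have "\<dots> \<le> s powr (real (2 * k))"
    by (rule powr_mono2) (use assms in auto)
  also have "\<dots> = s ^ (2 * k)"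
    using s assms(2) by (simp only: powr_realpow' zero_less_mult_iff pos2 simp_thms gr_implies_not0 mult_eq_0_iff)
  finally show ?thesis by (simp add: power_mult)
qed

text \<open>The quotient of \<open>g\<close> by \<open>z\<^sup>m\<close> is the shifted power
  series, hence holomorphic also at 0. On the circle of radius \<open>R\<close> it is at most
  \<open>M / R ^ m\<close>, and the maximum principle carries this bound to the interior point 1.
  The larger radius \<open>R'\<close> makes the quotient continuous on the closed disc.\<close>

lemma schwarz_power_series:
  fixes c :: "nat \<Rightarrow> complex"
  assumes R: "1 < R" "R < R'"
    and g: "\<And>z. cmod z < R' \<Longrightarrow> (\<lambda>k. c k * z ^ k) sums g z"
    and M: "\<And>z. cmod z < R' \<Longrightarrow> cmod (g z) \<le> M"
    and c0: "\<And>k. k < m \<Longrightarrow> c k = 0"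
  shows "cmod (g 1) \<le> M / R ^ m"
proof -
  \<comment> \<open>\<open>c m\<close> is the value of the shifted series at 0, where division by
    zero would give 0.\<close>
  define h where "h = (\<lambda>z. if z = 0 then c m else g z / z ^ m)"
  have h: "(\<lambda>k. c (k + m) * (z - 0) ^ k) sums h z" if z: "z \<in> ball 0 R'" for z
  proof (cases "z = 0")
    case True
    then show ?thesis using powser_sums_zero[of "\<lambda>k. c (k + m)"] by (simp add: h_def)
  next
    case False
    have "(\<lambda>k. c (k + m) * z ^ (k + m)) sums (g z - (\<Sum>i<m. c i * z ^ i))"
      by (rule sums_split_initial_segment[OF g]) (use z in simp)
    then have "(\<lambda>k. c (k + m) * z ^ (k + m)) sums g z"
      using c0 by simp
    from sums_divide[OF this, of "z ^ m"] show ?thesis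
      using False by (simp add: h_def power_add)
  qed
  have hol: "h holomorphic_on ball 0 R'" by (rule power_series_holomorphic[OF h])
  have "cmod (h 1) \<le> M / R ^ m"
  proof (rule maximum_modulus_frontier[of h "ball 0 R"])
    show "h holomorphic_on interior (ball 0 R)"
      by (rule holomorphic_on_subset[OF hol]) (use R in auto)
    show "continuous_on (closure (ball 0 R)) h"
      by (rule continuous_on_subset[OF holomorphic_on_imp_continuous_on[OF hol]]) (use R in auto)
    show "cmod (h z) \<le> M / R ^ m" if "z \<in> frontier (ball 0 R)" for z
    proof -
      have z: "cmod z = R" using that R by (simp add: frontier_ball)
      then have "z \<noteq> 0" using R by auto
      then show ?thesis using M[of z] z R by (simp add: h_def norm_divide norm_power divide_right_mono)
    qed
  qed (use R in auto)
  then show ?thesis by (simp add: h_def)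
qed

context hilb
begin

lemma coeff_norm_summable:
  fixes A :: "'n::finite list \<Rightarrow> 'a \<Rightarrow> 'a"
  assumes A: "free_holomorphic V A" and r: "0 \<le> r" "r < 1"
  shows "summable (\<lambda>k. sqrt (coeff_norm V A k) * r ^ k)"
proof -
  \<comment> \<open>Any \<open>s > 1\<close> with \<open>s * r < 1\<close> would do: the limsup
    condition makes the roots eventually less than \<open>s\<close>, so the terms are dominated by a
    convergent geometric series.\<close>
  define s where "s = 2 / (1 + r)"
  have s: "s > 1" "s * r < 1" "s \<ge> 0" using r by (auto simp: s_def field_simps)
  have Ab: "\<And>w. A w \<in> bounded_ops V"
    and "limsup (\<lambda>k. ereal (coeff_norm V A k powr (1 / (2 * real k)))) \<le> 1"
    using A by (auto simp: free_holomorphic_def)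
  then have "limsup (\<lambda>k. ereal (coeff_norm V A k powr (1 / (2 * real k)))) < ereal s"
    using s by (simp add: le_less_trans one_ereal_def)
  then have "\<forall>\<^sub>F k in sequentially. ereal (coeff_norm V A k powr (1 / (2 * real k))) < ereal s"
    by (rule Limsup_lessD)
  \<comment> \<open>The index \<open>k = 0\<close> is excluded because there the exponent
    \<open>1 / (2 * real k)\<close> is 0 by convention and the root carries no information.\<close>
  then have "\<forall>\<^sub>F k in sequentially. norm (sqrt (coeff_norm V A k) * r ^ k) \<le> (s * r) ^ k"
    using eventually_gt_at_top[of "0 :: nat"]
  proof eventually_elim
    case (elim k)
    have "coeff_norm V A k \<le> (s\<^sup>2) ^ k"
      by (rule le_power_if_root_le) (use elim coeff_norm_nonneg[of A, OF Ab] in auto)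
    then have "coeff_norm V A k \<le> (s ^ k)\<^sup>2" by (simp add: power_mult[symmetric] mult.commute)
    then have "sqrt (coeff_norm V A k) \<le> s ^ k" using s by (intro real_le_lsqrt) auto
    then have "sqrt (coeff_norm V A k) * r ^ k \<le> s ^ k * r ^ k" using r by (intro mult_right_mono) auto
    then show ?case using r coeff_norm_nonneg[of A, OF Ab] by (simp add: power_mult_distrib abs_mult)
  qed
  then show ?thesis
    by (rule summable_comparison_test_ev) (use s r in \<open>auto intro!: summable_geometric\<close>)
qed

lemma row_norm_op_smult_le:
  fixes X :: "'n::finite \<Rightarrow> 'a \<Rightarrow> 'a"
  assumes X: "\<And>i. X i \<in> bounded_ops V"
  shows "row_norm V (\<lambda>i. op_smult V z (X i)) \<le> cmod z * row_norm V X"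
proof (rule row_norm_leI[where B = "\<lambda>i y. cnj z \<odot> adjoint V (X i) y"])
  note [simp] = bop_closed[OF X] bop_closed[OF adjoint_bop[OF X]]
  show "op_smult V z (X i) \<in> bounded_ops V" for i by (rule op_smult_bop[OF X])
  show "inner_prod V (op_smult V z (X i) x) y = inner_prod V x (cnj z \<odot> adjoint V (X i) y)"
    if "x \<in> carrier V" "y \<in> carrier V" for i x y
    using that by (simp add: ip_adjoint[OF X])
  show "(\<Sum>i\<in>UNIV. (vnorm V (cnj z \<odot> adjoint V (X i) y))\<^sup>2) \<le> (cmod z * row_norm V X)\<^sup>2 * (vnorm V y)\<^sup>2"
    if y: "y \<in> carrier V" for y
  proof -
    have "(\<Sum>i\<in>UNIV. (vnorm V (cnj z \<odot> adjoint V (X i) y))\<^sup>2) =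
        (cmod z)\<^sup>2 * (\<Sum>i\<in>UNIV. (vnorm V (adjoint V (X i) y))\<^sup>2)"
      using y by (simp add: power_mult_distrib sum_distrib_left)
    also have "\<dots> \<le> (cmod z)\<^sup>2 * ((row_norm V X)\<^sup>2 * (vnorm V y)\<^sup>2)"
      by (intro mult_left_mono row_norm_bound X y) auto
    finally show ?thesis by (simp add: power_mult_distrib mult.assoc)
  qed
  show "0 \<le> cmod z * row_norm V X" by (intro mult_nonneg_nonneg row_norm_nonneg X) auto
qed (use X in \<open>auto simp: bop_closed[OF adjoint_bop]\<close>)

lemma word_op_smult:
  assumes X: "\<And>i. X i \<in> bounded_ops V"
  shows "word_op V (\<lambda>i. op_smult V z (X i)) w = op_smult V (z ^ length w) (word_op V X w)"
proof (rule bop_eqI)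
  note [simp] = bop_closed[OF word_op_bop[of X, OF X]] bop_closed[OF X]
  show "word_op V (\<lambda>i. op_smult V z (X i)) w \<in> bounded_ops V"
    "op_smult V (z ^ length w) (word_op V X w) \<in> bounded_ops V"
    by (intro word_op_bop op_smult_bop X)+
  show "word_op V (\<lambda>i. op_smult V z (X i)) w x = op_smult V (z ^ length w) (word_op V X w) x"
    if x: "x \<in> carrier V" for x
  proof (induction w)
    case (Cons i w)
    then have "word_op V (\<lambda>i. op_smult V z (X i)) (i # w) x = z \<odot> (z ^ length w \<odot> X i (word_op V X w x))"
      using x by (simp add: bop_smult[OF X])
    also have "\<dots> = op_smult V (z ^ length (i # w)) (word_op V X (i # w)) x"
      using x by (intro eqI) simp_all
    finally show ?case .
  qed (use x in simp)
qed

end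

section \<open>Homogeneous parts and the values of F\<close>

context htensor
begin

definition hom_part :: "('n::finite list \<Rightarrow> 'k \<Rightarrow> 'k) \<Rightarrow> ('n \<Rightarrow> 'h \<Rightarrow> 'h) \<Rightarrow> nat \<Rightarrow> 't \<Rightarrow> 't" where
  "hom_part A X k = op_sum T (\<lambda>w. tensor_op K H T t (A w) (word_op H X w)) (words k)"

lemma hom_part_bop:
  fixes A :: "'n::finite list \<Rightarrow> 'k \<Rightarrow> 'k"
  assumes A: "\<And>w. A w \<in> bounded_ops K" and X: "\<And>i. X i \<in> bounded_ops H"
  shows "hom_part A X k \<in> bounded_ops T"
  unfolding hom_part_def by (intro T.op_sum_bop tensor_op_bop A H.word_op_bop X) auto

lemma ip_hom_part:
  fixes A :: "'n::finite list \<Rightarrow> 'k \<Rightarrow> 'k"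
  assumes A: "\<And>w. A w \<in> bounded_ops K" and X: "\<And>i. X i \<in> bounded_ops H"
    and "u \<in> carrier T" "v \<in> carrier T"
  shows "inner_prod T (hom_part A X k u) v =
    (\<Sum>w\<in>words k. inner_prod T (tensor_op K H T t (A w) (word_op H X w) u) v)"
  unfolding hom_part_def
  by (rule T.ip_op_sum[OF tensor_op_bop[OF A H.word_op_bop[of X, OF X]] finite_words assms(3,4)])

text \<open>A homogeneous part is a row times a column:
  \<open>tensor_op K H T t (A w) (word_op H X w)\<close> factors as \<open>M w\<close> after
  \<open>L w\<close>. Moving \<open>M w\<close> to the other argument leaves a sum of inner
  products, to which Cauchy-Schwarz for families applies; \<open>coeff_norm\<close> bounds the
  column and \<open>word_norm\<close> the row.\<close>

lemma hom_part_bound: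
  fixes A :: "'n::finite list \<Rightarrow> 'k \<Rightarrow> 'k"
  assumes A: "\<And>w. A w \<in> bounded_ops K" and X: "\<And>i. X i \<in> bounded_ops H" and u: "u \<in> carrier T"
  shows "vnorm T (hom_part A X k u) \<le> sqrt (coeff_norm K A k) * sqrt (word_norm H X k) * vnorm T u"
proof (rule T.vnorm_leI)
  let ?X = "word_op H X" and ?c = "coeff_norm K A k" and ?r = "word_norm H X k"
  have Xw: "?X w \<in> bounded_ops H" for w by (rule H.word_op_bop[OF X])
  have c0: "?c \<ge> 0" by (rule K.coeff_norm_nonneg[OF A])
  have r0: "?r \<ge> 0" by (rule H.word_norm_nonneg[OF X])
  show "hom_part A X k u \<in> carrier T" using T.bop_closed[OF hom_part_bop[OF A X] u] .
  show "0 \<le> sqrt ?c * sqrt ?r * vnorm T u" using c0 r0 u by simp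
  fix v assume v: "v \<in> carrier T"
  define L where "L = (\<lambda>w. tensor_op K H T t (A w) (op_id H))"
  define M where "M = (\<lambda>w. tensor_op K H T t (op_id K) (?X w))"
  define N where "N = (\<lambda>w. tensor_op K H T t (op_id K) (adjoint H (?X w)))"
  have L: "L w \<in> bounded_ops T" and M: "M w \<in> bounded_ops T" and N: "N w \<in> bounded_ops T" for w
    unfolding L_def M_def N_def by (intro tensor_op_bop A H.op_id_bop K.op_id_bop Xw H.adjoint_bop)+
  have LM: "tensor_op K H T t (A w) (?X w) = op_mult T (M w) (L w)" for w
    by (rule tensor_op_eqI[OF A Xw T.op_mult_bop[OF M L]])
       (simp add: M_def L_def tensor_op_t A Xw K.bop_closed[OF A])
  have MN: "adjoint T (M w) v = N w v" for w
  proof -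
    have "adjoint K (op_id K) = op_id K"
      by (rule K.bop_eqI[OF K.adjoint_bop]) (auto simp: K.adjoint_op_id)
    then show ?thesis by (simp add: M_def N_def adjoint_tensor_op Xw)
  qed
  have "inner_prod T (hom_part A X k u) v = (\<Sum>w\<in>words k. inner_prod T (L w u) (N w v))"
    unfolding ip_hom_part[OF A X u v]
    by (intro sum.cong refl) (simp add: LM u v T.bop_closed[OF L] T.ip_adjoint[OF M] MN)
  also have "cmod \<dots> \<le> (sqrt ?c * vnorm T u) * (sqrt ?r * vnorm T v)"
  proof (rule T.ip_sum_le)
    have "(\<Sum>w\<in>words k. (vnorm T (L w u))\<^sup>2) \<le> ?c * (vnorm T u)\<^sup>2"
      unfolding L_def by (rule tensor_estimate_left) (use A u K.coeff_norm_bound[of A, OF A] in auto)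
    then show "(\<Sum>w\<in>words k. (vnorm T (L w u))\<^sup>2) \<le> (sqrt ?c * vnorm T u)\<^sup>2"
      using c0 by (simp add: power_mult_distrib)
    have "(\<Sum>w\<in>words k. (vnorm T (N w v))\<^sup>2) \<le> ?r * (vnorm T v)\<^sup>2"
      unfolding N_def by (rule tensor_estimate_right) (use Xw v H.adjoint_bop H.word_norm_bound[of X, OF X] in auto)
    then show "(\<Sum>w\<in>words k. (vnorm T (N w v))\<^sup>2) \<le> (sqrt ?r * vnorm T v)\<^sup>2"
      using r0 by (simp add: power_mult_distrib)
  qed (use c0 r0 u v T.bop_closed[OF L] T.bop_closed[OF N] in auto)
  finally show "cmod (inner_prod T (hom_part A X k u) v) \<le> sqrt ?c * sqrt ?r * vnorm T u * vnorm T v"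
    by (simp only: mult_ac)
qed

lemma row_ballD:
  fixes X :: "'n::finite \<Rightarrow> 'h \<Rightarrow> 'h"
  assumes "X \<in> row_ball H"
  shows "X i \<in> bounded_ops H" "row_norm H X < 1"
  using assms by (auto simp: row_ball_def)

text \<open>The majorant \<open>sqrt (coeff_norm K A k) * row_norm H X ^ k\<close> is summable, so
  the series converges in norm. Weak limits are unique, and the definite description in
  \<open>free_eval\<close> therefore denotes the sum.\<close>

lemma free_eval_aux:
  fixes A :: "'n::finite list \<Rightarrow> 'k \<Rightarrow> 'k"
  assumes A: "free_holomorphic K A" and X: "X \<in> row_ball H"
  shows free_eval_bop: "free_eval K H T t A X \<in> bounded_ops T"
    and free_eval_sums: "\<And>u v. u \<in> carrier T \<Longrightarrow> v \<in> carrier T \<Longrightarrow>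
      (\<lambda>k. inner_prod T (hom_part A X k u) v) sums inner_prod T (free_eval K H T t A X u) v"
proof -
  have Ab: "A w \<in> bounded_ops K" for w using A by (simp add: free_holomorphic_def)
  note Xb = row_ballD(1)[OF X]
  let ?r = "row_norm H X"
  have r: "0 \<le> ?r" "?r < 1" using H.row_norm_nonneg[OF Xb] row_ballD(2)[OF X] by auto
  have c0: "coeff_norm K A k \<ge> 0" for k by (rule K.coeff_norm_nonneg[OF Ab])
  note F = hom_part_bop[of A, OF Ab Xb]
  obtain S where S: "S \<in> bounded_ops T"
    and Sl: "(\<lambda>N. op_norm T (op_diff T (op_sum T (hom_part A X) {..<N}) S)) \<longlonglongrightarrow> 0"
    and Ss: "\<And>u v. u \<in> carrier T \<Longrightarrow> v \<in> carrier T \<Longrightarrow>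
      (\<lambda>k. inner_prod T (hom_part A X k u) v) sums inner_prod T (S u) v"
  proof (rule T.op_series[of "hom_part A X" "\<lambda>k. sqrt (coeff_norm K A k) * ?r ^ k"])
    show "hom_part A X k \<in> bounded_ops T" for k by (rule F)
    show "summable (\<lambda>k. sqrt (coeff_norm K A k) * ?r ^ k)" by (rule K.coeff_norm_summable[OF A r])
    show "vnorm T (hom_part A X k u) \<le> sqrt (coeff_norm K A k) * ?r ^ k * vnorm T u" if u: "u \<in> carrier T" for k u
    proof -
      have "word_norm H X k \<le> (?r ^ k)\<^sup>2"
        using H.word_norm_le_row_norm[of X k, OF Xb] by (simp add: power_mult[symmetric] mult.commute)
      then have "sqrt (word_norm H X k) \<le> ?r ^ k" using r by (intro real_le_lsqrt) auto
      then have "sqrt (coeff_norm K A k) * sqrt (word_norm H X k) * vnorm T u \<le>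
          sqrt (coeff_norm K A k) * ?r ^ k * vnorm T u"
        using c0 u by (intro mult_right_mono mult_left_mono) auto
      then show ?thesis using hom_part_bound[of A X, OF Ab Xb u, of k] by linarith
    qed
  qed (use c0 r in auto)
  have PS: "op_sum T (hom_part A X) {..<N} = free_partial_sum K H T t A X N" for N
    by (simp add: free_partial_sum_def hom_part_def[abs_def])
  have Pb: "op_sum T (hom_part A X) {..<N} \<in> bounded_ops T" for N by (intro T.op_sum_bop F) auto
  have "free_eval K H T t A X = S"
    unfolding free_eval_def PS[symmetric]
  proof (rule the_equality)
    show "S \<in> bounded_ops T \<and> (\<lambda>N. op_norm T (op_diff T (op_sum T (hom_part A X) {..<N}) S)) \<longlonglongrightarrow> 0"
      using S Sl by blast
    fix S' assume S': "S' \<in> bounded_ops T \<and> (\<lambda>N. op_norm T (op_diff T (op_sum T (hom_part A X) {..<N}) S')) \<longlonglongrightarrow> 0"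
    have "inner_prod T (S' u) v = inner_prod T (S u) v" if "u \<in> carrier T" "v \<in> carrier T" for u v
      using T.op_norm_tendsto_ip[OF Pb S Sl that] T.op_norm_tendsto_ip[OF Pb conjunct1[OF S'] conjunct2[OF S'] that]
      by (rule LIMSEQ_unique[rotated])
    then show "S' = S" using S S' T.bop_closed by (intro T.bop_eqI T.eqI) auto
  qed
  then show "free_eval K H T t A X \<in> bounded_ops T" "\<And>u v. u \<in> carrier T \<Longrightarrow> v \<in> carrier T \<Longrightarrow>
      (\<lambda>k. inner_prod T (hom_part A X k u) v) sums inner_prod T (free_eval K H T t A X u) v"
    using S Ss by auto
qed

text \<open>
  A description of the value of \<open>F\<close> by scalars on elementary tensors only; it is insensitive
  to the choice of the tensor product and of equivalent norms.
\<close>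

lemma free_eval_weak:
  fixes A :: "'n::finite list \<Rightarrow> 'k \<Rightarrow> 'k"
  assumes A: "free_holomorphic K A" and X: "X \<in> row_ball H"
    and "x \<in> carrier K" "x' \<in> carrier K" "y \<in> carrier H" "y' \<in> carrier H"
  shows "(\<lambda>k. \<Sum>w\<in>words k. inner_prod K (A w x) x' * inner_prod H (word_op H X w y) y')
    sums inner_prod T (free_eval K H T t A X (t x y)) (t x' y')"
proof -
  have Ab: "A w \<in> bounded_ops K" for w using A by (simp add: free_holomorphic_def)
  note Xb = row_ballD(1)[OF X]
  have "(\<Sum>w\<in>words k. inner_prod K (A w x) x' * inner_prod H (word_op H X w y) y') =
      inner_prod T (hom_part A X k (t x y)) (t x' y')" for k
    using assms(3-) by (simp add: ip_hom_part[of A X, OF Ab Xb] tensor_op_t[OF Ab H.word_op_bop[of X, OF Xb]]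
       K.bop_closed[OF Ab] H.bop_closed[OF H.word_op_bop[of X, OF Xb]])
  then show ?thesis using free_eval_sums[OF A X, of "t x y" "t x' y'"] assms(3-) by simp
qed

lemma free_eval_eqI:
  fixes A :: "'n::finite list \<Rightarrow> 'k \<Rightarrow> 'k"
  assumes A: "free_holomorphic K A" and X: "X \<in> row_ball H" and S: "S \<in> bounded_ops T"
    and "\<And>x x' y y'. x \<in> carrier K \<Longrightarrow> x' \<in> carrier K \<Longrightarrow> y \<in> carrier H \<Longrightarrow> y' \<in> carrier H \<Longrightarrow>
      (\<lambda>k. \<Sum>w\<in>words k. inner_prod K (A w x) x' * inner_prod H (word_op H X w y) y')
      sums inner_prod T (S (t x y)) (t x' y')"
  shows "free_eval K H T t A X = S"
  by (rule bop_weak_eqI[OF free_eval_bop[OF A X] S])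
     (rule sums_unique2[OF free_eval_weak[OF A X] assms(4)])

lemma free_eval_schwarz:
  fixes A :: "'n::finite list \<Rightarrow> 'k \<Rightarrow> 'k"
  assumes A: "free_holomorphic K A"
    and le1: "\<And>X. X \<in> row_ball H \<Longrightarrow> op_norm T (free_eval K H T t A X) \<le> 1"
    and A0: "\<And>w. length w < m \<Longrightarrow> A w = op_zero K"
    and X: "X \<in> row_ball H"
  shows "op_norm T (free_eval K H T t A X) \<le> row_norm H X ^ m"
proof -
  have Ab: "A w \<in> bounded_ops K" for w using A by (simp add: free_holomorphic_def)
  note Xb = row_ballD(1)[OF X]
  define \<rho> where "\<rho> = row_norm H X"
  have \<rho>: "0 \<le> \<rho>" "\<rho> < 1" using H.row_norm_nonneg[OF Xb] row_ballD(2)[OF X] by (auto simp: \<rho>_def)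
  \<comment> \<open>The bound is proved for each \<open>r\<close> between \<open>\<rho>\<close> and
    1 and passed to the limit, because \<open>\<rho>\<close> may be 0 and \<open>1 / \<rho>\<close>
    is then no radius.\<close>
  have main: "op_norm T (free_eval K H T t A X) \<le> r ^ m" if r: "\<rho> < r" "r < 1" for r
  proof (rule T.op_norm_leI)
    show "0 \<le> r ^ m" using r \<rho> by simp
    fix u assume u: "u \<in> carrier T"
    show "vnorm T (free_eval K H T t A X u) \<le> r ^ m * vnorm T u"
    proof (rule T.vnorm_leI)
      show "free_eval K H T t A X u \<in> carrier T" by (rule T.bop_closed[OF free_eval_bop[OF A X] u])
      show "0 \<le> r ^ m * vnorm T u" using u r \<rho> by simp
      fix v assume v: "v \<in> carrier T"
      define Y where "Y = (\<lambda>z i. op_smult H z (X i))"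
      define c where "c = (\<lambda>k. inner_prod T (hom_part A X k u) v)"
      define g where "g = (\<lambda>z. inner_prod T (free_eval K H T t A (Y z) u) v)"
      \<comment> \<open>An intermediate number between \<open>\<rho>\<close> and \<open>r\<close>
        provides the two radii of the Schwarz lemma: \<open>z\<close> times \<open>X\<close> stays
        in the ball for \<open>cmod z < 1 / q\<close>, and the maximum is taken on the smaller
        circle of radius \<open>1 / r\<close>.\<close>
      define q where "q = (\<rho> + r) / 2"
      have q: "0 < q" "\<rho> < q" "q < r" using r \<rho> by (auto simp: q_def)
      have Y: "Y z \<in> row_ball H" if "cmod z < 1 / q" for z
      proof -
        have "row_norm H (Y z) \<le> cmod z * \<rho>"
          unfolding Y_def \<rho>_def by (rule H.row_norm_op_smult_le[OF Xb])
        also have "\<dots> \<le> (1 / q) * \<rho>" using that \<rho> by (intro mult_right_mono) auto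
        also have "\<dots> < 1" using q by (simp add: divide_less_eq_1)
        finally show ?thesis by (simp add: row_ball_def Y_def H.op_smult_bop[OF Xb])
      qed
      \<comment> \<open>A word of length \<open>k\<close> is homogeneous of degree \<open>k\<close>,
        so the inner products are the terms of a power series in \<open>z\<close>.\<close>
      have hom: "inner_prod T (hom_part A (Y z) k u) v = c k * z ^ k" for z k
      proof -
        have Yb: "Y z i \<in> bounded_ops H" for i by (simp add: Y_def H.op_smult_bop[OF Xb])
        have "tensor_op K H T t (A w) (word_op H (Y z) w) =
            op_smult T (z ^ length w) (tensor_op K H T t (A w) (word_op H X w))" for w
        proof -
          note Xw = H.word_op_bop[of X, OF Xb]
          have "word_op H (Y z) w = op_smult H (z ^ length w) (word_op H X w)"
            unfolding Y_def by (rule H.word_op_smult[OF Xb])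
          then show ?thesis
            by (intro tensor_op_eqI T.op_smult_bop tensor_op_bop H.word_op_bop Ab Yb Xb)
               (simp add: tensor_op_t[OF Ab Xw] t_smult_right K.bop_closed[OF Ab] H.bop_closed[OF Xw])
        qed
        then have "inner_prod T (hom_part A (Y z) k u) v =
            (\<Sum>w\<in>words k. z ^ k * inner_prod T (tensor_op K H T t (A w) (word_op H X w) u) v)"
          unfolding ip_hom_part[of A "Y z", OF Ab Yb u v]
          by (intro sum.cong refl) (simp add: words_def u v
              T.bop_closed[OF tensor_op_bop[OF Ab H.word_op_bop[of X, OF Xb]]])
        then show ?thesis
          by (simp add: c_def ip_hom_part[of A X, OF Ab Xb u v] sum_distrib_left mult.commute)
      qed
      have Y1: "Y 1 = X"
      proof (rule ext)
        show "Y 1 i = X i" for i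
          unfolding Y_def by (rule H.bop_eqI[OF H.op_smult_bop[OF Xb] Xb]) (simp add: H.bop_closed[OF Xb])
      qed
      have "cmod (g 1) \<le> (vnorm T u * vnorm T v) / (1 / r) ^ m"
      proof (rule schwarz_power_series[where R' = "1 / q" and c = c])
        show "1 < 1 / r" "1 / r < 1 / q" using r q \<rho> by (auto simp: field_simps)
        fix z assume z: "cmod z < 1 / q"
        show "(\<lambda>k. c k * z ^ k) sums g z"
          using free_eval_sums[OF A Y[OF z] u v] by (simp add: hom g_def)
        have "cmod (g z) \<le> vnorm T (free_eval K H T t A (Y z) u) * vnorm T v"
          unfolding g_def by (intro T.cauchy_schwarz T.bop_closed[OF free_eval_bop] A Y z u v)
        also have "\<dots> \<le> (op_norm T (free_eval K H T t A (Y z)) * vnorm T u) * vnorm T v"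
          by (intro mult_right_mono T.op_norm_bound free_eval_bop A Y z u T.vnorm_nonneg v)
        also have "\<dots> \<le> (1 * vnorm T u) * vnorm T v"
          by (intro mult_right_mono le1 Y z T.vnorm_nonneg u v)
        finally show "cmod (g z) \<le> vnorm T u * vnorm T v" by simp
      next
        fix k assume "k < m"
        then have "A w x = \<zero>\<^bsub>K\<^esub>" if "w \<in> words k" "x \<in> carrier K" for w x
          using A0[of w] that by (simp add: words_def op_zero_def)
        \<comment> \<open>The coefficient norm vanishes below degree \<open>m\<close>, and
          \<open>hom_part_bound\<close> makes the whole homogeneous part vanish.\<close>
        then have "coeff_norm K A k \<le> 0"
          by (intro K.coeff_norm_leI Ab) (auto intro!: sum_nonpos)
        then have "coeff_norm K A k = 0" using K.coeff_norm_nonneg[of A k, OF Ab] by simp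
        then have "vnorm T (hom_part A X k u) = 0"
          using hom_part_bound[of A X, OF Ab Xb u, of k] T.vnorm_nonneg[OF T.bop_closed[OF hom_part_bop[of A X, OF Ab Xb] u], of k]
          by simp
        then have "hom_part A X k u = \<zero>\<^bsub>T\<^esub>"
          using T.vnorm_eq_0[OF T.bop_closed[OF hom_part_bop[of A X, OF Ab Xb] u]] by simp
        then show "c k = 0" by (simp add: c_def v)
      qed
      then show "cmod (inner_prod T (free_eval K H T t A X u) v) \<le> r ^ m * vnorm T u * vnorm T v"
        by (simp add: g_def Y1 power_divide mult_ac)
    qed
  qed
  have "((\<lambda>r. r ^ m) \<longlongrightarrow> \<rho> ^ m) (at_right \<rho>)" by (intro tendsto_intros)
  moreover have "\<forall>\<^sub>F r in at_right \<rho>. op_norm T (free_eval K H T t A X) \<le> r ^ m"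
    unfolding eventually_at_right_field using main \<rho> by blast
  ultimately have "op_norm T (free_eval K H T t A X) \<le> \<rho> ^ m"
    by (rule tendsto_lowerbound) simp
  then show ?thesis by (simp add: \<rho>_def)
qed

end

section \<open>Transport of structure\<close>

text \<open>Every module axiom is an identity that can be tested by inner products, hence follows
  from \<open>separating\<close>. Completeness is stated with \<open>(-1) \<odot> y\<close> because
  subtraction has its meaning only once the group structure is known.\<close>

lemma complex_hilbert_spaceI:
  fixes V :: "'a hilbert" (structure)
  assumes add: "\<And>x y. x \<in> carrier V \<Longrightarrow> y \<in> carrier V \<Longrightarrow> x \<oplus> y \<in> carrier V"
    and zero: "\<zero> \<in> carrier V"
    and smult: "\<And>c x. x \<in> carrier V \<Longrightarrow> c \<odot> x \<in> carrier V"
    and ip_add: "\<And>x y z. x \<in> carrier V \<Longrightarrow> y \<in> carrier V \<Longrightarrow> z \<in> carrier V \<Longrightarrow>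
      inner_prod V (x \<oplus> y) z = inner_prod V x z + inner_prod V y z"
    and ip_zero: "\<And>z. z \<in> carrier V \<Longrightarrow> inner_prod V \<zero> z = 0"
    and ip_smult: "\<And>c x z. x \<in> carrier V \<Longrightarrow> z \<in> carrier V \<Longrightarrow>
      inner_prod V (c \<odot> x) z = c * inner_prod V x z"
    and ip_cnj: "\<And>x y. x \<in> carrier V \<Longrightarrow> y \<in> carrier V \<Longrightarrow> inner_prod V y x = cnj (inner_prod V x y)"
    and nonneg: "\<And>x. x \<in> carrier V \<Longrightarrow> 0 \<le> Re (inner_prod V x x)"
    and definite: "\<And>x. x \<in> carrier V \<Longrightarrow> inner_prod V x x = 0 \<Longrightarrow> x = \<zero>"
    and separating: "\<And>x y. x \<in> carrier V \<Longrightarrow> y \<in> carrier V \<Longrightarrow>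
      (\<And>z. z \<in> carrier V \<Longrightarrow> inner_prod V x z = inner_prod V y z) \<Longrightarrow> x = y"
    and complete: "\<And>s. (\<And>i::nat. s i \<in> carrier V) \<Longrightarrow>
        (\<And>e. e > 0 \<Longrightarrow> \<exists>N. \<forall>i\<ge>N. \<forall>j\<ge>N. vnorm V (s i \<oplus> (-1) \<odot> s j) < e)
      \<Longrightarrow> \<exists>l\<in>carrier V. (\<lambda>i. vnorm V (s i \<oplus> (-1) \<odot> l)) \<longlonglongrightarrow> 0"
  shows "complex_hilbert_space V"
proof -
  note [simp] = add zero smult ip_add ip_zero ip_smult
  have ab: "abelian_group V"
  proof (rule abelian_groupI)
    fix x assume x: "x \<in> carrier V"
    show "\<exists>y\<in>carrier V. y \<oplus> x = \<zero>"
    proof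
      show "(-1) \<odot> x \<oplus> x = \<zero>" by (rule separating) (simp_all add: x)
    qed (simp add: x)
    show "\<zero> \<oplus> x = x" by (rule separating) (simp_all add: x)
    fix y assume y: "y \<in> carrier V"
    show "x \<oplus> y = y \<oplus> x" by (rule separating) (simp_all add: x y)
    show "x \<oplus> y \<in> carrier V" by (simp add: x y)
    fix z assume z: "z \<in> carrier V"
    show "x \<oplus> y \<oplus> z = x \<oplus> (y \<oplus> z)" by (rule separating) (simp_all add: x y z)
  qed (rule zero)
  have mod: "module complex_ring V"
  proof (rule moduleI[OF cring_complex_ring ab])
    fix x a b assume x: "x \<in> carrier V"
    show "a \<odot> x \<in> carrier V" by (simp add: x)
    show "(a \<oplus>\<^bsub>complex_ring\<^esub> b) \<odot> x = a \<odot> x \<oplus> b \<odot> x"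
      "(a \<otimes>\<^bsub>complex_ring\<^esub> b) \<odot> x = a \<odot> (b \<odot> x)" "\<one>\<^bsub>complex_ring\<^esub> \<odot> x = x"
      by (rule separating; simp add: x algebra_simps)+
    fix y assume y: "y \<in> carrier V"
    show "a \<odot> (x \<oplus> y) = a \<odot> x \<oplus> a \<odot> y"
      by (rule separating; simp add: x y algebra_simps)
  qed
  interpret M: module complex_ring V by (rule mod)
  have minus: "x \<ominus> y = x \<oplus> (-1) \<odot> y" if "x \<in> carrier V" "y \<in> carrier V" for x y
  proof -
    have "\<ominus> y = (-1) \<odot> y"
      by (rule M.minus_equality, rule separating) (simp_all add: that)
    then show ?thesis by (simp add: a_minus_def)
  qed
  show ?thesis
  proof (intro complex_hilbert_space.intro complex_hilbert_space_axioms.intro mod)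
    fix s :: "nat \<Rightarrow> 'a"
    assume s: "\<And>i. s i \<in> carrier V"
      and c: "\<And>e. e > 0 \<Longrightarrow> \<exists>N. \<forall>i\<ge>N. \<forall>j\<ge>N. vnorm V (s i \<ominus> s j) < e"
    have "\<exists>l\<in>carrier V. (\<lambda>i. vnorm V (s i \<oplus> (-1) \<odot> l)) \<longlonglongrightarrow> 0"
      by (rule complete[OF s]) (use c s in \<open>simp add: minus\<close>)
    then show "\<exists>l\<in>carrier V. (\<lambda>i. vnorm V (s i \<ominus> l)) \<longlonglongrightarrow> 0"
      using s by (auto simp: minus)
  qed (rule ip_add ip_smult ip_cnj nonneg definite; assumption)+
qed

lemma (in hilb) finsum_cong:
  assumes "\<And>i. i \<in> I \<Longrightarrow> F i = G i" "G \<in> I \<rightarrow> carrier V"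
  shows "finsum V F I = finsum V G I"
proof -
  interpret M: complex_hilbert_space V by (rule hilbert)
  show ?thesis by (rule M.finsum_cong'[OF refl assms(2,1)])
qed

text \<open>For \<open>f\<close> injective on the carrier this makes \<open>f\<close> a unitary with
  inverse \<open>g\<close>. It serves to move a space to another type.\<close>

definition transport :: "('a \<Rightarrow> 'b) \<Rightarrow> 'a hilbert \<Rightarrow> 'b hilbert" where
  "transport f V = (let g = inv_into (carrier V) f in
     \<lparr>carrier = f ` carrier V, mult = (\<lambda>a b. f \<zero>\<^bsub>V\<^esub>), one = f \<zero>\<^bsub>V\<^esub>, zero = f \<zero>\<^bsub>V\<^esub>,
      add = (\<lambda>a b. f (g a \<oplus>\<^bsub>V\<^esub> g b)), smult = (\<lambda>c a. f (c \<odot>\<^bsub>V\<^esub> g a)),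
      inner_prod = (\<lambda>a b. inner_prod V (g a) (g b))\<rparr>)"

locale htransport = hilb V for V :: "'a hilbert" (structure) +
  fixes f :: "'a \<Rightarrow> 'b"
  assumes inj: "inj_on f (carrier V)"
begin

definition V' :: "'b hilbert" where "V' = transport f V"

definition g :: "'b \<Rightarrow> 'a" where "g = inv_into (carrier V) f"

lemma carrier': "carrier V' = f ` carrier V"
  by (simp add: V'_def transport_def Let_def)

lemma gf [simp]: "x \<in> carrier V \<Longrightarrow> g (f x) = x"
  using inj by (simp add: g_def)

lemma f_closed [simp, intro]: "x \<in> carrier V \<Longrightarrow> f x \<in> carrier V'"
  by (simp add: carrier')

lemma g_closed [simp, intro]: "a \<in> carrier V' \<Longrightarrow> g a \<in> carrier V"
  by (auto simp: carrier')

lemma fg [simp]: "a \<in> carrier V' \<Longrightarrow> f (g a) = a"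
  by (auto simp: carrier')

lemma transport_simps:
  shows zero': "\<zero>\<^bsub>V'\<^esub> = f \<zero>"
    and add': "a \<oplus>\<^bsub>V'\<^esub> b = f (g a \<oplus> g b)"
    and smult': "c \<odot>\<^bsub>V'\<^esub> a = f (c \<odot> g a)"
    and ip': "inner_prod V' a b = inner_prod V (g a) (g b)"
  by (simp_all add: V'_def transport_def Let_def g_def)

lemma vnorm': "vnorm V' a = vnorm V (g a)"
  by (simp add: vnorm_def ip')

sublocale V': hilb V'
proof (rule hilb.intro, rule complex_hilbert_spaceI)
  fix x assume x: "x \<in> carrier V'"
  show "inner_prod V' x x = 0 \<Longrightarrow> x = \<zero>\<^bsub>V'\<^esub>"
    using x ip_definite[of "g x"] fg[OF x] by (simp add: ip' zero')
  fix y assume y: "y \<in> carrier V'"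
  assume eq: "\<And>z. z \<in> carrier V' \<Longrightarrow> inner_prod V' x z = inner_prod V' y z"
  have "g x = g y"
  proof (rule eqI)
    fix z assume "z \<in> carrier V"
    then show "inner_prod V (g x) z = inner_prod V (g y) z" using eq[of "f z"] by (simp add: ip')
  qed (intro g_closed x y)+
  then have "f (g x) = f (g y)" by (rule arg_cong)
  then show "x = y" by (simp only: fg x y)
next
  fix s :: "nat \<Rightarrow> 'b"
  assume s: "\<And>i. s i \<in> carrier V'"
    and c: "\<And>e. e > 0 \<Longrightarrow> \<exists>N. \<forall>i\<ge>N. \<forall>j\<ge>N. vnorm V' (s i \<oplus>\<^bsub>V'\<^esub> (-1) \<odot>\<^bsub>V'\<^esub> s j) < e"
  have n: "vnorm V' (s i \<oplus>\<^bsub>V'\<^esub> (-1) \<odot>\<^bsub>V'\<^esub> f y) = vnorm V (g (s i) \<ominus> y)" if "y \<in> carrier V" for i y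
    using that s by (simp add: vnorm' add' smult' minus_eq_add)
  have "\<exists>l\<in>carrier V. (\<lambda>i. vnorm V (g (s i) \<ominus> l)) \<longlonglongrightarrow> 0"
  proof (rule complete)
    show "\<exists>N. \<forall>i\<ge>N. \<forall>j\<ge>N. vnorm V (g (s i) \<ominus> g (s j)) < e" if "e > 0" for e
      using c[OF that] n[OF g_closed[OF s]] s by simp
  qed (use s in auto)
  then obtain l where l: "l \<in> carrier V" "(\<lambda>i. vnorm V (g (s i) \<ominus> l)) \<longlonglongrightarrow> 0" by blast
  then show "\<exists>l\<in>carrier V'. (\<lambda>i. vnorm V' (s i \<oplus>\<^bsub>V'\<^esub> (-1) \<odot>\<^bsub>V'\<^esub> l)) \<longlonglongrightarrow> 0"
    using n by (intro bexI[of _ "f l"]) auto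
next
  fix x y assume "x \<in> carrier V'" "y \<in> carrier V'"
  then show "inner_prod V' y x = cnj (inner_prod V' x y)"
    unfolding ip' by (intro ip_cnj) auto
qed (auto simp: zero' add' smult' ip' ip_nonneg)

lemma f_add: "x \<in> carrier V \<Longrightarrow> y \<in> carrier V \<Longrightarrow> f x \<oplus>\<^bsub>V'\<^esub> f y = f (x \<oplus> y)"
  and f_smult: "x \<in> carrier V \<Longrightarrow> c \<odot>\<^bsub>V'\<^esub> f x = f (c \<odot> x)"
  by (simp_all add: add' smult')

lemma f_finsum:
  assumes "finite I" "F \<in> I \<rightarrow> carrier V"
  shows "finsum V' (\<lambda>i. f (F i)) I = f (finsum V F I)"
  using assms
proof (induction I)
  case (insert i I)
  then have F: "F \<in> I \<rightarrow> carrier V" "F i \<in> carrier V" by auto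
  then have F': "(\<lambda>i. f (F i)) \<in> I \<rightarrow> carrier V'" "f (F i) \<in> carrier V'" by auto
  show ?case using insert F F' by (simp add: finsum_insert V'.finsum_insert f_add)
qed (simp add: zero')

lemma g_minus: "a \<in> carrier V' \<Longrightarrow> b \<in> carrier V' \<Longrightarrow> g (a \<ominus>\<^bsub>V'\<^esub> b) = g a \<ominus> g b"
  by (simp add: minus_eq_add V'.minus_eq_add add' smult')

definition transport_op :: "('a \<Rightarrow> 'a) \<Rightarrow> 'b \<Rightarrow> 'b" where
  "transport_op S = (\<lambda>a\<in>carrier V'. f (S (g a)))"

lemma transport_op_bop:
  assumes S: "S \<in> bounded_ops V"
  shows "transport_op S \<in> bounded_ops V'"
proof (rule V'.bounded_opsI)
  note [simp] = bop_closed[OF S]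
  show "vnorm V' (transport_op S a) \<le> op_norm V S * vnorm V' a" if "a \<in> carrier V'" for a
    using op_norm_bound[OF S, of "g a"] that by (simp add: transport_op_def vnorm')
  show "transport_op S (a \<oplus>\<^bsub>V'\<^esub> b) = transport_op S a \<oplus>\<^bsub>V'\<^esub> transport_op S b" if "a \<in> carrier V'" "b \<in> carrier V'" for a b
    using that by (simp add: transport_op_def add' bop_add[OF S])
  show "transport_op S (c \<odot>\<^bsub>V'\<^esub> a) = c \<odot>\<^bsub>V'\<^esub> transport_op S a" if "a \<in> carrier V'" for a c
    using that by (simp add: transport_op_def smult' bop_smult[OF S])
qed (auto simp: transport_op_def bop_closed[OF S])

lemma transport_op_f [simp]: "x \<in> carrier V \<Longrightarrow> transport_op S (f x) = f (S x)"
  by (simp add: transport_op_def)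

lemma op_norm_transport_op:
  assumes S: "S \<in> bounded_ops V"
  shows "op_norm V S \<le> op_norm V' (transport_op S)"
proof (rule op_norm_leI)
  fix x assume "x \<in> carrier V"
  then show "vnorm V (S x) \<le> op_norm V' (transport_op S) * vnorm V x"
    using V'.op_norm_bound[OF transport_op_bop[OF S], of "f x"] by (simp add: vnorm' bop_closed[OF S])
qed (rule V'.op_norm_nonneg[OF transport_op_bop[OF S]])

lemma row_ball_transport_op:
  fixes X :: "'n::finite \<Rightarrow> 'a \<Rightarrow> 'a"
  assumes X: "X \<in> row_ball V"
  shows "(\<lambda>i. transport_op (X i)) \<in> row_ball V'"
proof -
  have Xb: "X i \<in> bounded_ops V" for i using X by (simp add: row_ball_def)
  note [simp] = bop_closed[OF Xb] bop_closed[OF adjoint_bop[OF Xb]]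
  have "row_norm V' (\<lambda>i. transport_op (X i)) \<le> row_norm V X"
  proof (rule V'.row_norm_leI[where B = "\<lambda>i a. f (adjoint V (X i) (g a))"])
    show "inner_prod V' (transport_op (X i) a) b = inner_prod V' a (f (adjoint V (X i) (g b)))"
      if "a \<in> carrier V'" "b \<in> carrier V'" for i a b
      using that by (simp add: ip' transport_op_def ip_adjoint[OF Xb])
    show "(\<Sum>i\<in>UNIV. (vnorm V' (f (adjoint V (X i) (g a))))\<^sup>2) \<le> (row_norm V X)\<^sup>2 * (vnorm V' a)\<^sup>2"
      if "a \<in> carrier V'" for a
      using row_norm_bound[of X, OF Xb g_closed[OF that]] that by (simp add: vnorm')
  qed (use Xb in \<open>auto simp: transport_op_bop row_norm_nonneg\<close>)
  then show ?thesis using X Xb by (auto simp: row_ball_def transport_op_bop)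
qed

lemma word_op_transport_op:
  assumes X: "\<And>i. X i \<in> bounded_ops V" and x: "x \<in> carrier V"
  shows "word_op V' (\<lambda>i. transport_op (X i)) w (f x) = f (word_op V X w x)"
  using x by (induction w) (simp_all add: bop_closed[OF word_op_bop[of X, OF X]])

end

text \<open>The functional sending \<open>x\<close> to the inner product of \<open>t x y\<close>
  with \<open>v\<close> is bounded, and Riesz represents it. The vector \<open>a\<close> is the
  partial inner product of \<open>v\<close> with \<open>y\<close>.\<close>

lemma (in htensor) slice_exists:
  assumes v: "v \<in> carrier T" and y: "y \<in> carrier H"
  shows "\<exists>a\<in>carrier K. \<forall>x\<in>carrier K. inner_prod T (t x y) v = inner_prod K x a"
proof -
  have "\<exists>a\<in>carrier K. (\<forall>(x, c)\<in>(\<lambda>x. (x, inner_prod T (t x y) v)) ` carrier K. inner_prod K x a = c) \<and>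
      vnorm K a \<le> vnorm H y * vnorm T v"
  proof (rule K.riesz)
    show "(\<lambda>x. (x, inner_prod T (t x y) v)) ` carrier K \<noteq> {}" using K.zero_closed by blast
    show "cmod c \<le> vnorm H y * vnorm T v * vnorm K x"
      if "(x, c) \<in> (\<lambda>x. (x, inner_prod T (t x y) v)) ` carrier K" for x c
      using that T.cauchy_schwarz[of "t x y" v] y v by (auto simp: vnorm_t mult_ac)
  qed (use y v in \<open>auto simp: image_iff t_add_left t_smult_left\<close>)
  then obtain a where "a \<in> carrier K"
    "\<And>x. x \<in> carrier K \<Longrightarrow> inner_prod K x a = inner_prod T (t x y) v" by auto
  then show ?thesis by (intro bexI[of _ a]) auto
qed

text \<open>
  The slices of a vector of \<open>T\<close> embed \<open>T\<close> into the functions from \<open>H\<close> to \<open>K\<close>, so a tensor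
  product on an arbitrary type has a copy among those in the definition of the supremum norm.
\<close>

lemma op_norm_le_free_sup_norm:
  fixes K :: "'u hilbert" and A :: "'n::finite list \<Rightarrow> 'u \<Rightarrow> 'u" and E :: "'e hilbert"
    and h :: "'e \<Rightarrow> 'u"
  assumes tensor: "htensor K E T t" and inj: "inj_on h (carrier E)"
    and A: "free_holomorphic K A" and X: "X \<in> row_ball E"
  shows "ereal (op_norm T (free_eval K E T t A X)) \<le> free_sup_norm K A"
proof -
  interpret htensor K E T t by (rule tensor)
  interpret E: htransport E h by unfold_locales (rule inj)
  let ?P = "\<lambda>e v a. a \<in> carrier K \<and> (\<forall>x\<in>carrier K. inner_prod T (t x (E.g e)) v = inner_prod K x a)"
  \<comment> \<open>Slices are indexed by the copy of \<open>E\<close> in \<open>'u\<close> and not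
    by \<open>E\<close> itself, so that \<open>sl v\<close> has the type
    \<open>'u \<Rightarrow> 'u\<close> demanded by the supremum norm.\<close>
  define sl where "sl = (\<lambda>v e. SOME a. ?P e v a)"
  have sl: "?P e v (sl v e)" if "v \<in> carrier T" "e \<in> carrier E.V'" for v e
    unfolding sl_def using slice_exists[OF that(1) E.g_closed[OF that(2)]]
    by (intro someI_ex[where P = "?P e v"]) blast
  \<comment> \<open>The slices recover the inner products with all elementary tensors, and these
    determine the vector.\<close>
  have "inj_on sl (carrier T)"
  proof (rule inj_onI)
    fix v v' assume v: "v \<in> carrier T" "v' \<in> carrier T" and eq: "sl v = sl v'"
    show "v = v'"
    proof (rule T_eqI[OF v])
      fix x y assume "x \<in> carrier K" "y \<in> carrier E"
      then show "inner_prod T (t x y) v = inner_prod T (t x y) v'"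
        using sl[OF v(1), of "h y"] sl[OF v(2), of "h y"] eq by simp
    qed
  qed
  then interpret T: htransport T sl by unfold_locales
  define t' where "t' = (\<lambda>x e. sl (t x (E.g e)))"
  have t'h: "t' x (h y) = sl (t x y)" if "y \<in> carrier E" for x y using that by (simp add: t'_def)
  have ht': "hilbert_tensor K E.V' T.V' t'"
    unfolding hilbert_tensor_def
  proof (intro conjI ballI allI impI)
    fix v and e :: real assume v: "v \<in> carrier T.V'" and e: "e > 0"
    have "\<exists>(N::nat) f g. (\<forall>i<N. f i \<in> carrier K \<and> g i \<in> carrier E) \<and>
        vnorm T (T.g v \<ominus>\<^bsub>T\<^esub> finsum T (\<lambda>i. t (f i) (g i)) {..<N}) < e"
      using tensor v e unfolding htensor_def htensor_axioms_def hilbert_tensor_def by blast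
    then obtain N f g where fg: "\<And>i. i < (N::nat) \<Longrightarrow> f i \<in> carrier K \<and> g i \<in> carrier E"
      and d: "vnorm T (T.g v \<ominus>\<^bsub>T\<^esub> finsum T (\<lambda>i. t (f i) (g i)) {..<N}) < e" by blast
    have F: "(\<lambda>i. t (f i) (g i)) \<in> {..<N} \<rightarrow> carrier T" using fg by auto
    have "finsum T.V' (\<lambda>i. t' (f i) (h (g i))) {..<N} = finsum T.V' (\<lambda>i. sl (t (f i) (g i))) {..<N}"
      by (rule T.V'.finsum_cong) (use fg in \<open>auto simp: t'h\<close>)
    also have "\<dots> = sl (finsum T (\<lambda>i. t (f i) (g i)) {..<N})" by (rule T.f_finsum[OF _ F]) simp
    finally have "vnorm T.V' (v \<ominus>\<^bsub>T.V'\<^esub> finsum T.V' (\<lambda>i. t' (f i) (h (g i))) {..<N}) < e"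
      using d v F by (simp add: T.vnorm' T.g_minus)
    then show "\<exists>(N::nat) f g. (\<forall>i<N. f i \<in> carrier K \<and> g i \<in> carrier E.V') \<and>
        vnorm T.V' (v \<ominus>\<^bsub>T.V'\<^esub> finsum T.V' (\<lambda>i. t' (f i) (g i)) {..<N}) < e"
      using fg by (intro exI[of _ N] exI[of _ f] exI[of _ "\<lambda>i. h (g i)"]) auto
  qed (auto simp: t'_def T.V'.hilbert T.f_add T.f_smult t_add_left t_add_right t_smult_left t_smult_right
      E.add' E.smult' T.ip' E.ip')
  then interpret T': htensor K E.V' T.V' t' by unfold_locales
  define X' where "X' = (\<lambda>i. E.transport_op (X i))"
  have X': "X' \<in> row_ball E.V'" unfolding X'_def by (rule E.row_ball_transport_op[OF X])
  note Xb = row_ballD(1)[OF X]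
  have Ab: "A w \<in> bounded_ops K" for w using A by (simp add: free_holomorphic_def)
  define S where "S = free_eval K E T t A X"
  have S: "S \<in> bounded_ops T" unfolding S_def by (rule free_eval_bop[OF A X])
  \<comment> \<open>The scalar series on elementary tensors are unchanged by the copying, so the
    value on the copy is the copy of the value.\<close>
  have "free_eval K E.V' T.V' t' A X' = T.transport_op S"
  proof (rule T'.free_eval_eqI[OF A X' T.transport_op_bop[OF S]])
    fix x x' y y' assume *: "x \<in> carrier K" "x' \<in> carrier K" "y \<in> carrier E.V'" "y' \<in> carrier E.V'"
    have "word_op E.V' X' w y = h (word_op E X w (E.g y))" for w
      using E.word_op_transport_op[of X "E.g y" w, OF Xb] *(3) by (simp add: X'_def)
    then show "(\<lambda>k. \<Sum>w\<in>words k. inner_prod K (A w x) x' * inner_prod E.V' (word_op E.V' X' w y) y') sums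
       inner_prod T.V' (T.transport_op S (t' x y)) (t' x' y')"
      using free_eval_weak[OF A X *(1,2) E.g_closed[OF *(3)] E.g_closed[OF *(4)]] *
      by (simp add: E.ip' T.ip' t'_def S_def[symmetric] T.bop_closed[OF S] H.bop_closed[OF H.word_op_bop[of X, OF Xb]])
  qed
  then have "op_norm T S \<le> op_norm T.V' (free_eval K E.V' T.V' t' A X')"
    using T.op_norm_transport_op[OF S] by simp
  moreover have "ereal (op_norm T.V' (free_eval K E.V' T.V' t' A X')) \<le> free_sup_norm K A"
    unfolding free_sup_norm_def using E.V'.hilbert ht' X' by (intro Sup_upper) blast
  ultimately show ?thesis unfolding S_def by (meson ereal_less_eq(3) order_trans)
qed

section \<open>The truncated Fock space\<close>

definition complex_space :: "complex hilbert" where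
  "complex_space = \<lparr>carrier = UNIV, mult = (*), one = 1, zero = 0, add = (+), smult = (*),
     inner_prod = (\<lambda>x y. x * cnj y)\<rparr>"

lemma complex_space_simps [simp]:
  "carrier complex_space = UNIV" "\<zero>\<^bsub>complex_space\<^esub> = 0" "x \<oplus>\<^bsub>complex_space\<^esub> y = x + y"
  "c \<odot>\<^bsub>complex_space\<^esub> x = c * x" "inner_prod complex_space x y = x * cnj y"
  by (simp_all add: complex_space_def)

lemma vnorm_complex_space [simp]: "vnorm complex_space x = cmod x"
  by (simp add: vnorm_def cmod_def power2_eq_square)

lemma hilb_complex_space: "hilb complex_space"
proof (rule hilb.intro, rule complex_hilbert_spaceI)
  fix x y :: complex
  assume "\<And>z. z \<in> carrier complex_space \<Longrightarrow> inner_prod complex_space x z = inner_prod complex_space y z"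
  from this[of 1] show "x = y" by simp
next
  fix s :: "nat \<Rightarrow> complex"
  assume "\<And>e. e > 0 \<Longrightarrow> \<exists>N. \<forall>i\<ge>N. \<forall>j\<ge>N.
    vnorm complex_space (s i \<oplus>\<^bsub>complex_space\<^esub> (-1) \<odot>\<^bsub>complex_space\<^esub> s j) < e"
  then have "Cauchy s" by (auto simp: Cauchy_def dist_norm)
  then obtain l where "s \<longlonglongrightarrow> l" by (auto simp: Cauchy_convergent_iff convergent_def)
  then have "(\<lambda>i. vnorm complex_space (s i \<oplus>\<^bsub>complex_space\<^esub> (-1) \<odot>\<^bsub>complex_space\<^esub> l)) \<longlonglongrightarrow> 0"
    by (simp add: tendsto_norm_zero LIM_zero)
  then show "\<exists>l\<in>carrier complex_space.
      (\<lambda>i. vnorm complex_space (s i \<oplus>\<^bsub>complex_space\<^esub> (-1) \<odot>\<^bsub>complex_space\<^esub> l)) \<longlonglongrightarrow> 0"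
    by (intro bexI[of _ l]) auto
qed (auto simp: algebra_simps)

text \<open>With the complex numbers as \<open>V\<close> this is the Fock space below, and with
  \<open>K\<close> as \<open>V\<close> the tensor product of \<open>K\<close> with it.\<close>

definition dsum :: "'a hilbert \<Rightarrow> 'i set \<Rightarrow> ('i \<Rightarrow> 'a) hilbert" where
  "dsum V I = \<lparr>carrier = I \<rightarrow>\<^sub>E carrier V, mult = (\<lambda>F G. F), one = (\<lambda>i\<in>I. \<zero>\<^bsub>V\<^esub>),
     zero = (\<lambda>i\<in>I. \<zero>\<^bsub>V\<^esub>), add = (\<lambda>F G. \<lambda>i\<in>I. F i \<oplus>\<^bsub>V\<^esub> G i), smult = (\<lambda>c F. \<lambda>i\<in>I. c \<odot>\<^bsub>V\<^esub> F i),
     inner_prod = (\<lambda>F G. \<Sum>i\<in>I. inner_prod V (F i) (G i))\<rparr>"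

lemma dsum_simps:
  "carrier (dsum V I) = I \<rightarrow>\<^sub>E carrier V" "\<zero>\<^bsub>dsum V I\<^esub> = (\<lambda>i\<in>I. \<zero>\<^bsub>V\<^esub>)"
  "F \<oplus>\<^bsub>dsum V I\<^esub> G = (\<lambda>i\<in>I. F i \<oplus>\<^bsub>V\<^esub> G i)" "c \<odot>\<^bsub>dsum V I\<^esub> F = (\<lambda>i\<in>I. c \<odot>\<^bsub>V\<^esub> F i)"
  "inner_prod (dsum V I) F G = (\<Sum>i\<in>I. inner_prod V (F i) (G i))"
  by (simp_all add: dsum_def)

context hilb
begin

lemma vnorm_dsum_sq:
  assumes "F \<in> carrier (dsum V I)"
  shows "Re (inner_prod (dsum V I) F F) = (\<Sum>i\<in>I. (vnorm V (F i))\<^sup>2)"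
proof -
  have "F i \<in> carrier V" if "i \<in> I" for i using assms that by (auto simp: dsum_simps)
  then show ?thesis by (auto simp: dsum_simps vnorm_sq intro!: sum.cong)
qed

lemma hilb_dsum:
  assumes I: "finite I"
  shows "hilb (dsum V I)"
proof (rule hilb.intro, rule complex_hilbert_spaceI)
  fix F assume F: "F \<in> carrier (dsum V I)"
  have Fi: "F i \<in> carrier V" if "i \<in> I" for i using F that by (auto simp: dsum_simps)
  show "c \<odot>\<^bsub>dsum V I\<^esub> F \<in> carrier (dsum V I)" for c using Fi by (auto simp: dsum_simps)
  show "inner_prod (dsum V I) \<zero>\<^bsub>dsum V I\<^esub> F = 0" using Fi by (simp add: dsum_simps)
  show "0 \<le> Re (inner_prod (dsum V I) F F)" unfolding vnorm_dsum_sq[OF F] by (simp add: sum_nonneg)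
  show "F = \<zero>\<^bsub>dsum V I\<^esub>" if "inner_prod (dsum V I) F F = 0"
  proof -
    have "(\<Sum>i\<in>I. (vnorm V (F i))\<^sup>2) = 0" using that vnorm_dsum_sq[OF F] by simp
    then have "\<forall>i\<in>I. (vnorm V (F i))\<^sup>2 = 0" using I by (subst (asm) sum_nonneg_eq_0_iff) auto
    then have "F i = \<zero>" if "i \<in> I" for i using vnorm_eq_0[OF Fi[OF that]] that by simp
    then show ?thesis using F by (intro extensionalityI[of _ I]) (auto simp: dsum_simps PiE_def)
  qed
  fix G assume G: "G \<in> carrier (dsum V I)"
  have Gi: "G i \<in> carrier V" if "i \<in> I" for i using G that by (auto simp: dsum_simps)
  show "F \<oplus>\<^bsub>dsum V I\<^esub> G \<in> carrier (dsum V I)" using Fi Gi by (auto simp: dsum_simps)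
  show "inner_prod (dsum V I) (c \<odot>\<^bsub>dsum V I\<^esub> F) G = c * inner_prod (dsum V I) F G" for c
    using Fi Gi by (simp add: dsum_simps sum_distrib_left)
  show "inner_prod (dsum V I) G F = cnj (inner_prod (dsum V I) F G)"
    unfolding dsum_simps cnj_sum by (intro sum.cong refl ip_cnj Fi Gi)
  show "inner_prod (dsum V I) (F \<oplus>\<^bsub>dsum V I\<^esub> G) H = inner_prod (dsum V I) F H + inner_prod (dsum V I) G H"
    if H: "H \<in> carrier (dsum V I)" for H
  proof -
    have "H i \<in> carrier V" if "i \<in> I" for i using H that by (auto simp: dsum_simps)
    then show ?thesis using Fi Gi by (simp add: dsum_simps sum.distrib)
  qed
  assume eq: "\<And>H. H \<in> carrier (dsum V I) \<Longrightarrow> inner_prod (dsum V I) F H = inner_prod (dsum V I) G H"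
  have "F i = G i" if i: "i \<in> I" for i
  proof (rule eqI[OF Fi[OF i] Gi[OF i]])
    fix z assume z: "z \<in> carrier V"
    \<comment> \<open>A vector supported at \<open>i\<close> with value \<open>z\<close> there tests
      the coordinate \<open>i\<close> alone.\<close>
    have "inner_prod (dsum V I) F' (\<lambda>j\<in>I. if j = i then z else \<zero>) = inner_prod V (F' i) z"
      if "\<And>i. i \<in> I \<Longrightarrow> F' i \<in> carrier V" for F'
    proof -
      have "inner_prod (dsum V I) F' (\<lambda>j\<in>I. if j = i then z else \<zero>) =
          (\<Sum>j\<in>I. if j = i then inner_prod V (F' j) z else 0)"
        unfolding dsum_simps using that by (intro sum.cong) auto
      then show ?thesis using i I by simp
    qed
    from this[of F] this[of G] show "inner_prod V (F i) z = inner_prod V (G i) z"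
      using eq[of "\<lambda>j\<in>I. if j = i then z else \<zero>"] z Fi Gi by (simp add: dsum_simps)
  qed
  then show "F = G" using F G by (intro extensionalityI[of _ I]) (auto simp: dsum_simps PiE_def)
next
  fix s :: "nat \<Rightarrow> 'b \<Rightarrow> 'a"
  assume s: "\<And>n. s n \<in> carrier (dsum V I)"
    and c: "\<And>e. e > 0 \<Longrightarrow> \<exists>N. \<forall>m\<ge>N. \<forall>n\<ge>N. vnorm (dsum V I) (s m \<oplus>\<^bsub>dsum V I\<^esub> (-1) \<odot>\<^bsub>dsum V I\<^esub> s n) < e"
  have si: "s n i \<in> carrier V" if "i \<in> I" for n i using s[of n] that by (auto simp: dsum_simps)
  have diff: "vnorm (dsum V I) (s m \<oplus>\<^bsub>dsum V I\<^esub> (-1) \<odot>\<^bsub>dsum V I\<^esub> F) = sqrt (\<Sum>i\<in>I. (vnorm V (s m i \<ominus> F i))\<^sup>2)"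
    if F: "F \<in> carrier (dsum V I)" for m F
  proof -
    have Fi: "F i \<in> carrier V" if "i \<in> I" for i using F that by (auto simp: dsum_simps)
    have d: "s m \<oplus>\<^bsub>dsum V I\<^esub> (-1) \<odot>\<^bsub>dsum V I\<^esub> F = (\<lambda>i\<in>I. s m i \<ominus> F i)"
      using si Fi by (auto simp: dsum_simps minus_eq_add)
    have dc: "(\<lambda>i\<in>I. s m i \<ominus> F i) \<in> carrier (dsum V I)" using si Fi by (auto simp: dsum_simps)
    show ?thesis
      unfolding d vnorm_def[of "dsum V I"] vnorm_dsum_sq[OF dc] by simp
  qed
  have "\<exists>l. l \<in> carrier V \<and> (\<lambda>n. vnorm V (s n i \<ominus> l)) \<longlonglongrightarrow> 0" if i: "i \<in> I" for i
  proof -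
    have "\<exists>N. \<forall>m\<ge>N. \<forall>n\<ge>N. vnorm V (s m i \<ominus> s n i) < e" if e: "e > 0" for e
    proof -
      obtain N where N: "\<And>m n. m \<ge> N \<Longrightarrow> n \<ge> N \<Longrightarrow>
          vnorm (dsum V I) (s m \<oplus>\<^bsub>dsum V I\<^esub> (-1) \<odot>\<^bsub>dsum V I\<^esub> s n) < e" using c[OF e] by metis
      have "vnorm V (s m i \<ominus> s n i) < e" if "m \<ge> N" "n \<ge> N" for m n
      proof -
        have "(vnorm V (s m i \<ominus> s n i))\<^sup>2 \<le> (\<Sum>i\<in>I. (vnorm V (s m i \<ominus> s n i))\<^sup>2)"
          by (rule member_le_sum[OF i]) (use I in auto)
        then have "vnorm V (s m i \<ominus> s n i) \<le> vnorm (dsum V I) (s m \<oplus>\<^bsub>dsum V I\<^esub> (-1) \<odot>\<^bsub>dsum V I\<^esub> s n)"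
          unfolding diff[OF s] by (rule real_le_rsqrt)
        also have "\<dots> < e" by (rule N[OF that])
        finally show ?thesis .
      qed
      then show ?thesis by (intro exI[of _ N] allI impI)
    qed
    from complete[of "\<lambda>n. s n i", OF si[OF i] this] show ?thesis by (simp only: Bex_def)
  qed
  from bchoice[OF ballI[OF this]] obtain l
    where "\<forall>i\<in>I. l i \<in> carrier V \<and> (\<lambda>n. vnorm V (s n i \<ominus> l i)) \<longlonglongrightarrow> 0" ..
  then have l: "\<And>i. i \<in> I \<Longrightarrow> l i \<in> carrier V"
    and lim: "\<And>i. i \<in> I \<Longrightarrow> (\<lambda>n. vnorm V (s n i \<ominus> l i)) \<longlonglongrightarrow> 0" by simp_all
  define L where "L = (\<lambda>i\<in>I. l i)"
  have L: "L \<in> carrier (dsum V I)" using l by (auto simp: L_def dsum_simps)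
  have "(\<lambda>n. \<Sum>i\<in>I. (vnorm V (s n i \<ominus> L i))\<^sup>2) \<longlonglongrightarrow> (\<Sum>i\<in>I. 0\<^sup>2)"
    by (rule tendsto_sum, rule tendsto_power) (use lim in \<open>simp add: L_def\<close>)
  then have "(\<lambda>n. vnorm (dsum V I) (s n \<oplus>\<^bsub>dsum V I\<^esub> (-1) \<odot>\<^bsub>dsum V I\<^esub> L)) \<longlonglongrightarrow> sqrt (\<Sum>i\<in>I. 0\<^sup>2)"
    unfolding diff[OF L] by (rule tendsto_real_sqrt)
  then show "\<exists>l\<in>carrier (dsum V I). (\<lambda>n. vnorm (dsum V I) (s n \<oplus>\<^bsub>dsum V I\<^esub> (-1) \<odot>\<^bsub>dsum V I\<^esub> l)) \<longlonglongrightarrow> 0"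
    using L by (intro bexI[of _ L]) simp_all
qed (simp add: dsum_simps)

end

text \<open>The square of an infinite set is equipotent to the set, so finite powers of the complex
  numbers inject into the complex numbers by induction. This brings the truncated Fock space within
  reach of \<open>op_norm_le_free_sup_norm\<close>.\<close>

lemma inj_complex_functions:
  assumes "finite I"
  shows "\<exists>p :: ('i \<Rightarrow> complex) \<Rightarrow> complex. inj_on p (I \<rightarrow>\<^sub>E UNIV)"
  using assms
proof (induction I)
  case empty
  show ?case by (rule exI[of _ "\<lambda>_. 0"]) simp
next
  case (insert i I)
  then obtain p :: "('i \<Rightarrow> complex) \<Rightarrow> complex" where p: "inj_on p (I \<rightarrow>\<^sub>E UNIV)" by blast
  have "\<exists>q. bij_betw q (UNIV \<times> UNIV :: (complex \<times> complex) set) (UNIV :: complex set)"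
    unfolding card_of_ordIso by (rule card_of_Times_same_infinite) (rule infinite_UNIV_char_0)
  then obtain q :: "complex \<times> complex \<Rightarrow> complex" where "bij_betw q (UNIV \<times> UNIV) UNIV" ..
  then have q: "inj q" by (simp add: bij_betw_def)
  have "inj_on (\<lambda>F. q (F i, p (restrict F I))) (insert i I \<rightarrow>\<^sub>E UNIV)"
  proof (rule inj_onI)
    fix F G :: "'i \<Rightarrow> complex"
    assume F: "F \<in> insert i I \<rightarrow>\<^sub>E UNIV" and G: "G \<in> insert i I \<rightarrow>\<^sub>E UNIV"
      and eq: "q (F i, p (restrict F I)) = q (G i, p (restrict G I))"
    have pair: "(F i, p (restrict F I)) = (G i, p (restrict G I))" by (rule injD[OF q eq])
    have "restrict F I = restrict G I" by (rule inj_onD[OF p]) (use pair in auto)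
    then have "F j = G j" if "j \<in> I" for j using that by (metis restrict_apply')
    then show "F = G" using pair by (intro PiE_ext[OF F G]) auto
  qed
  then show ?case by blast
qed

text \<open>\<open>dummy\<close> fixes the type of the generators, which occurs in no other
  parameter.\<close>

locale truncated_fock = hilb K for K :: "'u hilbert" +
  fixes k :: nat and r :: real and dummy :: "'n::finite itself"
  assumes r: "0 \<le> r" "r < 1"
begin

definition I :: "'n list set" where "I = {w. length w \<le> k}"

definition E :: "('n list \<Rightarrow> complex) hilbert" where "E = dsum complex_space I"

definition T :: "('n list \<Rightarrow> 'u) hilbert" where "T = dsum K I"

definition t :: "'u \<Rightarrow> ('n list \<Rightarrow> complex) \<Rightarrow> 'n list \<Rightarrow> 'u" where
  "t x y = (\<lambda>w\<in>I. y w \<odot>\<^bsub>K\<^esub> x)"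

definition e :: "'n list \<Rightarrow> 'n list \<Rightarrow> complex" where
  "e u = (\<lambda>w\<in>I. if w = u then 1 else 0)"

text \<open>\<open>r\<close> times the left creation operator, which sends the basis vector of
  \<open>v\<close> to that of \<open>i # v\<close>; words longer than \<open>k\<close> are cut
  off.\<close>

definition X :: "'n \<Rightarrow> ('n list \<Rightarrow> complex) \<Rightarrow> 'n list \<Rightarrow> complex" where
  "X i = (\<lambda>y\<in>carrier E. \<lambda>w\<in>I. case w of [] \<Rightarrow> 0 | j # v \<Rightarrow> if j = i then r * y v else 0)"

text \<open>The adjoint of \<open>X i\<close>, that is \<open>r\<close> times the annihilation
  operator. The test \<open>i # w \<in> I\<close> accounts for the truncation.\<close>

definition B :: "'n \<Rightarrow> ('n list \<Rightarrow> complex) \<Rightarrow> 'n list \<Rightarrow> complex" where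
  "B i y = (\<lambda>w\<in>I. if i # w \<in> I then complex_of_real r * y (i # w) else 0)"

lemma finite_I: "finite I"
  using finite_lists_length_le[of "UNIV :: 'n set" k] by (simp add: I_def)

lemma I_Cons: "i # w \<in> I \<Longrightarrow> w \<in> I"
  by (simp add: I_def)

sublocale E: hilb E
  unfolding E_def by (rule hilb.hilb_dsum[OF hilb_complex_space finite_I])

sublocale T: hilb T
  unfolding T_def by (rule hilb_dsum[OF finite_I])

lemma carrier_E: "carrier E = I \<rightarrow>\<^sub>E UNIV"
  by (simp add: E_def dsum_simps)

lemma ip_E: "inner_prod E x y = (\<Sum>w\<in>I. x w * cnj (y w))"
  by (simp add: E_def dsum_simps)

lemma vnorm_E: "y \<in> carrier E \<Longrightarrow> (vnorm E y)\<^sup>2 = (\<Sum>w\<in>I. (cmod (y w))\<^sup>2)"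
  using hilb.vnorm_dsum_sq[OF hilb_complex_space, of y I] by (simp add: E.vnorm_sq flip: E_def)

lemma vnorm_T: "v \<in> carrier T \<Longrightarrow> (vnorm T v)\<^sup>2 = (\<Sum>w\<in>I. (vnorm K (v w))\<^sup>2)"
  using vnorm_dsum_sq[of v I] by (simp add: T.vnorm_sq flip: T_def)

lemma e_closed [simp]: "e u \<in> carrier E"
  by (simp add: carrier_E e_def)

text \<open>The basis vector \<open>e u\<close> vanishes outside \<open>u\<close>, so pairing with
  \<open>t x (e u)\<close> reads off the coordinate of \<open>v\<close> at \<open>u\<close>.\<close>

lemma ip_t_e:
  assumes "u \<in> I" "x \<in> carrier K" "v \<in> carrier T"
  shows "inner_prod T v (t x (e u)) = inner_prod K (v u) x"
proof -
  have "inner_prod T v (t x (e u)) = (\<Sum>w\<in>I. if w = u then inner_prod K (v w) x else 0)"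
    unfolding T_def dsum_simps
  proof (intro sum.cong refl)
    fix w assume w: "w \<in> I"
    then have "v w \<in> carrier K" using assms(3) by (auto simp: T_def dsum_simps)
    then show "inner_prod K (v w) (t x (e u) w) = (if w = u then inner_prod K (v w) x else 0)"
      using w assms(2) by (simp add: t_def e_def)
  qed
  then show ?thesis using assms(1) finite_I by simp
qed

lemma t_closed: "x \<in> carrier K \<Longrightarrow> y \<in> carrier E \<Longrightarrow> t x y \<in> carrier T"
  by (auto simp: t_def T_def dsum_simps)

lemma htensor: "htensor K E T t"
proof (intro htensor.intro htensor_axioms.intro)
  show "hilbert_tensor K E T t"
    unfolding hilbert_tensor_def
  proof (intro conjI ballI allI impI)
    fix x x' y y' c assume *: "x \<in> carrier K" "x' \<in> carrier K" "y \<in> carrier E" "y' \<in> carrier E"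
    show "inner_prod T (t x y) (t x' y') = inner_prod K x x' * inner_prod E y y'"
      using * by (simp add: ip_E T_def dsum_simps t_def sum_distrib_left mult_ac)
    show "t (x \<oplus>\<^bsub>K\<^esub> x') y = t x y \<oplus>\<^bsub>T\<^esub> t x' y"
      using * by (auto simp: t_def T_def dsum_simps algebra_simps intro!: restrict_ext eqI)
    show "t x (y \<oplus>\<^bsub>E\<^esub> y') = t x y \<oplus>\<^bsub>T\<^esub> t x y'"
      using * by (auto simp: t_def T_def E_def dsum_simps algebra_simps intro!: restrict_ext eqI)
    show "t (c \<odot>\<^bsub>K\<^esub> x) y = c \<odot>\<^bsub>T\<^esub> t x y"
      using * by (auto simp: t_def T_def dsum_simps algebra_simps intro!: restrict_ext eqI)
    show "t x (c \<odot>\<^bsub>E\<^esub> y) = c \<odot>\<^bsub>T\<^esub> t x y"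
      using * by (auto simp: t_def T_def E_def dsum_simps algebra_simps intro!: restrict_ext eqI)
  next
    fix v and \<epsilon> :: real assume v: "v \<in> carrier T" and \<epsilon>: "\<epsilon> > 0"
    have vi: "v w \<in> carrier K" if "w \<in> I" for w using v that by (auto simp: T_def dsum_simps)
    \<comment> \<open>The density clause asks for a sum over an initial segment of the natural
      numbers, hence an enumeration of \<open>I\<close>. The sum of the tensors
      \<open>t (v w) (e w)\<close> over \<open>I\<close> is exactly \<open>v\<close>, so no
      approximation takes place.\<close>
    obtain h where h: "bij_betw h {0..<card I} I" using ex_bij_betw_nat_finite[OF finite_I] by blast
    then have hI: "h j \<in> I" if "j < card I" for j using that by (auto simp: bij_betw_def)
    have F: "(\<lambda>j. t (v (h j)) (e (h j))) \<in> {..<card I} \<rightarrow> carrier T"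
      using hI vi by (auto intro!: t_closed)
    have "finsum T (\<lambda>j. t (v (h j)) (e (h j))) {..<card I} = v"
    proof (rule T.ip_right_eqI)
      fix z assume z: "z \<in> carrier T"
      have "inner_prod T z (finsum T (\<lambda>j. t (v (h j)) (e (h j))) {..<card I}) =
          (\<Sum>j<card I. inner_prod T z (t (v (h j)) (e (h j))))"
        by (rule T.ip_finsum_right[OF F z finite_lessThan])
      also have "\<dots> = (\<Sum>j\<in>{0..<card I}. inner_prod K (z (h j)) (v (h j)))"
        unfolding lessThan_atLeast0 by (intro sum.cong refl ip_t_e) (use hI vi z in auto)
      also have "\<dots> = (\<Sum>w\<in>I. inner_prod K (z w) (v w))" by (rule sum.reindex_bij_betw[OF h])
      finally show "inner_prod T z (finsum T (\<lambda>j. t (v (h j)) (e (h j))) {..<card I}) = inner_prod T z v"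
        by (simp add: T_def dsum_simps)
    qed (use v F in auto)
    then show "\<exists>N f g. (\<forall>i<N. f i \<in> carrier K \<and> g i \<in> carrier E) \<and>
        vnorm T (v \<ominus>\<^bsub>T\<^esub> finsum T (\<lambda>i. t (f i) (g i)) {..<N::nat}) < \<epsilon>"
      using v \<epsilon> hI vi
      by (intro exI[of _ "card I"] exI[of _ "\<lambda>j. v (h j)"] exI[of _ "\<lambda>j. e (h j)"]) auto
  qed (auto intro: t_closed T.hilbert)
qed (intro hilb_axioms E.hilb_axioms T.hilb_axioms)+

lemma sum_Cons:
  fixes f :: "'n list \<Rightarrow> 'b::comm_monoid_add"
  shows "(\<Sum>w\<in>I. case w of [] \<Rightarrow> 0 | j # v \<Rightarrow> if j = i then f v else 0) =
    (\<Sum>v\<in>{v\<in>I. i # v \<in> I}. f v)"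
proof -
  have "(\<Sum>w\<in>(#) i ` {v\<in>I. i # v \<in> I}. case w of [] \<Rightarrow> 0 | j # v \<Rightarrow> if j = i then f v else 0) =
      (\<Sum>w\<in>I. case w of [] \<Rightarrow> 0 | j # v \<Rightarrow> if j = i then f v else 0)"
    by (rule sum.mono_neutral_left) (use finite_I in \<open>auto split: list.split simp: I_Cons\<close>)
  then show ?thesis by (simp add: sum.reindex)
qed

lemma X_closed: "y \<in> carrier E \<Longrightarrow> X i y \<in> carrier E"
  by (simp add: X_def carrier_E)

lemma X_bop: "X i \<in> bounded_ops E"
proof (rule E.bounded_opsI)
  fix y assume y: "y \<in> carrier E"
  show "X i y \<in> carrier E" using X_closed[OF y] .
  have "(vnorm E (X i y))\<^sup>2 = (\<Sum>w\<in>I. case w of [] \<Rightarrow> 0 | j # v \<Rightarrow> if j = i then (cmod (r * y v))\<^sup>2 else 0)"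
    unfolding vnorm_E[OF X_closed[OF y]] using y by (intro sum.cong) (auto simp: X_def split: list.split)
  also have "\<dots> = (\<Sum>v\<in>{v\<in>I. i # v \<in> I}. (cmod (r * y v))\<^sup>2)" by (rule sum_Cons)
  also have "\<dots> \<le> (\<Sum>v\<in>I. (cmod (r * y v))\<^sup>2)" by (rule sum_mono2) (use finite_I in auto)
  also have "\<dots> = (r * vnorm E y)\<^sup>2"
    using y by (simp add: power_mult_distrib vnorm_E norm_mult sum_distrib_left)
  finally show "vnorm E (X i y) \<le> r * vnorm E y"
    by (rule power2_le_imp_le) (use r y in auto)
  show "X i (c \<odot>\<^bsub>E\<^esub> y) = c \<odot>\<^bsub>E\<^esub> X i y" for c
    using y E.smult_closed[OF y] by (auto simp: X_def I_Cons E_def dsum_simps split: list.split intro!: restrict_ext)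
  fix z assume z: "z \<in> carrier E"
  show "X i (y \<oplus>\<^bsub>E\<^esub> z) = X i y \<oplus>\<^bsub>E\<^esub> X i z"
    using y z E.add_closed[OF y z]
    by (auto simp: X_def I_Cons E_def dsum_simps algebra_simps split: list.split intro!: restrict_ext)
qed (simp add: X_def)

text \<open>A nonempty word has exactly one first letter. The vectors \<open>B i y\<close> together
  therefore contain each coordinate of \<open>y\<close> at a nonempty word once, multiplied by
  \<open>r\<close>, and the row norm is at most \<open>r < 1\<close>.\<close>

lemma X_row_ball: "X \<in> row_ball E"
proof -
  have "row_norm E X \<le> r"
  proof (rule E.row_norm_leI[where B = B])
    fix i x y assume x: "x \<in> carrier E" and y: "y \<in> carrier E"
    have "inner_prod E (X i x) y = (\<Sum>w\<in>I. case w of [] \<Rightarrow> 0 | j # v \<Rightarrow> if j = i then r * x v * cnj (y (i # v)) else 0)"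
      unfolding ip_E using x by (intro sum.cong) (auto simp: X_def split: list.split)
    also have "\<dots> = (\<Sum>v\<in>{v\<in>I. i # v \<in> I}. r * x v * cnj (y (i # v)))" by (rule sum_Cons)
    also have "\<dots> = (\<Sum>v\<in>I. if i # v \<in> I then r * x v * cnj (y (i # v)) else 0)"
      using finite_I by (simp add: sum.inter_filter)
    also have "\<dots> = inner_prod E x (B i y)"
      unfolding ip_E by (intro sum.cong) (auto simp: B_def)
    finally show "inner_prod E (X i x) y = inner_prod E x (B i y)" .
  next
    fix y assume y: "y \<in> carrier E"
    have Bc: "B i y \<in> carrier E" for i by (simp add: B_def carrier_E)
    have "(\<Sum>i\<in>UNIV. (vnorm E (B i y))\<^sup>2) = (\<Sum>i\<in>UNIV. \<Sum>v\<in>{v\<in>I. i # v \<in> I}. (cmod (r * y (i # v)))\<^sup>2)"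
    proof (rule sum.cong[OF refl])
      fix i
      have "(vnorm E (B i y))\<^sup>2 = (\<Sum>w\<in>I. if i # w \<in> I then (cmod (r * y (i # w)))\<^sup>2 else 0)"
        unfolding vnorm_E[OF Bc] by (intro sum.cong) (auto simp: B_def)
      then show "(vnorm E (B i y))\<^sup>2 = (\<Sum>v\<in>{v\<in>I. i # v \<in> I}. (cmod (r * y (i # v)))\<^sup>2)"
        by (simp only: sum.inter_filter[OF finite_I])
    qed
    also have "\<dots> = (\<Sum>(i, v)\<in>(SIGMA i:UNIV. {v\<in>I. i # v \<in> I}). (cmod (r * y (i # v)))\<^sup>2)"
      using finite_I by (subst sum.Sigma) auto
    also have "\<dots> = (\<Sum>w\<in>(\<lambda>(i, v). i # v) ` (SIGMA i:UNIV. {v\<in>I. i # v \<in> I}). (cmod (r * y w))\<^sup>2)"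
      by (subst sum.reindex) (auto simp: inj_on_def case_prod_beta)
    also have "\<dots> \<le> (\<Sum>w\<in>I. (cmod (r * y w))\<^sup>2)"
      by (rule sum_mono2) (use finite_I in auto)
    also have "\<dots> = r\<^sup>2 * (vnorm E y)\<^sup>2"
      using y by (simp add: power_mult_distrib vnorm_E norm_mult sum_distrib_left)
    finally show "(\<Sum>i\<in>UNIV. (vnorm E (B i y))\<^sup>2) \<le> r\<^sup>2 * (vnorm E y)\<^sup>2" .
  qed (use r X_bop in \<open>auto simp: B_def carrier_E\<close>)
  then show ?thesis using r X_bop by (simp add: row_ball_def)
qed

text \<open>Creation operators build the word \<open>u\<close> letter by letter from the vacuum
  \<open>e []\<close>, with one factor \<open>r\<close> for each letter; a word outside
  \<open>I\<close> gives the zero vector.\<close>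

lemma word_op_e: "word_op E X u (e []) = (\<lambda>w\<in>I. if w = u then complex_of_real r ^ length u else 0)"
proof (induction u)
  case Nil
  have "word_op E X [] (e []) = e []" by simp
  also have "e [] = (\<lambda>w\<in>I. if w = [] then complex_of_real r ^ length [] else 0)"
    unfolding e_def by (intro restrict_ext) simp
  finally show ?case .
next
  case (Cons i u)
  have "word_op E X (i # u) (e []) = X i (\<lambda>w\<in>I. if w = u then complex_of_real r ^ length u else 0)"
    using Cons.IH by (simp only: word_op.simps E.op_mult_apply[OF e_closed])
  also have "\<dots> = (\<lambda>w\<in>I. if w = i # u then complex_of_real r ^ length (i # u) else 0)"
    by (auto simp: X_def I_Cons carrier_E split: list.split intro!: restrict_ext)
  finally show ?case .
qed

lemma coeff_sum_le:
  fixes A :: "'n list \<Rightarrow> 'u \<Rightarrow> 'u"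
  assumes A: "free_holomorphic K A" and x: "x \<in> carrier K"
    and le1: "op_norm T (free_eval K E T t A X) \<le> 1"
  shows "r ^ (2 * k) * (\<Sum>w\<in>words k. (vnorm K (A w x))\<^sup>2) \<le> (vnorm K x)\<^sup>2"
proof -
  interpret tens: htensor K E T t by (rule htensor)
  have Ab: "A w \<in> bounded_ops K" for w using A by (simp add: free_holomorphic_def)
  let ?F = "free_eval K E T t A X"
  have F: "?F \<in> bounded_ops T" by (rule tens.free_eval_bop[OF A X_row_ball])
  define v where "v = ?F (t x (e []))"
  have tx: "t x (e []) \<in> carrier T" by (intro t_closed x e_closed)
  have v: "v \<in> carrier T" unfolding v_def by (rule T.bop_closed[OF F tx])
  \<comment> \<open>Pairing with \<open>t z (e u)\<close> leaves a single term in the series of F,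
    the one of the word \<open>u\<close>, since different words send the vacuum to orthogonal
    vectors.\<close>
  have vw: "v u = complex_of_real (r ^ length u) \<odot>\<^bsub>K\<^esub> A u x" if u: "u \<in> I" for u
  proof (rule eqI)
    show "v u \<in> carrier K" using v u by (auto simp: T_def dsum_simps)
    show "complex_of_real (r ^ length u) \<odot>\<^bsub>K\<^esub> A u x \<in> carrier K" by (intro smult_closed bop_closed[OF Ab x])
    fix z assume z: "z \<in> carrier K"
    have ipe: "inner_prod E (word_op E X w (e [])) (e u) = (if w = u then complex_of_real r ^ length u else 0)" for w
    proof -
      have "inner_prod E (word_op E X w (e [])) (e u) = (\<Sum>w'\<in>I. if w' = u then (if w = u then complex_of_real r ^ length u else 0) else 0)"
        unfolding ip_E word_op_e by (intro sum.cong) (auto simp: e_def)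
      then show ?thesis using u finite_I by simp
    qed
    have "(\<lambda>j. \<Sum>w\<in>words j. inner_prod K (A w x) z * inner_prod E (word_op E X w (e [])) (e u))
        sums inner_prod T v (t z (e u))"
      unfolding v_def by (rule tens.free_eval_weak[OF A X_row_ball x z e_closed e_closed])
    moreover have "(\<Sum>w\<in>words j. inner_prod K (A w x) z * inner_prod E (word_op E X w (e [])) (e u)) =
        (if j = length u then inner_prod K (A u x) z * r ^ length u else 0)" for j
    proof -
      have "(\<Sum>w\<in>words j. inner_prod K (A w x) z * inner_prod E (word_op E X w (e [])) (e u)) =
          (\<Sum>w\<in>words j. if w = u then inner_prod K (A u x) z * r ^ length u else 0)"
        unfolding ipe by (intro sum.cong) auto
      also have "\<dots> = (if u \<in> words j then inner_prod K (A u x) z * r ^ length u else 0)"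
        by (rule sum.delta[OF finite_words])
      finally show ?thesis by (simp add: words_def eq_commute)
    qed
    ultimately have "(\<lambda>j. if j = length u then inner_prod K (A u x) z * r ^ length u else 0)
        sums inner_prod T v (t z (e u))" by simp
    then have "inner_prod T v (t z (e u)) = inner_prod K (A u x) z * r ^ length u"
      using sums_single[of "length u" "\<lambda>_. inner_prod K (A u x) z * r ^ length u"] sums_unique2 by simp
    then show "inner_prod K (v u) z = inner_prod K (complex_of_real (r ^ length u) \<odot>\<^bsub>K\<^esub> A u x) z"
      using ip_t_e[OF u z v] z x by (simp add: bop_closed[OF Ab] mult.commute)
  qed
  have "r ^ (2 * k) * (\<Sum>w\<in>words k. (vnorm K (A w x))\<^sup>2) = (\<Sum>w\<in>words k. (vnorm K (v w))\<^sup>2)"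
    unfolding sum_distrib_left
  proof (intro sum.cong refl)
    fix w :: "'n list" assume w: "w \<in> words k"
    then have "w \<in> I" "length w = k" by (auto simp: I_def words_def)
    then show "r ^ (2 * k) * (vnorm K (A w x))\<^sup>2 = (vnorm K (v w))\<^sup>2"
      using r by (simp add: vw bop_closed[OF Ab x] norm_power power_mult_distrib power_mult power2_eq_square)
  qed
  also have "\<dots> \<le> (\<Sum>w\<in>I. (vnorm K (v w))\<^sup>2)"
    by (rule sum_mono2) (use finite_I in \<open>auto simp: I_def words_def\<close>)
  also have "\<dots> = (vnorm T v)\<^sup>2" by (rule vnorm_T[OF v, symmetric])
  also have "vnorm T v \<le> vnorm K x"
  proof -
    have "vnorm T v \<le> op_norm T ?F * vnorm T (t x (e []))" unfolding v_def by (rule T.op_norm_bound[OF F tx])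
    also have "\<dots> \<le> 1 * vnorm T (t x (e []))" by (rule mult_right_mono[OF le1 T.vnorm_nonneg[OF tx]])
    also have "(vnorm E (e []))\<^sup>2 = (\<Sum>w\<in>I. if w = [] then 1 else 0)"
      unfolding vnorm_E[OF e_closed] by (intro sum.cong) (auto simp: e_def)
    then have "(vnorm E (e []))\<^sup>2 = 1" using finite_I by (simp add: I_def)
    then have "vnorm E (e []) = 1"
      using power2_eq_imp_eq[of "vnorm E (e [])" 1] E.vnorm_nonneg[OF e_closed] by simp
    then have "1 * vnorm T (t x (e [])) = vnorm K x" using x by (simp add: tens.vnorm_t)
    finally show ?thesis .
  qed
  then have "(vnorm T v)\<^sup>2 \<le> (vnorm K x)\<^sup>2" by (rule power_mono) (simp add: v)
  finally show ?thesis .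
qed

end

lemma (in hilb) coeff_norm_le_1:
  fixes A :: "'n::finite list \<Rightarrow> 'a \<Rightarrow> 'a"
  assumes A: "free_holomorphic V A" and sup: "free_sup_norm V A \<le> 1"
  shows "coeff_norm V A k \<le> 1"
proof (rule coeff_norm_leI)
  show "A w \<in> bounded_ops V" for w using A by (simp add: free_holomorphic_def)
  fix x assume x: "x \<in> carrier V"
  show "(\<Sum>w\<in>words k. (vnorm V (A w x))\<^sup>2) \<le> 1 * (vnorm V x)\<^sup>2"
  proof (cases "x = \<zero>")
    case True
    then show ?thesis using A by (simp add: free_holomorphic_def bop_zero)
  next
    case False
    define S where "S = (\<Sum>w\<in>words k. (vnorm V (A w x))\<^sup>2)"
    have main: "r ^ (2 * k) * S \<le> (vnorm V x)\<^sup>2" if r: "0 < r" "r < 1" for r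
    proof -
      interpret fock: truncated_fock V k r "TYPE('n)"
        by unfold_locales (use r in auto)
      obtain p :: "('n list \<Rightarrow> complex) \<Rightarrow> complex" where p: "inj_on p (carrier fock.E)"
        using inj_complex_functions[OF fock.finite_I] unfolding fock.carrier_E by blast
      \<comment> \<open>This is where \<open>x\<close> must be nonzero: the coordinates of the Fock
        space, encoded in one complex number, are stored on the line through
        \<open>x\<close>.\<close>
      have "inj (\<lambda>c. c \<odot> x)"
      proof (rule injI)
        fix c d assume "c \<odot> x = d \<odot> x"
        then have "inner_prod V (c \<odot> x) x = inner_prod V (d \<odot> x) x" by simp
        then show "c = d" using x False ip_definite[OF x] by auto
      qed
      then have "inj_on (\<lambda>y. p y \<odot> x) (carrier fock.E)"
        using comp_inj_on[OF p inj_on_subset[OF _ subset_UNIV]] by (simp only: comp_def)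
      from order_trans[OF op_norm_le_free_sup_norm[OF fock.htensor this A fock.X_row_ball] sup]
      have "op_norm fock.T (free_eval V fock.E fock.T fock.t A fock.X) \<le> 1"
        by (simp only: one_ereal_def ereal_less_eq(3))
      from fock.coeff_sum_le[OF A x this] show ?thesis by (simp add: S_def)
    qed
    \<comment> \<open>The weighted creation operators lie in the open ball only for
      \<open>r < 1\<close>; the factor \<open>r ^ (2 * k)\<close> disappears in the limit.\<close>
    have "((\<lambda>r. r ^ (2 * k) * S) \<longlongrightarrow> 1 ^ (2 * k) * S) (at_left 1)" by (intro tendsto_intros)
    moreover have "\<forall>\<^sub>F r in at_left 1. r ^ (2 * k) * S \<le> (vnorm V x)\<^sup>2"
      unfolding eventually_at_left_field by (rule exI[of _ 0]) (use main in auto)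
    ultimately have "1 ^ (2 * k) * S \<le> (vnorm V x)\<^sup>2"
      by (rule tendsto_upperbound) simp
    then show ?thesis by (simp add: S_def)
  qed
qed simp

section \<open>Equivalent norms and the spectral radius\<close>

lemma Re_of_real_mult: "Re (of_real a * z) = a * Re z"
  by simp

text \<open>Fekete's argument: the limit is the infimum of the roots. The geometric growth bound for
  every \<open>\<mu>\<close> above the infimum yields the limit as well as the summability needed
  for Rota's series.\<close>

lemma root_limit_submultiplicative:
  fixes R :: "nat \<Rightarrow> real"
  assumes nonneg: "\<And>k. 0 \<le> R k" and sub: "\<And>j k. R (j + k) \<le> R j * R k"
  obtains L where "(\<lambda>k. R k powr (1 / (2 * real k))) \<longlonglongrightarrow> L" "0 \<le> L"
    and "\<And>\<rho>. L < \<rho> \<Longrightarrow> summable (\<lambda>k. R k / \<rho> ^ (2 * k))"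
    and "\<And>c. 0 \<le> c \<Longrightarrow> (\<And>k. R k \<le> (c\<^sup>2) ^ k) \<Longrightarrow> L \<le> c"
proof -
  define a where "a = (\<lambda>k. R k powr (1 / (2 * real k)))"
  \<comment> \<open>The infimum starts at 1; at 0 the exponent of the root is 0 by
    convention.\<close>
  define L where "L = (INF k\<in>{1..}. a k)"
  have a0: "0 \<le> a k" for k by (simp add: a_def)
  have bdd: "bdd_below (a ` {1..})" by (rule bdd_belowI2[of _ 0]) (rule a0)
  have La: "L \<le> a k" if "k \<ge> 1" for k
    unfolding L_def by (rule cINF_lower[OF bdd]) (use that in simp)
  have L0: "0 \<le> L" unfolding L_def by (rule cINF_greatest) (auto simp: a0)
  have growth: "\<exists>C>0. \<forall>n. R n \<le> C * (\<mu>\<^sup>2) ^ n" if l: "L < \<mu>" for \<mu>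
  proof -
    have "\<exists>m\<in>{1..}. a m < \<mu>"
      using l unfolding L_def by (subst (asm) cINF_less_iff[OF _ bdd]) auto
    then obtain m where m: "m \<ge> 1" "a m < \<mu>" by auto
    have \<mu>: "\<mu> > 0" using l L0 by simp
    have Rm: "R m \<le> (\<mu>\<^sup>2) ^ m"
      by (rule le_power_if_root_le) (use m nonneg in \<open>auto simp: a_def\<close>)
    define b where "b = (\<lambda>n. R n / (\<mu>\<^sup>2) ^ n)"
    have b0: "0 \<le> b n" for n using nonneg \<mu> by (simp add: b_def)
    \<comment> \<open>Removing a block of length \<open>m\<close> does not decrease
      \<open>b\<close>, so \<open>b\<close> is bounded by its values below \<open>m\<close>, each of
      which the sum dominates. The summand 1 makes \<open>C\<close> positive.\<close>
    define C where "C = (\<Sum>i<m. b i) + 1"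
    have C: "C > 0" using b0 by (simp add: C_def sum_nonneg add_nonneg_pos)
    have "b n \<le> C" for n
    proof (induction n rule: less_induct)
      case (less n)
      show ?case
      proof (cases "n < m")
        case True
        then have "b n \<le> (\<Sum>i<m. b i)" by (intro member_le_sum) (auto simp: b0)
        then show ?thesis by (simp add: C_def)
      next
        case False
        then have n: "n = m + (n - m)" by simp
        have "R n \<le> R m * R (n - m)" using sub[of m "n - m"] n by simp
        also have "\<dots> \<le> (\<mu>\<^sup>2) ^ m * R (n - m)" by (rule mult_right_mono[OF Rm nonneg])
        finally have "b n \<le> (\<mu>\<^sup>2) ^ m * R (n - m) / (\<mu>\<^sup>2) ^ n"
          unfolding b_def using \<mu> by (intro divide_right_mono) auto
        also have "\<dots> = b (n - m)"
          using \<mu> False power_add[of "\<mu>\<^sup>2" m "n - m"] by (simp add: b_def)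
        also have "\<dots> \<le> C" using less.IH[of "n - m"] m False by simp
        finally show ?thesis .
      qed
    qed
    then have "\<forall>n. R n \<le> C * (\<mu>\<^sup>2) ^ n" using \<mu> by (simp add: b_def divide_le_eq)
    then show ?thesis using C by blast
  qed
  have "a \<longlonglongrightarrow> L"
  proof (rule order_tendstoI)
    fix y assume "y < L"
    then show "\<forall>\<^sub>F n in sequentially. y < a n"
      by (intro eventually_sequentiallyI[of 1]) (rule less_le_trans[OF _ La])
  next
    fix y assume y: "L < y"
    define \<mu> where "\<mu> = (L + y) / 2"
    have \<mu>: "L < \<mu>" "\<mu> < y" "\<mu> > 0" using y L0 by (auto simp: \<mu>_def)
    obtain C where C: "C > 0" "\<And>n. R n \<le> C * (\<mu>\<^sup>2) ^ n" using growth[OF \<mu>(1)] by blast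
    have e0: "(\<lambda>n. 1 / (2 * real n)) \<longlonglongrightarrow> 0"
      using tendsto_mult_right_zero[OF lim_inverse_n, where c = "1/2 :: real"] by (simp add: inverse_eq_divide)
    \<comment> \<open>The constant \<open>C\<close> is lost in the limit, its roots tending to
      1.\<close>
    have "(\<lambda>n. C powr (1 / (2 * real n)) * \<mu>) \<longlonglongrightarrow> C powr 0 * \<mu>"
      by (rule tendsto_mult_right[OF tendsto_powr[OF tendsto_const e0]]) (use C(1) in simp)
    then have "\<forall>\<^sub>F n in sequentially. C powr (1 / (2 * real n)) * \<mu> < y"
      by (rule order_tendstoD(2)) (use C \<mu> in simp)
    then show "\<forall>\<^sub>F n in sequentially. a n < y"
      using eventually_ge_at_top[of "1::nat"]
    proof eventually_elim
      case (elim n)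
      have "a n \<le> (C * (\<mu>\<^sup>2) ^ n) powr (1 / (2 * real n))"
        unfolding a_def by (rule powr_mono2) (use nonneg C in auto)
      also have "(\<mu>\<^sup>2) ^ n = \<mu> powr real (2 * n)"
        by (simp only: power_mult[symmetric] powr_realpow[OF \<mu>(3)])
      also have "(C * \<mu> powr real (2 * n)) powr (1 / (2 * real n)) =
          C powr (1 / (2 * real n)) * (\<mu> powr real (2 * n)) powr (1 / (2 * real n))"
        by (rule powr_mult)
      also have "\<dots> = C powr (1 / (2 * real n)) * \<mu>"
        using elim \<mu> by (simp add: powr_powr)
      finally show ?case using elim by simp
    qed
  qed
  moreover have "summable (\<lambda>k. R k / \<rho> ^ (2 * k))" if \<rho>: "L < \<rho>" for \<rho>
  proof -
    define \<mu> where "\<mu> = (L + \<rho>) / 2"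
    have \<mu>: "L < \<mu>" "\<mu> < \<rho>" "\<mu> > 0" using \<rho> L0 by (auto simp: \<mu>_def)
    obtain C where C: "C > 0" "\<And>n. R n \<le> C * (\<mu>\<^sup>2) ^ n" using growth[OF \<mu>(1)] by blast
    show ?thesis
    proof (rule summable_comparison_test')
      have "\<mu>\<^sup>2 < \<rho>\<^sup>2" using \<mu> by (intro power_strict_mono) auto
      then show "summable (\<lambda>n. C * (\<mu>\<^sup>2 / \<rho>\<^sup>2) ^ n)"
        using \<mu> by (intro summable_mult summable_geometric) (simp add: divide_less_eq_1)
      fix n :: nat
      have "R n / (\<rho>\<^sup>2) ^ n \<le> C * (\<mu>\<^sup>2) ^ n / (\<rho>\<^sup>2) ^ n" by (intro divide_right_mono C) simp
      then show "norm (R n / \<rho> ^ (2 * n)) \<le> C * (\<mu>\<^sup>2 / \<rho>\<^sup>2) ^ n"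
        using nonneg[of n] by (simp add: power_mult power_divide)
    qed
  qed
  moreover have "L \<le> c" if c: "0 \<le> c" "\<And>k. R k \<le> (c\<^sup>2) ^ k" for c
  proof -
    have "a 1 \<le> (c\<^sup>2) powr (1 / (2 * real 1))"
      unfolding a_def by (rule powr_mono2) (use c(2)[of 1] nonneg[of 1] in auto)
    also have "\<dots> = c" using c(1) by (simp add: powr_half_sqrt)
    finally show ?thesis using La[of 1] by simp
  qed
  ultimately show thesis using that[of L] L0 unfolding a_def by blast
qed

section \<open>Equivalent inner products on the same space\<close>

locale hrenorm = hilb V for V :: "'a hilbert" (structure) +
  fixes q :: "'a \<Rightarrow> 'a \<Rightarrow> complex" and c1 c2 :: real
  assumes q_add: "\<And>x y z. x \<in> carrier V \<Longrightarrow> y \<in> carrier V \<Longrightarrow> z \<in> carrier V \<Longrightarrow> q (x \<oplus> y) z = q x z + q y z"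
    and q_smult: "\<And>c x z. x \<in> carrier V \<Longrightarrow> z \<in> carrier V \<Longrightarrow> q (c \<odot> x) z = c * q x z"
    and q_cnj: "\<And>x y. x \<in> carrier V \<Longrightarrow> y \<in> carrier V \<Longrightarrow> q y x = cnj (q x y)"
    and q_lower: "\<And>x. x \<in> carrier V \<Longrightarrow> c1 * (vnorm V x)\<^sup>2 \<le> Re (q x x)"
    and q_upper: "\<And>x. x \<in> carrier V \<Longrightarrow> Re (q x x) \<le> c2 * (vnorm V x)\<^sup>2"
    and c1: "c1 > 0" and c2: "c2 > 0"
begin

text \<open>Only the inner product is replaced. The vector space stays, and with it the bounded
  operators, their products and their spectra, whereas norms and adjoints change.\<close>

definition N :: "'a hilbert" where "N = V\<lparr>inner_prod := q\<rparr>"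

lemma N_simps [simp]:
  "carrier N = carrier V" "\<zero>\<^bsub>N\<^esub> = \<zero>" "x \<oplus>\<^bsub>N\<^esub> y = x \<oplus> y" "c \<odot>\<^bsub>N\<^esub> x = c \<odot> x"
  "inner_prod N x y = q x y" "x \<ominus>\<^bsub>N\<^esub> y = x \<ominus> y" "finsum N f I = finsum V f I"
  by (simp_all add: N_def a_minus_def a_inv_def finsum_def)

lemma vnorm_N_le: "x \<in> carrier V \<Longrightarrow> vnorm N x \<le> sqrt c2 * vnorm V x"
  using q_upper[of x] by (simp add: vnorm_def[of N]) (metis real_sqrt_le_mono real_sqrt_mult real_sqrt_abs abs_of_nonneg vnorm_nonneg)

lemma vnorm_le_N: "x \<in> carrier V \<Longrightarrow> sqrt c1 * vnorm V x \<le> vnorm N x"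
  using q_lower[of x] by (simp add: vnorm_def[of N]) (metis real_sqrt_le_mono real_sqrt_mult real_sqrt_abs abs_of_nonneg vnorm_nonneg)

lemma q_zero: "z \<in> carrier V \<Longrightarrow> q \<zero> z = 0"
  using q_smult[of "\<zero>" z 0] by simp

sublocale N: hilb N
proof (rule hilb.intro, rule complex_hilbert_spaceI)
  have zero_iff: "x = \<zero>" if "x \<in> carrier V" "Re (q x x) \<le> 0" for x
  proof -
    have "c1 * (vnorm V x)\<^sup>2 \<le> 0" using q_lower[OF that(1)] that(2) by simp
    then have "(vnorm V x)\<^sup>2 \<le> 0" using c1 by (simp add: mult_le_0_iff)
    then show ?thesis using that(1) by simp
  qed
  fix x assume x: "x \<in> carrier N"
  show "0 \<le> Re (inner_prod N x x)"
    using q_lower[of x] x c1 by (simp add: order_trans[rotated])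
  show "x = \<zero>\<^bsub>N\<^esub>" if "inner_prod N x x = 0"
    unfolding N_simps(2) by (rule zero_iff) (use x that in \<open>simp_all only: N_simps zero_complex.sel order_refl\<close>)
  fix y assume y: "y \<in> carrier N"
  show "inner_prod N y x = cnj (inner_prod N x y)"
    unfolding N_simps(5) by (rule q_cnj) (use x y in simp_all)
  assume eq: "\<And>z. z \<in> carrier N \<Longrightarrow> inner_prod N x z = inner_prod N y z"
  have "q (x \<oplus> (-1) \<odot> y) (x \<oplus> (-1) \<odot> y) = 0"
    using eq[of "x \<oplus> (-1) \<odot> y"] x y by (simp add: q_add q_smult)
  then have "x \<oplus> (-1) \<odot> y = \<zero>" using x y by (intro zero_iff) auto
  then have "x \<ominus> y = \<zero>" using x y by (simp add: minus_eq_add)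
  moreover have "x = (x \<ominus> y) \<oplus> y" "y = \<zero> \<oplus> y" by (rule eqI; use x y in simp)+
  ultimately show "x = y" by simp
next
  fix s :: "nat \<Rightarrow> 'a"
  assume s: "\<And>i. s i \<in> carrier N"
    and c: "\<And>e. e > 0 \<Longrightarrow> \<exists>N'. \<forall>i\<ge>N'. \<forall>j\<ge>N'. vnorm N (s i \<oplus>\<^bsub>N\<^esub> (-1) \<odot>\<^bsub>N\<^esub> s j) < e"
  have d: "vnorm N (s i \<oplus>\<^bsub>N\<^esub> (-1) \<odot>\<^bsub>N\<^esub> l) = vnorm N (s i \<ominus> l)" if "l \<in> carrier V" for i l
    using s that by (simp add: minus_eq_add)
  have "\<exists>l\<in>carrier V. (\<lambda>i. vnorm V (s i \<ominus> l)) \<longlonglongrightarrow> 0"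
  proof (rule complete)
    fix e :: real assume "e > 0"
    then obtain N' where N': "\<forall>i\<ge>N'. \<forall>j\<ge>N'. vnorm N (s i \<oplus>\<^bsub>N\<^esub> (-1) \<odot>\<^bsub>N\<^esub> s j) < sqrt c1 * e"
      using c[of "sqrt c1 * e"] c1 by auto
    have "vnorm V (s i \<ominus> s j) < e" if "i \<ge> N'" "j \<ge> N'" for i j
    proof -
      have "sqrt c1 * vnorm V (s i \<ominus> s j) \<le> vnorm N (s i \<ominus> s j)"
        by (rule vnorm_le_N) (use s in simp)
      also have "\<dots> < sqrt c1 * e" using N'[rule_format, OF that] d[of "s j" i] s by simp
      finally show ?thesis using c1 by simp
    qed
    then show "\<exists>N'. \<forall>i\<ge>N'. \<forall>j\<ge>N'. vnorm V (s i \<ominus> s j) < e" by (intro exI[of _ N'] allI impI)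
  qed (use s in simp)
  then obtain l where l: "l \<in> carrier V" and lim: "(\<lambda>i. vnorm V (s i \<ominus> l)) \<longlonglongrightarrow> 0" ..
  have "(\<lambda>i. vnorm N (s i \<ominus> l)) \<longlonglongrightarrow> 0"
  proof (rule null_comparison)
    show "(\<lambda>i. sqrt c2 * vnorm V (s i \<ominus> l)) \<longlonglongrightarrow> 0" by (rule tendsto_mult_right_zero[OF lim])
    fix i
    have sl: "s i \<ominus> l \<in> carrier V" using s l by simp
    have "0 \<le> sqrt c1 * vnorm V (s i \<ominus> l)" using sl c1 by simp
    also have "\<dots> \<le> vnorm N (s i \<ominus> l)" by (rule vnorm_le_N[OF sl])
    finally show "norm (vnorm N (s i \<ominus> l)) \<le> sqrt c2 * vnorm V (s i \<ominus> l)" using vnorm_N_le[OF sl] by simp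
  qed
  then show "\<exists>l\<in>carrier N. (\<lambda>i. vnorm N (s i \<oplus>\<^bsub>N\<^esub> (-1) \<odot>\<^bsub>N\<^esub> l)) \<longlonglongrightarrow> 0"
    using l by (intro bexI[of _ l]) (simp_all only: d N_simps(1))
qed (simp_all add: q_add q_smult q_zero)

lemma bounded_ops_N: "bounded_ops N = bounded_ops V"
proof (intro equalityI subsetI)
  fix S assume S: "S \<in> bounded_ops N"
  obtain b where b: "b \<ge> 0" "\<And>x. x \<in> carrier V \<Longrightarrow> vnorm N (S x) \<le> b * vnorm N x"
    using N.bop_bound[OF S] by auto
  show "S \<in> bounded_ops V"
  proof (rule bounded_opsI)
    fix x assume x: "x \<in> carrier V"
    have "sqrt c1 * vnorm V (S x) \<le> vnorm N (S x)" by (rule vnorm_le_N) (use N.bop_closed[OF S] x in simp)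
    also have "\<dots> \<le> b * vnorm N x" by (rule b(2)[OF x])
    also have "\<dots> \<le> b * (sqrt c2 * vnorm V x)" by (rule mult_left_mono[OF vnorm_N_le[OF x] b(1)])
    finally show "vnorm V (S x) \<le> (b * sqrt c2 / sqrt c1) * vnorm V x" using c1 by (simp add: field_simps)
  qed (use N.bop_closed[OF S] N.bop_add[OF S] N.bop_smult[OF S] N.bop_ext[OF S] in auto)
next
  fix S assume S: "S \<in> bounded_ops V"
  obtain b where b: "b \<ge> 0" "\<And>x. x \<in> carrier V \<Longrightarrow> vnorm V (S x) \<le> b * vnorm V x"
    using bop_bound[OF S] by auto
  show "S \<in> bounded_ops N"
  proof (rule N.bounded_opsI)
    fix x assume "x \<in> carrier N"
    then have x: "x \<in> carrier V" by simp
    have "vnorm N (S x) \<le> sqrt c2 * vnorm V (S x)" by (rule vnorm_N_le[OF bop_closed[OF S x]])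
    also have "\<dots> \<le> sqrt c2 * (b * vnorm V x)" by (rule mult_left_mono[OF b(2)[OF x]]) (use c2 in simp)
    finally have 1: "vnorm N (S x) \<le> (sqrt c2 * b) * vnorm V x" by (simp add: mult.assoc)
    have "vnorm V x \<le> vnorm N x / sqrt c1" using vnorm_le_N[OF x] c1 by (simp add: field_simps)
    then have "(sqrt c2 * b) * vnorm V x \<le> (sqrt c2 * b) * (vnorm N x / sqrt c1)"
      by (rule mult_left_mono) (use b c2 in simp)
    with 1 show "vnorm N (S x) \<le> (sqrt c2 * b / sqrt c1) * vnorm N x" by simp
  qed (use bop_closed[OF S] bop_add[OF S] bop_smult[OF S] bop_ext[OF S] in auto)
qed

text \<open>Spectrum is a notion of the algebra of bounded operators, which is the same for
  equivalent norms. A norm estimate in any equivalent norm can thus be used for the spectral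
  radius.\<close>

lemma op_spectral_radius_N: "op_spectral_radius N S = op_spectral_radius V S"
  by (simp add: op_spectral_radius_def op_spectrum_def bounded_ops_N op_mult_def op_diff_def op_smult_def op_id_def)

lemma word_op_N: "word_op N X w = word_op V X w"
  by (induction w) (simp_all add: op_mult_def op_id_def)

text \<open>Passing from the form \<open>\<langle>P x, y\<rangle>\<close> to \<open>\<langle>P\<^sup>-\<^sup>1 x, y\<rangle>\<close>.\<close>

lemma q_inverse_exists:
  shows "\<exists>G\<in>bounded_ops V. \<forall>x\<in>carrier V. \<forall>y\<in>carrier V. q x (G y) = inner_prod V x y"
proof -
  have "\<exists>G\<in>bounded_ops N. (\<forall>x\<in>carrier N. \<forall>y\<in>carrier N. inner_prod N x (G y) = inner_prod V x y) \<and>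
      (\<forall>u\<in>carrier N. vnorm N (G u) \<le> (1 / c1) * vnorm N u)"
  proof (rule N.op_exists[where \<phi> = "\<lambda>x. x"])
    show "carrier N \<noteq> {}" using N.zero_closed by (metis empty_iff)
    show "cmod (inner_prod V x y) \<le> 1 / c1 * vnorm N x * vnorm N y" if "x \<in> carrier N" "y \<in> carrier N" for x y
    proof -
      have x: "x \<in> carrier V" and y: "y \<in> carrier V" using that by auto
      have "(sqrt c1 * vnorm V x) * (sqrt c1 * vnorm V y) \<le> vnorm N x * vnorm N y"
        by (intro mult_mono vnorm_le_N x y N.vnorm_nonneg[OF that(1)] mult_nonneg_nonneg vnorm_nonneg)
           (use c1 in simp)
      also have "(sqrt c1 * vnorm V x) * (sqrt c1 * vnorm V y) = (sqrt c1 * sqrt c1) * (vnorm V x * vnorm V y)"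
        by (simp only: mult_ac)
      also have "sqrt c1 * sqrt c1 = c1" using c1 by simp
      finally have "c1 * (vnorm V x * vnorm V y) \<le> vnorm N x * vnorm N y" .
      moreover have "c1 * cmod (inner_prod V x y) \<le> c1 * (vnorm V x * vnorm V y)"
        using cauchy_schwarz[OF x y] c1 by simp
      ultimately have "c1 * cmod (inner_prod V x y) \<le> vnorm N x * vnorm N y" by simp
      then show ?thesis using c1 by (simp add: pos_le_divide_eq mult.commute)
    qed
    show "\<exists>k\<in>carrier N. k = i \<oplus>\<^bsub>N\<^esub> j \<and> (\<forall>u\<in>carrier N. inner_prod V k u = inner_prod V i u + inner_prod V j u)"
      if "i \<in> carrier N" "j \<in> carrier N" for i j
      using that by (intro bexI[of _ "i \<oplus> j"]) auto
    show "\<exists>k\<in>carrier N. k = a \<odot>\<^bsub>N\<^esub> i \<and> (\<forall>u\<in>carrier N. inner_prod V k u = a * inner_prod V i u)"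
      if "i \<in> carrier N" for i a
      using that by (intro bexI[of _ "a \<odot> i"]) auto
    show "u = \<zero>\<^bsub>N\<^esub>" if u: "u \<in> carrier N" "\<And>i. i \<in> carrier N \<Longrightarrow> inner_prod N i u = 0" for u
      by (rule N.ip_definite[OF u(1) u(2)[OF u(1)]])
  qed (use c1 in auto)
  then show ?thesis by (auto simp: bounded_ops_N)
qed

text \<open>If \<open>q\<close> is the form of a positive operator, \<open>G\<close> is the inverse
  of that operator. The new form is \<open>q\<close> pulled back along \<open>G\<close>, hence
  positive, and the two constants are inverted and exchange their places.\<close>

lemma q_inverse:
  assumes G: "G \<in> bounded_ops V"
    and qG: "\<And>x y. x \<in> carrier V \<Longrightarrow> y \<in> carrier V \<Longrightarrow> q x (G y) = inner_prod V x y"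
  shows ip_G: "\<And>x y. x \<in> carrier V \<Longrightarrow> y \<in> carrier V \<Longrightarrow> inner_prod V x (G y) = q (G x) (G y)"
    and hrenorm_G: "hrenorm V (\<lambda>x y. inner_prod V x (G y)) (1 / c2) (1 / c1)"
proof -
  note [simp] = bop_closed[OF G]
  show ip: "inner_prod V x (G y) = q (G x) (G y)" if "x \<in> carrier V" "y \<in> carrier V" for x y
    using ip_cnj[of "G y" x] q_cnj[of "G y" "G x"] qG[of "G y" x] that by simp
  show "hrenorm V (\<lambda>x y. inner_prod V x (G y)) (1 / c2) (1 / c1)"
  proof
    fix x assume x: "x \<in> carrier V"
    have Gx: "G x \<in> carrier V" using x by simp
    have nG: "(vnorm N (G x))\<^sup>2 = Re (inner_prod V x (G x))"
      using N.vnorm_sq[of "G x"] x by (simp add: ip)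
    show "1 / c2 * (vnorm V x)\<^sup>2 \<le> Re (inner_prod V x (G x))"
    proof -
      \<comment> \<open>Cauchy-Schwarz for \<open>q\<close>, followed by cancelling one factor
        \<open>vnorm V x\<close>.\<close>
      have "(vnorm V x)\<^sup>2 = Re (q x (G x))" using qG[OF x x] x by (simp add: vnorm_sq)
      also have "\<dots> \<le> vnorm N x * vnorm N (G x)"
        using N.cauchy_schwarz[of x "G x"] complex_Re_le_cmod[of "q x (G x)"] x by simp
      also have "\<dots> \<le> sqrt c2 * vnorm V x * vnorm N (G x)"
        by (intro mult_right_mono vnorm_N_le x N.vnorm_nonneg) (simp add: x)
      finally have le: "vnorm V x * vnorm V x \<le> vnorm V x * (sqrt c2 * vnorm N (G x))"
        by (simp add: power2_eq_square mult_ac)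
      have "vnorm V x \<le> sqrt c2 * vnorm N (G x)"
      proof (cases "vnorm V x = 0")
        case True
        then show ?thesis using N.vnorm_nonneg[of "G x"] x c2 by simp
      next
        case False
        then have "vnorm V x > 0" using vnorm_nonneg[OF x] by simp
        then show ?thesis using le by simp
      qed
      then have "(vnorm V x)\<^sup>2 \<le> (sqrt c2 * vnorm N (G x))\<^sup>2" by (rule power_mono) (simp add: x)
      then show ?thesis using c2 by (simp add: power_mult_distrib nG field_simps)
    qed
    show "Re (inner_prod V x (G x)) \<le> 1 / c1 * (vnorm V x)\<^sup>2"
    proof -
      \<comment> \<open>Here Cauchy-Schwarz is applied in the old inner product, and the factor
        cancelled is \<open>vnorm N (G x)\<close>.\<close>
      have "(vnorm N (G x))\<^sup>2 \<le> vnorm V x * vnorm V (G x)"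
        unfolding nG using cauchy_schwarz[OF x Gx] complex_Re_le_cmod[of "inner_prod V x (G x)"] by simp
      also have "\<dots> \<le> vnorm V x * (vnorm N (G x) / sqrt c1)"
        using vnorm_le_N[OF Gx] c1 by (intro mult_left_mono) (auto simp: field_simps x)
      finally have le: "vnorm N (G x) * vnorm N (G x) \<le> vnorm N (G x) * (vnorm V x / sqrt c1)"
        by (simp add: power2_eq_square mult_ac)
      have "vnorm N (G x) \<le> vnorm V x / sqrt c1"
      proof (cases "vnorm N (G x) = 0")
        case True
        then show ?thesis unfolding True using x c1 by (intro divide_nonneg_pos) auto
      next
        case False
        moreover have "0 \<le> vnorm N (G x)" by (rule N.vnorm_nonneg) (simp add: x)
        ultimately have "0 < vnorm N (G x)" by (metis order_less_le)
        then show ?thesis using le by (simp only: mult_le_cancel_left_pos)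
      qed
      then have "(vnorm N (G x))\<^sup>2 \<le> (vnorm V x / sqrt c1)\<^sup>2"
        by (rule power_mono) (simp add: N.vnorm_nonneg x)
      then show ?thesis using c1 by (simp add: power_divide nG)
    qed
    fix y assume y: "y \<in> carrier V"
    show "inner_prod V y (G x) = cnj (inner_prod V x (G y))"
      using x y q_cnj[of "G x" "G y"] by (simp add: ip)
  qed (use c1 c2 in auto)
qed

end

section \<open>Rota's form as an equivalent inner product\<close>

text \<open>The form \<open>\<langle>P x, y\<rangle>\<close> for \<open>P = \<Sum>\<^sub>w \<rho>\<^bsup>-2|w|\<^esup> B\<^sub>w\<^sup>* B\<^sub>w\<close>, after Rota.\<close>

definition rota :: "'a hilbert \<Rightarrow> real \<Rightarrow> ('n::finite list \<Rightarrow> 'a \<Rightarrow> 'a) \<Rightarrow> 'a \<Rightarrow> 'a \<Rightarrow> complex" where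
  "rota V \<rho> B x y = (\<Sum>k. of_real (1 / \<rho> ^ (2 * k)) * (\<Sum>w\<in>words k. inner_prod V (B w x) (B w y)))"

context hilb
begin

context
  fixes B :: "'n::finite list \<Rightarrow> 'a \<Rightarrow> 'a" and \<rho> :: real and d :: "nat \<Rightarrow> real"
  assumes B: "\<And>w. B w \<in> bounded_ops V"
    and B_Nil: "\<And>x. x \<in> carrier V \<Longrightarrow> B [] x = x"
    and d: "\<And>k x. x \<in> carrier V \<Longrightarrow> (\<Sum>w\<in>words k. (vnorm V (B w x))\<^sup>2) \<le> d k * (vnorm V x)\<^sup>2"
    and d0: "\<And>k. d k \<ge> 0"
    and \<rho>: "\<rho> > 0" and sd: "summable (\<lambda>k. d k / \<rho> ^ (2 * k))"
begin

text \<open>Cauchy-Schwarz for families bounds the term of degree \<open>k\<close> by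
  \<open>d k / \<rho> ^ (2 * k)\<close> times the two norms. The family \<open>B\<close> is left
  abstract because it is taken on \<open>H\<close> and on the tensor product.\<close>

lemma rota_sums:
  assumes x: "x \<in> carrier V" and y: "y \<in> carrier V"
  shows "(\<lambda>k. of_real (1 / \<rho> ^ (2 * k)) * (\<Sum>w\<in>words k. inner_prod V (B w x) (B w y))) sums rota V \<rho> B x y"
proof -
  have "summable (\<lambda>k. complex_of_real (1 / \<rho> ^ (2 * k)) * (\<Sum>w\<in>words k. inner_prod V (B w x) (B w y)))"
  proof (rule summable_comparison_test')
    show "summable (\<lambda>k. d k / \<rho> ^ (2 * k) * (vnorm V x * vnorm V y))" by (rule summable_mult2[OF sd])
    fix k :: nat
    have "cmod (\<Sum>w\<in>words k. inner_prod V (B w x) (B w y)) \<le> (sqrt (d k) * vnorm V x) * (sqrt (d k) * vnorm V y)"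
      by (rule ip_sum_le) (use d[of x k] d[of y k] d0[of k] x y bop_closed[OF B] in \<open>auto simp: power_mult_distrib\<close>)
    also have "\<dots> = (sqrt (d k) * sqrt (d k)) * (vnorm V x * vnorm V y)" by (simp only: mult_ac)
    also have "sqrt (d k) * sqrt (d k) = d k" using d0[of k] by simp
    finally have "cmod (\<Sum>w\<in>words k. inner_prod V (B w x) (B w y)) / \<rho> ^ (2 * k) \<le> d k * (vnorm V x * vnorm V y) / \<rho> ^ (2 * k)"
      using \<rho> by (intro divide_right_mono) auto
    then show "norm (complex_of_real (1 / \<rho> ^ (2 * k)) * (\<Sum>w\<in>words k. inner_prod V (B w x) (B w y)))
        \<le> d k / \<rho> ^ (2 * k) * (vnorm V x * vnorm V y)"
      using \<rho> by (simp add: norm_mult norm_divide norm_power)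
  qed
  then show ?thesis unfolding rota_def by (rule summable_sums)
qed

lemma rota_self_sums:
  assumes x: "x \<in> carrier V"
  shows "(\<lambda>k. (1 / \<rho> ^ (2 * k)) * (\<Sum>w\<in>words k. (vnorm V (B w x))\<^sup>2)) sums Re (rota V \<rho> B x x)"
proof -
  have "Re (of_real (1 / \<rho> ^ (2 * k)) * (\<Sum>w\<in>words k. inner_prod V (B w x) (B w x))) =
      (1 / \<rho> ^ (2 * k)) * (\<Sum>w\<in>words k. (vnorm V (B w x))\<^sup>2)" for k
    by (simp only: Re_of_real_mult Re_sum vnorm_sq[OF bop_closed[OF B x]])
  then show ?thesis using sums_Re[OF rota_sums[OF x x]] by (simp only:)
qed

text \<open>The lower constant 1 is the term of degree 0, where \<open>B []\<close> is the identity.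
  The summand 1 in the upper constant ensures that it is positive.\<close>

lemma hrenorm_rota: "hrenorm V (rota V \<rho> B) 1 (suminf (\<lambda>k. d k / \<rho> ^ (2 * k)) + 1)"
proof
  note [simp] = bop_closed[OF B]
  have pos: "0 \<le> suminf (\<lambda>k. d k / \<rho> ^ (2 * k))" by (rule suminf_nonneg[OF sd]) (use d0 in auto)
  then show "0 < suminf (\<lambda>k. d k / \<rho> ^ (2 * k)) + 1" by simp
  fix x assume x: "x \<in> carrier V"
  show "1 * (vnorm V x)\<^sup>2 \<le> Re (rota V \<rho> B x x)"
  proof -
    have "(\<Sum>k\<in>{0}. (1 / \<rho> ^ (2 * k)) * (\<Sum>w\<in>words k. (vnorm V (B w x))\<^sup>2)) \<le>
        (\<Sum>k. (1 / \<rho> ^ (2 * k)) * (\<Sum>w\<in>words k. (vnorm V (B w x))\<^sup>2))"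
      by (rule sum_le_suminf[OF sums_summable[OF rota_self_sums[OF x]]])
         (use \<rho> in \<open>auto intro!: mult_nonneg_nonneg sum_nonneg divide_nonneg_pos\<close>)
    also have "\<dots> = Re (rota V \<rho> B x x)" by (rule sums_unique[OF rota_self_sums[OF x], symmetric])
    finally show ?thesis by (simp add: B_Nil x)
  qed
  show "Re (rota V \<rho> B x x) \<le> (suminf (\<lambda>k. d k / \<rho> ^ (2 * k)) + 1) * (vnorm V x)\<^sup>2"
  proof -
    have "Re (rota V \<rho> B x x) \<le> suminf (\<lambda>k. d k / \<rho> ^ (2 * k)) * (vnorm V x)\<^sup>2"
    proof (rule sums_le[OF _ rota_self_sums[OF x] sums_mult2[OF summable_sums[OF sd]]])
      fix k
      have "(\<Sum>w\<in>words k. (vnorm V (B w x))\<^sup>2) / \<rho> ^ (2 * k) \<le> d k * (vnorm V x)\<^sup>2 / \<rho> ^ (2 * k)"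
        using d[OF x, of k] by (intro divide_right_mono) auto
      then show "1 / \<rho> ^ (2 * k) * (\<Sum>w\<in>words k. (vnorm V (B w x))\<^sup>2) \<le> d k / \<rho> ^ (2 * k) * (vnorm V x)\<^sup>2"
        by simp
    qed
    then show ?thesis by (simp add: distrib_right add_increasing2)
  qed
  fix z assume z: "z \<in> carrier V"
  show "rota V \<rho> B (c \<odot> x) z = c * rota V \<rho> B x z" for c
  proof -
    have "of_real (1 / \<rho> ^ (2 * k)) * (\<Sum>w\<in>words k. inner_prod V (B w (c \<odot> x)) (B w z)) =
        c * (of_real (1 / \<rho> ^ (2 * k)) * (\<Sum>w\<in>words k. inner_prod V (B w x) (B w z)))" for k
      using x z by (simp add: bop_smult[OF B] sum_distrib_left mult_ac)
    from sums_mult[OF rota_sums[OF x z], of c, folded this]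
    show ?thesis by (rule sums_unique2[OF rota_sums[OF smult_closed[OF x] z]])
  qed
  show "rota V \<rho> B z x = cnj (rota V \<rho> B x z)"
  proof -
    have "cnj (of_real (1 / \<rho> ^ (2 * k)) * (\<Sum>w\<in>words k. inner_prod V (B w x) (B w z))) =
        of_real (1 / \<rho> ^ (2 * k)) * (\<Sum>w\<in>words k. inner_prod V (B w z) (B w x))" for k
      unfolding complex_cnj_mult complex_cnj_complex_of_real cnj_sum
      by (intro arg_cong2[where f = "(*)"] refl sum.cong ip_cnj[symmetric] bop_closed[OF B] x z)
    from rota_sums[OF x z, THEN iffD2[OF sums_cnj], unfolded this]
    show ?thesis by (rule sums_unique2[OF rota_sums[OF z x]])
  qed
  fix y assume y: "y \<in> carrier V"
  show "rota V \<rho> B (x \<oplus> y) z = rota V \<rho> B x z + rota V \<rho> B y z" if z: "z \<in> carrier V" for z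
  proof -
    have "of_real (1 / \<rho> ^ (2 * k)) * (\<Sum>w\<in>words k. inner_prod V (B w (x \<oplus> y)) (B w z)) =
        of_real (1 / \<rho> ^ (2 * k)) * (\<Sum>w\<in>words k. inner_prod V (B w x) (B w z)) +
        of_real (1 / \<rho> ^ (2 * k)) * (\<Sum>w\<in>words k. inner_prod V (B w y) (B w z))" for k
      using x y z by (simp add: bop_add[OF B] sum.distrib distrib_left)
    from sums_add[OF rota_sums[OF x z] rota_sums[OF y z], folded this]
    show ?thesis by (rule sums_unique2[OF rota_sums[OF add_closed[OF x y] z]])
  qed
qed simp

end

end

text \<open>This recovers the operator P from its form, so that an inverse of P on a tensor product
  can be verified on elementary tensors.\<close>

lemma (in hrenorm) q_op_exists:
  shows "\<exists>M\<in>bounded_ops V. \<forall>x\<in>carrier V. \<forall>y\<in>carrier V. inner_prod V x (M y) = q x y"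
proof -
  have "\<exists>M\<in>bounded_ops V. (\<forall>x\<in>carrier V. \<forall>y\<in>carrier V. inner_prod V x (M y) = q x y) \<and>
      (\<forall>u\<in>carrier V. vnorm V (M u) \<le> c2 * vnorm V u)"
  proof (rule op_exists[where \<phi> = "\<lambda>x. x"])
    show "carrier V \<noteq> {}" using zero_closed by (metis empty_iff)
    show "cmod (q x y) \<le> c2 * vnorm V x * vnorm V y" if x: "x \<in> carrier V" and y: "y \<in> carrier V" for x y
    proof -
      have "cmod (q x y) \<le> vnorm N x * vnorm N y"
        using N.cauchy_schwarz[of x y] x y by simp
      also have "\<dots> \<le> (sqrt c2 * vnorm V x) * (sqrt c2 * vnorm V y)"
        by (intro mult_mono vnorm_N_le x y mult_nonneg_nonneg N.vnorm_nonneg vnorm_nonneg)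
           (use x y c2 in simp_all)
      also have "\<dots> = (sqrt c2 * sqrt c2) * vnorm V x * vnorm V y" by (simp only: mult_ac)
      also have "sqrt c2 * sqrt c2 = c2" using c2 by simp
      finally show ?thesis .
    qed
    show "\<exists>k\<in>carrier V. k = i \<oplus> j \<and> (\<forall>u\<in>carrier V. q k u = q i u + q j u)"
      if "i \<in> carrier V" "j \<in> carrier V" for i j
      using that by (intro bexI[of _ "i \<oplus> j"]) (auto simp: q_add)
    show "\<exists>k\<in>carrier V. k = a \<odot> i \<and> (\<forall>u\<in>carrier V. q k u = a * q i u)"
      if "i \<in> carrier V" for i a
      using that by (intro bexI[of _ "a \<odot> i"]) (auto simp: q_smult)
    show "u = \<zero>" if u: "u \<in> carrier V" "\<And>i. i \<in> carrier V \<Longrightarrow> inner_prod V i u = 0" for u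
      by (rule ip_definite[OF u(1) u(2)[OF u(1)]])
    show "q i (u \<oplus> v) = q i u + q i v" if "i \<in> carrier V" "u \<in> carrier V" "v \<in> carrier V" for i u v
      using N.ip_add_right[of u v i] that by simp
    show "q i (c \<odot> u) = cnj c * q i u" if "i \<in> carrier V" "u \<in> carrier V" for i u c
      using N.ip_smult_right[of u i c] that by simp
  qed (use c2 in auto)
  then show ?thesis by blast
qed

text \<open>The adjoint of \<open>X\<^sub>w\<close> after that of \<open>X\<^sub>i\<close> is the
  adjoint belonging to the word \<open>i # w\<close>. Summation over \<open>i\<close> thus raises
  the degree by one: the series is multiplied by \<open>\<rho>\<^sup>2\<close> and loses its
  nonnegative term of degree 0.\<close>

lemma (in hilb) rota_row:
  fixes X :: "'n::finite \<Rightarrow> 'a \<Rightarrow> 'a"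
  assumes X: "\<And>i. X i \<in> bounded_ops V" and \<rho>: "\<rho> > 0"
    and sd: "summable (\<lambda>k. word_norm V X k / \<rho> ^ (2 * k))" and u: "u \<in> carrier V"
  defines "B \<equiv> \<lambda>w. adjoint V (word_op V X w)"
  shows "(\<Sum>i\<in>UNIV. Re (rota V \<rho> B (adjoint V (X i) u) (adjoint V (X i) u))) \<le> \<rho>\<^sup>2 * Re (rota V \<rho> B u u)"
proof -
  note Xw = word_op_bop[of X, OF X]
  have sums: "(\<lambda>k. (1 / \<rho> ^ (2 * k)) * (\<Sum>w\<in>words k. (vnorm V (B w x))\<^sup>2)) sums Re (rota V \<rho> B x x)"
    if x: "x \<in> carrier V" for x
    unfolding B_def
    by (rule rota_self_sums[where d = "word_norm V X"])
       (simp_all add: adjoint_bop[OF Xw] adjoint_op_id word_norm_bound[of X, OF X] word_norm_nonneg[of X, OF X] \<rho> sd x)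
  define f where "f = (\<lambda>k. (1 / \<rho> ^ (2 * k)) * (\<Sum>w\<in>words k. (vnorm V (B w u))\<^sup>2))"
  have au: "adjoint V (X i) u \<in> carrier V" for i by (rule bop_closed[OF adjoint_bop[OF X] u])
  have "(\<lambda>k. \<Sum>i\<in>UNIV. (1 / \<rho> ^ (2 * k)) * (\<Sum>w\<in>words k. (vnorm V (B w (adjoint V (X i) u)))\<^sup>2))
      sums (\<Sum>i\<in>UNIV. Re (rota V \<rho> B (adjoint V (X i) u) (adjoint V (X i) u)))"
    by (rule sums_sum[OF sums[OF au]])
  moreover have "(\<Sum>i\<in>UNIV. (1 / \<rho> ^ (2 * k)) * (\<Sum>w\<in>words k. (vnorm V (B w (adjoint V (X i) u)))\<^sup>2)) = \<rho>\<^sup>2 * f (k + 1)" for k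
  proof -
    have "(\<Sum>v\<in>words (Suc 0 + k). (vnorm V (B v u))\<^sup>2) = (\<Sum>i\<in>UNIV. \<Sum>w\<in>words k. (vnorm V (B ([i] @ w) u))\<^sup>2)"
      unfolding sum_words_add sum_words_1 ..
    also have "\<dots> = (\<Sum>i\<in>UNIV. \<Sum>w\<in>words k. (vnorm V (B w (adjoint V (X i) u)))\<^sup>2)"
      unfolding B_def adjoint_word_append[of X, OF X u] adjoint_word_single[of X, OF X u] ..
    finally have "f (k + 1) = (1 / \<rho> ^ (2 * (k + 1))) * (\<Sum>i\<in>UNIV. \<Sum>w\<in>words k. (vnorm V (B w (adjoint V (X i) u)))\<^sup>2)"
      by (simp add: f_def)
    moreover have "\<rho>\<^sup>2 * (1 / \<rho> ^ (2 * (k + 1))) = 1 / \<rho> ^ (2 * k)"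
      using \<rho> by (simp add: power2_eq_square)
    ultimately show ?thesis by (simp only: mult.assoc[symmetric] sum_distrib_left)
  qed
  moreover have "(\<lambda>k. \<rho>\<^sup>2 * f (k + 1)) sums (\<rho>\<^sup>2 * (Re (rota V \<rho> B u u) - (\<Sum>i<1. f i)))"
    by (intro sums_mult sums_split_initial_segment) (use sums[OF u] in \<open>simp only: f_def\<close>)
  ultimately have "(\<Sum>i\<in>UNIV. Re (rota V \<rho> B (adjoint V (X i) u) (adjoint V (X i) u))) =
      \<rho>\<^sup>2 * (Re (rota V \<rho> B u u) - (\<Sum>i<1. f i))"
    by (simp only: sums_unique2)
  moreover have "f 0 \<ge> 0" by (simp add: f_def)
  ultimately show ?thesis by (simp add: mult_left_mono)
qed

lemma (in htensor) op_spectral_radius_free_eval_le: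
  fixes A :: "'n::finite list \<Rightarrow> 'k \<Rightarrow> 'k"
  assumes A: "free_holomorphic K A"
    and le1: "\<And>H' T' Y. htensor K H' T' t \<Longrightarrow> Y \<in> row_ball H' \<Longrightarrow> op_norm T' (free_eval K H' T' t A Y) \<le> 1"
    and A0: "\<And>w. length w < m \<Longrightarrow> A w = op_zero K"
    and X: "X \<in> row_ball H" and \<rho>: "0 < \<rho>" "\<rho> < 1"
    and sd: "summable (\<lambda>k. word_norm H X k / \<rho> ^ (2 * k))"
  shows "op_spectral_radius T (free_eval K H T t A X) \<le> \<rho> ^ m"
proof -
  note Xb = row_ballD(1)[OF X]
  note Xw = H.word_op_bop[of X, OF Xb]
  note d0 = H.word_norm_nonneg[of X, OF Xb] and d = H.word_norm_bound[of X, OF Xb]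
  have Ab: "A w \<in> bounded_ops K" for w using A by (simp add: free_holomorphic_def)
  define B where "B = (\<lambda>w. adjoint H (word_op H X w))"
  have B: "B w \<in> bounded_ops H" for w unfolding B_def by (rule H.adjoint_bop[OF Xw])
  \<comment> \<open>The same construction on the tensor product: the column estimate for operators
    on the second factor gives \<open>C\<close> the bounds of \<open>B\<close>, hence the same
    constants.\<close>
  define C where "C = (\<lambda>w. tensor_op K H T t (op_id K) (B w))"
  have C: "C w \<in> bounded_ops T" for w unfolding C_def by (rule tensor_op_bop[OF K.op_id_bop B])
  have Ct: "C w (t x y) = t x (B w y)" if "x \<in> carrier K" "y \<in> carrier H" for w x y
    using that by (simp add: C_def tensor_op_t[OF K.op_id_bop B])
  have B_Nil: "B [] y = y" if "y \<in> carrier H" for y using that by (simp add: B_def H.adjoint_op_id)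
  have "tensor_op K H T t (op_id K) (B []) = op_id T"
    by (rule tensor_op_eqI[OF K.op_id_bop B T.op_id_bop]) (simp add: B_Nil)
  then have C_Nil: "C [] u = u" if "u \<in> carrier T" for u using that by (simp add: C_def)
  have Bd: "(\<Sum>w\<in>words k. (vnorm H (B w y))\<^sup>2) \<le> word_norm H X k * (vnorm H y)\<^sup>2" if "y \<in> carrier H" for k y
    unfolding B_def by (rule d[OF that])
  have Cd: "(\<Sum>w\<in>words k. (vnorm T (C w u))\<^sup>2) \<le> word_norm H X k * (vnorm T u)\<^sup>2" if "u \<in> carrier T" for k u
    unfolding C_def by (rule tensor_estimate_right[OF finite_words B Bd that])
  let ?p = "rota H \<rho> B" and ?pT = "rota T \<rho> C"
  have rH: "(\<lambda>k. of_real (1 / \<rho> ^ (2 * k)) * (\<Sum>w\<in>words k. inner_prod H (B w x) (B w y))) sums ?p x y"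
    if "x \<in> carrier H" "y \<in> carrier H" for x y
    using that by (rule H.rota_sums[of B "word_norm H X" \<rho>, OF B B_Nil Bd d0 \<rho>(1) sd, rotated 2])
  have rT: "(\<lambda>k. of_real (1 / \<rho> ^ (2 * k)) * (\<Sum>w\<in>words k. inner_prod T (C w x) (C w y))) sums ?pT x y"
    if "x \<in> carrier T" "y \<in> carrier T" for x y
    using that by (rule T.rota_sums[of C "word_norm H X" \<rho>, OF C C_Nil Cd d0 \<rho>(1) sd, rotated 2])
  define D where "D = suminf (\<lambda>k. word_norm H X k / \<rho> ^ (2 * k)) + 1"
  interpret P: hrenorm H ?p 1 D
    unfolding D_def by (rule H.hrenorm_rota[of B "word_norm H X" \<rho>, OF B B_Nil Bd d0 \<rho>(1) sd])
  interpret PT: hrenorm T ?pT 1 D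
    unfolding D_def by (rule T.hrenorm_rota[of C "word_norm H X" \<rho>, OF C C_Nil Cd d0 \<rho>(1) sd])
  \<comment> \<open>\<open>C w\<close> acts on the second factor alone, so each term of the series
    splits off the inner product of \<open>K\<close>.\<close>
  have pT: "?pT (t x y) (t x' y') = inner_prod K x x' * ?p y y'"
    if "x \<in> carrier K" "x' \<in> carrier K" "y \<in> carrier H" "y' \<in> carrier H" for x x' y y'
  proof -
    have "of_real (1 / \<rho> ^ (2 * k)) * (\<Sum>w\<in>words k. inner_prod T (C w (t x y)) (C w (t x' y'))) =
        inner_prod K x x' * (of_real (1 / \<rho> ^ (2 * k)) * (\<Sum>w\<in>words k. inner_prod H (B w y) (B w y')))" for k
      using that by (simp add: Ct H.bop_closed[OF B] sum_distrib_left mult_ac)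
    from sums_mult[OF rH[OF that(3,4)], of "inner_prod K x x'", folded this]
    show ?thesis by (rule sums_unique2[OF rT[OF t_closed[OF that(1,3)] t_closed[OF that(2,4)]]])
  qed
  obtain G where G: "G \<in> bounded_ops H"
    and pG: "\<And>x y. x \<in> carrier H \<Longrightarrow> y \<in> carrier H \<Longrightarrow> ?p x (G y) = inner_prod H x y"
    using P.q_inverse_exists by metis
  define R where "R = tensor_op K H T t (op_id K) G"
  have R: "R \<in> bounded_ops T" unfolding R_def by (rule tensor_op_bop[OF K.op_id_bop G])
  have Rt: "R (t x y) = t x (G y)" if "x \<in> carrier K" "y \<in> carrier H" for x y
    using that by (simp add: R_def tensor_op_t[OF K.op_id_bop G])
  obtain M where M: "M \<in> bounded_ops T"
    and pM: "\<And>u v. u \<in> carrier T \<Longrightarrow> v \<in> carrier T \<Longrightarrow> inner_prod T u (M v) = ?pT u v"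
    using PT.q_op_exists by metis
  \<comment> \<open>\<open>M\<close> is the operator P on the tensor product. That \<open>R\<close>
    is a right inverse is checked on elementary tensors, and \<open>pR\<close> then holds on all of
    \<open>T\<close>.\<close>
  have MR: "op_mult T M R = op_id T"
  proof (rule bop_weak_eqI[OF T.op_mult_bop[OF M R] T.op_id_bop])
    fix x y x' y' assume *: "x \<in> carrier K" "y \<in> carrier H" "x' \<in> carrier K" "y' \<in> carrier H"
    note Gy = H.bop_closed[OF G *(2)]
    have "inner_prod T (M (t x (G y))) (t x' y') = cnj (inner_prod T (t x' y') (M (t x (G y))))"
      by (rule T.ip_cnj) (use * Gy T.bop_closed[OF M] in auto)
    also have "\<dots> = cnj (inner_prod K x' x * ?p y' (G y))" using * Gy by (simp add: pM pT)
    also have "\<dots> = cnj (inner_prod K x' x * inner_prod H y' y)" using * by (simp add: pG)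
    also have "\<dots> = inner_prod T (t x y) (t x' y')"
      using * K.ip_cnj[of x' x] H.ip_cnj[of y' y] by simp
    finally show "inner_prod T (op_mult T M R (t x y)) (t x' y') = inner_prod T (op_id T (t x y)) (t x' y')"
      using * by (simp add: Rt)
  qed
  have pR: "?pT u (R v) = inner_prod T u v" if "u \<in> carrier T" "v \<in> carrier T" for u v
  proof -
    have "M (R v) = v" using fun_cong[OF MR, of v] that by simp
    then show ?thesis using pM[OF that(1) T.bop_closed[OF R that(2)]] by simp
  qed
  \<comment> \<open>P being at least the identity becomes the upper constant 1 here: the new norms
    are dominated by the old ones, so sums of elementary tensors stay dense.\<close>
  interpret Q: hrenorm H "\<lambda>x y. inner_prod H x (G y)" "1 / D" "1 / 1" by (rule P.hrenorm_G[OF G pG])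
  interpret QT: hrenorm T "\<lambda>u v. inner_prod T u (R v)" "1 / D" "1 / 1" by (rule PT.hrenorm_G[OF R pR])
  have ht: "htensor K Q.N QT.N t"
  proof (intro htensor.intro htensor_axioms.intro)
    show "hilbert_tensor K Q.N QT.N t"
      unfolding hilbert_tensor_def
    proof (intro conjI ballI allI impI)
      fix v and e :: real assume v: "v \<in> carrier QT.N" and e: "e > 0"
      have "\<exists>(N::nat) f g. (\<forall>i<N. f i \<in> carrier K \<and> g i \<in> carrier H) \<and>
          vnorm T (v \<ominus>\<^bsub>T\<^esub> finsum T (\<lambda>i. t (f i) (g i)) {..<N}) < e"
        using tensor v e unfolding hilbert_tensor_def by simp
      then obtain N f g where fg: "\<And>i. i < (N::nat) \<Longrightarrow> f i \<in> carrier K \<and> g i \<in> carrier H"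
        and d: "vnorm T (v \<ominus>\<^bsub>T\<^esub> finsum T (\<lambda>i. t (f i) (g i)) {..<N}) < e" by metis
      have "finsum T (\<lambda>i. t (f i) (g i)) {..<N} \<in> carrier T" using fg by auto
      then have "vnorm QT.N (v \<ominus>\<^bsub>T\<^esub> finsum T (\<lambda>i. t (f i) (g i)) {..<N}) \<le>
          sqrt (1 / 1) * vnorm T (v \<ominus>\<^bsub>T\<^esub> finsum T (\<lambda>i. t (f i) (g i)) {..<N})"
        using v by (intro QT.vnorm_N_le) simp
      then have "vnorm QT.N (v \<ominus>\<^bsub>QT.N\<^esub> finsum QT.N (\<lambda>i. t (f i) (g i)) {..<N}) < e" using d by simp
      then show "\<exists>(N::nat) f g. (\<forall>i<N. f i \<in> carrier K \<and> g i \<in> carrier Q.N) \<and>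
          vnorm QT.N (v \<ominus>\<^bsub>QT.N\<^esub> finsum QT.N (\<lambda>i. t (f i) (g i)) {..<N}) < e"
        using fg by (intro exI[of _ N] exI[of _ f] exI[of _ g]) simp
    qed (simp_all add: QT.N.hilbert t_add_left t_add_right t_smult_left t_smult_right Rt H.bop_closed[OF G])
  qed unfold_locales
  interpret T': htensor K Q.N QT.N t by (rule ht)
  have row: "row_norm Q.N X \<le> \<rho>"
  proof (rule Q.N.row_norm_leI[where B = "\<lambda>i. adjoint Q.N (X i)"])
    have XN: "X i \<in> bounded_ops Q.N" for i by (simp add: Q.bounded_ops_N Xb)
    note Z = Q.N.bop_closed[OF Q.N.adjoint_bop[OF XN]]
    show "X i \<in> bounded_ops Q.N" for i by (rule XN)
    show "adjoint Q.N (X i) y \<in> carrier Q.N" if "y \<in> carrier Q.N" for i y by (rule Z[OF that])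
    show "inner_prod Q.N (X i x) y = inner_prod Q.N x (adjoint Q.N (X i) y)"
      if "x \<in> carrier Q.N" "y \<in> carrier Q.N" for i x y
      by (rule Q.N.ip_adjoint[OF XN that])
    fix y assume yN: "y \<in> carrier Q.N"
    then have y: "y \<in> carrier H" by simp
    have Zy: "adjoint Q.N (X i) y \<in> carrier H" for i using Z[OF yN] by simp
    note Gy = H.bop_closed[OF G y]
    \<comment> \<open>\<open>G\<close> intertwines the new adjoint with the old one. With
      \<open>vQ\<close> the new norm of the new adjoint becomes the value of Rota's form to which
      \<open>rota_row\<close> applies.\<close>
    have GZ: "G (adjoint Q.N (X i) y) = adjoint H (X i) (G y)" for i
    proof (rule H.ip_right_eqI)
      fix x assume x: "x \<in> carrier H"
      have "inner_prod H x (G (adjoint Q.N (X i) y)) = inner_prod H (X i x) (G y)"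
        using Q.N.ip_adjoint[OF XN, of x y i] x y by simp
      also have "\<dots> = inner_prod H x (adjoint H (X i) (G y))" by (rule H.ip_adjoint[OF Xb x Gy])
      finally show "inner_prod H x (G (adjoint Q.N (X i) y)) = inner_prod H x (adjoint H (X i) (G y))" .
    qed (intro H.bop_closed[OF G] Zy H.bop_closed[OF H.adjoint_bop[OF Xb]] Gy)+
    have vQ: "(vnorm Q.N z)\<^sup>2 = Re (?p (G z) (G z))" if z: "z \<in> carrier H" for z
      using Q.N.vnorm_sq[of z] P.ip_G[OF G pG z z] z by simp
    have "(\<Sum>i\<in>UNIV. (vnorm Q.N (adjoint Q.N (X i) y))\<^sup>2) =
        (\<Sum>i\<in>UNIV. Re (?p (adjoint H (X i) (G y)) (adjoint H (X i) (G y))))"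
      by (simp only: vQ[OF Zy] GZ)
    also have "\<dots> \<le> \<rho>\<^sup>2 * Re (?p (G y) (G y))"
      unfolding B_def by (rule H.rota_row[of X, OF Xb \<rho>(1) sd Gy])
    also have "\<dots> = \<rho>\<^sup>2 * (vnorm Q.N y)\<^sup>2" by (simp only: vQ[OF y])
    finally show "(\<Sum>i\<in>UNIV. (vnorm Q.N (adjoint Q.N (X i) y))\<^sup>2) \<le> \<rho>\<^sup>2 * (vnorm Q.N y)\<^sup>2" .
  qed (use \<rho> in simp)
  have XQ: "X \<in> row_ball Q.N" using row \<rho> Xb by (simp add: row_ball_def Q.bounded_ops_N)
  define F where "F = free_eval K H T t A X"
  have F: "F \<in> bounded_ops T" unfolding F_def by (rule free_eval_bop[OF A X])
  have FQ: "F \<in> bounded_ops QT.N" by (simp add: QT.bounded_ops_N F)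
  \<comment> \<open>The operator is the same for both inner products: pairing with \<open>y'\<close>
    in the new one is pairing with \<open>G y'\<close> in the old one, so the scalar series are
    those of the original value.\<close>
  have FF: "free_eval K Q.N QT.N t A X = F"
  proof (rule T'.free_eval_eqI[OF A XQ FQ])
    fix x x' y y' assume *: "x \<in> carrier K" "x' \<in> carrier K" "y \<in> carrier Q.N" "y' \<in> carrier Q.N"
    then have y: "y \<in> carrier H" "y' \<in> carrier H" by simp_all
    show "(\<lambda>k. \<Sum>w\<in>words k. inner_prod K (A w x) x' * inner_prod Q.N (word_op Q.N X w y) y')
      sums inner_prod QT.N (F (t x y)) (t x' y')"
      using free_eval_weak[OF A X *(1,2) y(1) H.bop_closed[OF G y(2)]] * y
      by (simp add: Q.word_op_N Rt F_def)
  qed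
  have "op_norm QT.N F \<le> row_norm Q.N X ^ m"
    using T'.free_eval_schwarz[OF A le1[OF ht] A0 XQ] unfolding FF .
  also have "\<dots> \<le> \<rho> ^ m"
    by (rule power_mono[OF row]) (use T'.row_ballD[OF XQ] in \<open>auto intro: Q.N.row_norm_nonneg\<close>)
  finally have le: "op_norm QT.N F \<le> \<rho> ^ m" .
  have "op_spectral_radius QT.N F \<le> op_norm QT.N F"
    by (rule QT.N.op_spectral_radius_le[OF FQ QT.N.op_norm_nonneg[OF FQ] QT.N.op_norm_bound[OF FQ]])
  then show ?thesis using le by (simp add: QT.op_spectral_radius_N F_def)
qed

theorem theorem2p4:
  fixes K H :: "'u hilbert"
    and A :: "'n::finite list \<Rightarrow> 'u \<Rightarrow> 'u"
    and m :: nat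
  assumes "complex_hilbert_space K" and "complex_hilbert_space H"
    and "free_holomorphic K A"
    and "free_sup_norm K A \<le> 1"
    and "m \<ge> 1"
    and "\<And>w. length w \<le> m - 1 \<Longrightarrow> A w = op_zero K"
  shows "(\<forall>(T :: 't hilbert) t X. hilbert_tensor K H T t \<longrightarrow> X \<in> row_ball H \<longrightarrow>
           op_norm T (free_eval K H T t A X) \<le> row_norm H X ^ m \<and>
           op_spectral_radius T (free_eval K H T t A X) \<le> joint_spectral_radius H X ^ m) \<and>
         (\<forall>k\<ge>m. sqrt (coeff_norm K A k) \<le> 1)"
proof (intro conjI allI impI)
  interpret K: hilb K by (rule hilb.intro[OF assms(1)])
  show "sqrt (coeff_norm K A k) \<le> 1" for k
    using K.coeff_norm_le_1[OF assms(3,4), of k] by simp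
  have A0: "A w = op_zero K" if "length w < m" for w by (rule assms(6)) (use that in simp)
  \<comment> \<open>Spaces on \<open>'u\<close> need no copying, so the identity serves as
    injection, whereas the tensor product may have any type of vectors. The bound is needed for all
    \<open>H'\<close> and \<open>T'\<close> because it is also used after renorming.\<close>
  have le1: "op_norm T' (free_eval K H' T' t' A Y) \<le> 1"
    if "htensor K H' T' t'" "Y \<in> row_ball H'" for H' :: "'u hilbert" and T' :: "'t hilbert" and t' Y
    using order_trans[OF op_norm_le_free_sup_norm[OF that(1) inj_on_id assms(3) that(2)] assms(4)]
    by (simp only: one_ereal_def ereal_less_eq(3))
  fix T :: "'t hilbert" and t and X :: "'n \<Rightarrow> 'u \<Rightarrow> 'u"
  assume t: "hilbert_tensor K H T t" and X: "X \<in> row_ball H"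
  have ht: "htensor K H T t"
    by (intro htensor.intro htensor_axioms.intro hilb.intro t assms(1,2))
       (use t in \<open>simp add: hilbert_tensor_def\<close>)
  interpret htensor K H T t by (rule ht)
  show "op_norm T (free_eval K H T t A X) \<le> row_norm H X ^ m"
    by (rule free_eval_schwarz[OF assms(3) le1[OF ht] A0 X])
  note Xb = row_ballD(1)[OF X]
  from H.word_norm_nonneg[of X, OF Xb] H.word_norm_add[of X, OF Xb]
  obtain L where lim: "(\<lambda>k. word_norm H X k powr (1 / (2 * real k))) \<longlonglongrightarrow> L" and L0: "0 \<le> L"
    and sm: "\<And>\<rho>. L < \<rho> \<Longrightarrow> summable (\<lambda>k. word_norm H X k / \<rho> ^ (2 * k))"
    and Lc: "\<And>c. 0 \<le> c \<Longrightarrow> (\<And>k. word_norm H X k \<le> (c\<^sup>2) ^ k) \<Longrightarrow> L \<le> c"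
    using root_limit_submultiplicative[of "word_norm H X" thesis] by blast
  \<comment> \<open>The row norm bounds the limit, which leaves room for some \<open>\<rho>\<close>
    between \<open>L\<close> and 1.\<close>
  have L1: "L < 1"
    using Lc[OF H.row_norm_nonneg[OF Xb] H.word_norm_le_row_norm[of X, OF Xb]] row_ballD(2)[OF X] by simp
  have "joint_spectral_radius H X = L"
    unfolding joint_spectral_radius_def word_norm_def[symmetric] by (rule limI[OF lim])
  moreover have "op_spectral_radius T (free_eval K H T t A X) \<le> L ^ m"
  \<comment> \<open>Rota's series requires \<open>\<rho>\<close> strictly above \<open>L\<close>;
    the limit from the right gives the bound at \<open>L\<close>, including
    \<open>L = 0\<close>.\<close>
  proof (rule tendsto_lowerbound)
    show "((\<lambda>\<rho>. \<rho> ^ m) \<longlongrightarrow> L ^ m) (at_right L)" by (intro tendsto_intros)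
    show "\<forall>\<^sub>F \<rho> in at_right L. op_spectral_radius T (free_eval K H T t A X) \<le> \<rho> ^ m"
      unfolding eventually_at_right_field
    proof (intro exI[of _ 1] conjI allI impI)
      fix \<rho> assume \<rho>: "L < \<rho>" "\<rho> < 1"
      have "0 < \<rho>" using \<rho>(1) L0 by simp
      then show "op_spectral_radius T (free_eval K H T t A X) \<le> \<rho> ^ m"
        by (intro op_spectral_radius_free_eval_le[OF assms(3) _ A0 X _ \<rho>(2) sm[OF \<rho>(1)]] le1)
    qed (rule L1)
  qed simp
  ultimately show "op_spectral_radius T (free_eval K H T t A X) \<le> joint_spectral_radius H X ^ m" by simp
qed

end
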